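(* Over $\mathsf{RCA}_0$ the following are equivalent: (1) $\Pi^1_1\text{-}\mathsf{CA}_0$; (2) for every sequence of graphs $\langle G_i : i\in\mathbb{N}\rangle$ there is a set $Z\subseteq\mathbb{N}$ such that $i\in Z$ if and only if $G_i$ has a Hamilton path.
   Context: Work in second-order arithmetic, whose number variables range over $\mathbb{N}$ and set variables over subsets of $\mathbb{N}$; finite sequences, functions, sequences of graphs, etc. are coded by sets of natural numbers in the standard way. $\mathsf{RCA}_0$ is the subsystem consisting of the basic axioms of Peano arithmetic, induction restricted to $\Sigma^0_1$ formulas, and recursive comprehension (any set definable by both a $\Sigma^0_1$ formula and a $\Pi^0_1$ formula, with set parameters, exists). $\Pi^1_1\text{-}\mathsf{CA}_0$ is $\mathsf{RCA}_0$ together with the comprehension scheme asserting that $\{n\in\mathbb{N}:\Psi(n)\}$ exists for every $\Pi^1_1$ formula $\Psi$ (set parameters allowed). A graph $G=\langle V,E\rangle$ has vertex set $V\subseteq\mathbb{N}$ and edge set $E$ a set of unordered pairs of elements of $V$. A path in $G$ is a sequence of vertices $v_0,v_1,v_2,\dots$ (indexed by $\mathbb{N}$) such that $(v_i,v_{i+1})\in E$ for every $i$; it is a (one-way) Hamilton path if it uses every vertex of $G$ exactly once. *)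

theory Defs
  imports Main
begin

section \<open>The language of second-order arithmetic\<close>

text \<open>
  Two-sorted de Bruijn syntax: number variables and set variables are counted separately, so a
  number quantifier shifts only number indices and a set quantifier only set indices.  As usual
  there is no primitive equality between sets.
\<close>

datatype trm =
    Var nat
  | TZero  ("\<zero>")
  | TOne  ("\<one>")
  | TAdd trm trm  (infixl "\<oplus>" 65)
  | TMul trm trm  (infixl "\<otimes>" 70)

datatype fm =
    FEq trm trm  (infix "\<doteq>" 50)
  | FLess trm trm  (infix "\<prec>" 50)
  | FMem trm nat  (infix "\<epsilon>" 50)
  | Falsum  ("\<^bold>\<bottom>")
  | FImp fm fm  (infixr "\<^bold>\<longrightarrow>" 25)
  | AllN fm
  | AllS fm

abbreviation FNot :: "fm \<Rightarrow> fm"  ("\<^bold>\<not> _" [40] 40) where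
  "\<^bold>\<not> \<phi> \<equiv> \<phi> \<^bold>\<longrightarrow> \<^bold>\<bottom>"

abbreviation FAnd :: "fm \<Rightarrow> fm \<Rightarrow> fm"  (infixr "\<^bold>\<and>" 35) where
  "\<phi> \<^bold>\<and> \<psi> \<equiv> \<^bold>\<not> (\<phi> \<^bold>\<longrightarrow> \<^bold>\<not> \<psi>)"

abbreviation FOr :: "fm \<Rightarrow> fm \<Rightarrow> fm"  (infixr "\<^bold>\<or>" 30) where
  "\<phi> \<^bold>\<or> \<psi> \<equiv> \<^bold>\<not> \<phi> \<^bold>\<longrightarrow> \<psi>"

abbreviation FIff :: "fm \<Rightarrow> fm \<Rightarrow> fm"  (infix "\<^bold>\<longleftrightarrow>" 25) where
  "\<phi> \<^bold>\<longleftrightarrow> \<psi> \<equiv> (\<phi> \<^bold>\<longrightarrow> \<psi>) \<^bold>\<and> (\<psi> \<^bold>\<longrightarrow> \<phi>)"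

abbreviation ExN :: "fm \<Rightarrow> fm" where
  "ExN \<phi> \<equiv> \<^bold>\<not> AllN (\<^bold>\<not> \<phi>)"

abbreviation ExS :: "fm \<Rightarrow> fm" where
  "ExS \<phi> \<equiv> \<^bold>\<not> AllS (\<^bold>\<not> \<phi>)"

text \<open>
  Simultaneous capture-avoiding substitution of terms \<open>\<sigma>\<close> for number variables and of set
  variables \<open>\<rho>\<close> for set variables.
\<close>

primrec subst_trm :: "(nat \<Rightarrow> trm) \<Rightarrow> trm \<Rightarrow> trm" where
  "subst_trm \<sigma> (Var i) = \<sigma> i"
| "subst_trm \<sigma> \<zero> = \<zero>"
| "subst_trm \<sigma> \<one> = \<one>"
| "subst_trm \<sigma> (s \<oplus> t) = subst_trm \<sigma> s \<oplus> subst_trm \<sigma> t"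
| "subst_trm \<sigma> (s \<otimes> t) = subst_trm \<sigma> s \<otimes> subst_trm \<sigma> t"

definition lift_trm :: "trm \<Rightarrow> trm" where
  "lift_trm = subst_trm (\<lambda>i. Var (Suc i))"

primrec subst :: "(nat \<Rightarrow> trm) \<Rightarrow> (nat \<Rightarrow> nat) \<Rightarrow> fm \<Rightarrow> fm" where
  "subst \<sigma> \<rho> (s \<doteq> t) = (subst_trm \<sigma> s \<doteq> subst_trm \<sigma> t)"
| "subst \<sigma> \<rho> (s \<prec> t) = (subst_trm \<sigma> s \<prec> subst_trm \<sigma> t)"
| "subst \<sigma> \<rho> (t \<epsilon> X) = (subst_trm \<sigma> t \<epsilon> \<rho> X)"
| "subst \<sigma> \<rho> \<^bold>\<bottom> = \<^bold>\<bottom>"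
| "subst \<sigma> \<rho> (\<phi> \<^bold>\<longrightarrow> \<psi>) = (subst \<sigma> \<rho> \<phi> \<^bold>\<longrightarrow> subst \<sigma> \<rho> \<psi>)"
| "subst \<sigma> \<rho> (AllN \<phi>) = AllN (subst (case_nat (Var 0) (\<lambda>i. lift_trm (\<sigma> i))) \<rho> \<phi>)"
| "subst \<sigma> \<rho> (AllS \<phi>) = AllS (subst \<sigma> (case_nat 0 (\<lambda>X. Suc (\<rho> X))) \<phi>)"

definition liftN :: "fm \<Rightarrow> fm" where
  "liftN = subst (\<lambda>i. Var (Suc i)) (\<lambda>X. X)"

definition liftS :: "fm \<Rightarrow> fm" where
  "liftS = subst Var Suc"

definition instN :: "fm \<Rightarrow> trm \<Rightarrow> fm" where
  "instN \<phi> t = subst (case_nat t Var) (\<lambda>X. X) \<phi>"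

definition instS :: "fm \<Rightarrow> nat \<Rightarrow> fm" where
  "instS \<phi> X = subst Var (case_nat X (\<lambda>Y. Y)) \<phi>"


section \<open>Provability\<close>

text \<open>
  Classical two-sorted natural deduction with equality.  \<open>T\<close> is a set of axioms and \<open>\<Gamma>\<close> a list of
  open hypotheses.  Free variables of axioms are read universally (in contrast to those of
  hypotheses): the generalisation rules constrain \<open>\<Gamma>\<close> only, so an axiom may be replaced by its
  universal closure.
\<close>

inductive deriv :: "fm set \<Rightarrow> fm list \<Rightarrow> fm \<Rightarrow> bool" for T :: "fm set" where
  Ax: "\<phi> \<in> T \<Longrightarrow> deriv T \<Gamma> \<phi>"
| Hyp: "\<phi> \<in> set \<Gamma> \<Longrightarrow> deriv T \<Gamma> \<phi>"
| ImpI: "deriv T (\<phi> # \<Gamma>) \<psi> \<Longrightarrow> deriv T \<Gamma> (\<phi> \<^bold>\<longrightarrow> \<psi>)"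
| ImpE: "deriv T \<Gamma> (\<phi> \<^bold>\<longrightarrow> \<psi>) \<Longrightarrow> deriv T \<Gamma> \<phi> \<Longrightarrow> deriv T \<Gamma> \<psi>"
| Raa: "deriv T ((\<^bold>\<not> \<phi>) # \<Gamma>) \<^bold>\<bottom> \<Longrightarrow> deriv T \<Gamma> \<phi>"
| AllNI: "deriv T (map liftN \<Gamma>) \<phi> \<Longrightarrow> deriv T \<Gamma> (AllN \<phi>)"
| AllNE: "deriv T \<Gamma> (AllN \<phi>) \<Longrightarrow> deriv T \<Gamma> (instN \<phi> t)"
| AllSI: "deriv T (map liftS \<Gamma>) \<phi> \<Longrightarrow> deriv T \<Gamma> (AllS \<phi>)"
| AllSE: "deriv T \<Gamma> (AllS \<phi>) \<Longrightarrow> deriv T \<Gamma> (instS \<phi> X)"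
| EqRefl: "deriv T \<Gamma> (t \<doteq> t)"
| EqSubst: "deriv T \<Gamma> (s \<doteq> t) \<Longrightarrow> deriv T \<Gamma> (instN \<phi> s) \<Longrightarrow> deriv T \<Gamma> (instN \<phi> t)"

definition proves :: "fm set \<Rightarrow> fm \<Rightarrow> bool"  (infix "\<turnstile>" 50) where
  "T \<turnstile> \<phi> \<longleftrightarrow> deriv T [] \<phi>"

definition equivalent_over :: "fm set \<Rightarrow> fm set \<Rightarrow> fm set \<Rightarrow> bool" where
  "equivalent_over T A B \<longleftrightarrow> (\<forall>\<phi>\<in>B. T \<union> A \<turnstile> \<phi>) \<and> (\<forall>\<phi>\<in>A. T \<union> B \<turnstile> \<phi>)"


section \<open>Formula classes\<close>

text \<open>
  Bounded existential quantifiers are covered too: \<open>\<exists>n<t. \<phi>\<close> is \<open>\<not> (\<forall>n<t. \<not> \<phi>)\<close>.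
  The lifting of \<open>t\<close> says that the bound does not contain the quantified variable.
\<close>

inductive bounded :: "fm \<Rightarrow> bool" where
  "bounded (s \<doteq> t)"
| "bounded (s \<prec> t)"
| "bounded (t \<epsilon> X)"
| "bounded \<^bold>\<bottom>"
| "bounded \<phi> \<Longrightarrow> bounded \<psi> \<Longrightarrow> bounded (\<phi> \<^bold>\<longrightarrow> \<psi>)"
| "bounded \<phi> \<Longrightarrow> bounded (AllN (Var 0 \<prec> lift_trm t \<^bold>\<longrightarrow> \<phi>))"

primrec arithmetical :: "fm \<Rightarrow> bool" where
  "arithmetical (s \<doteq> t) \<longleftrightarrow> True"
| "arithmetical (s \<prec> t) \<longleftrightarrow> True"
| "arithmetical (t \<epsilon> X) \<longleftrightarrow> True"
| "arithmetical \<^bold>\<bottom> \<longleftrightarrow> True"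
| "arithmetical (\<phi> \<^bold>\<longrightarrow> \<psi>) \<longleftrightarrow> arithmetical \<phi> \<and> arithmetical \<psi>"
| "arithmetical (AllN \<phi>) \<longleftrightarrow> arithmetical \<phi>"
| "arithmetical (AllS \<phi>) \<longleftrightarrow> False"

definition Sigma01 :: "fm set" where
  "Sigma01 = {ExN \<theta> |\<theta>. bounded \<theta>}"

definition Pi01 :: "fm set" where
  "Pi01 = {AllN \<theta> |\<theta>. bounded \<theta>}"

definition Pi11 :: "fm set" where
  "Pi11 = {AllS \<theta> |\<theta>. arithmetical \<theta>}"


section \<open>The axiom systems\<close>

definition basic_axioms :: "fm set" where
  "basic_axioms =
    {\<^bold>\<not> (Var 0 \<oplus> \<one> \<doteq> \<zero>),
     Var 0 \<oplus> \<one> \<doteq> Var 1 \<oplus> \<one> \<^bold>\<longrightarrow> Var 0 \<doteq> Var 1,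
     Var 0 \<oplus> \<zero> \<doteq> Var 0,
     Var 0 \<oplus> (Var 1 \<oplus> \<one>) \<doteq> (Var 0 \<oplus> Var 1) \<oplus> \<one>,
     Var 0 \<otimes> \<zero> \<doteq> \<zero>,
     Var 0 \<otimes> (Var 1 \<oplus> \<one>) \<doteq> (Var 0 \<otimes> Var 1) \<oplus> Var 0,
     \<^bold>\<not> (Var 0 \<prec> \<zero>),
     Var 0 \<prec> Var 1 \<oplus> \<one> \<^bold>\<longleftrightarrow> (Var 0 \<prec> Var 1 \<^bold>\<or> Var 0 \<doteq> Var 1)}"

text \<open>
  In the schemes, the distinguished variable \<open>n\<close> of a formula is \<open>Var 0\<close>; all other free
  variables are parameters.
\<close>

definition induction :: "fm \<Rightarrow> fm" where
  "induction \<phi> =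
    (instN \<phi> \<zero>
      \<^bold>\<and> AllN (\<phi> \<^bold>\<longrightarrow> subst (case_nat (Var 0 \<oplus> \<one>) (\<lambda>i. Var (Suc i))) (\<lambda>X. X) \<phi>)
      \<^bold>\<longrightarrow> AllN \<phi>)"

text \<open>The lifting ensures that the set asserted to exist is not free in the defining formula.\<close>

definition comprehension :: "fm \<Rightarrow> fm" where
  "comprehension \<phi> = ExS (AllN (Var 0 \<epsilon> 0 \<^bold>\<longleftrightarrow> liftS \<phi>))"

definition RCA0 :: "fm set" where
  "RCA0 = basic_axioms
    \<union> {induction \<phi> |\<phi>. \<phi> \<in> Sigma01}
    \<union> {AllN (\<phi> \<^bold>\<longleftrightarrow> \<psi>) \<^bold>\<longrightarrow> comprehension \<phi> |\<phi> \<psi>. \<phi> \<in> Sigma01 \<and> \<psi> \<in> Pi01}"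

definition Pi11_CA0 :: "fm set" where
  "Pi11_CA0 = RCA0 \<union> {comprehension \<psi> |\<psi>. \<psi> \<in> Pi11}"


section \<open>Sequences of graphs and Hamilton paths\<close>

text \<open>The pairing function \<open>(i + j)\<^sup>2 + i\<close>, which is injective provably in \<open>RCA0\<close>.\<close>

definition pair :: "trm \<Rightarrow> trm \<Rightarrow> trm" where
  "pair s t = (s \<oplus> t) \<otimes> (s \<oplus> t) \<oplus> s"

text \<open>
  A sequence of graphs \<open>G\<^sub>i = (V\<^sub>i, E\<^sub>i)\<close> is given by two sets \<open>V\<close> and \<open>E\<close>, where \<open>v \<in> V\<^sub>i\<close> iff
  \<open>(i, v) \<in> V\<close>, and \<open>{u, v} \<in> E\<^sub>i\<close> iff \<open>(i, (u, v)) \<in> E\<close>.  Edges being unordered pairs, \<open>E\<^sub>i\<close> is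
  symmetric and irreflexive as a set of ordered pairs.

  The arguments \<open>V\<close>, \<open>E\<close>, \<open>P\<close> below are set variables; there are no set quantifiers in
  these formulas, so they need no shifting.  The number variable \<open>i\<close> appears as \<open>Var (i + k)\<close>
  below \<open>k\<close> number quantifiers.
\<close>

definition vertex_in :: "trm \<Rightarrow> nat \<Rightarrow> trm \<Rightarrow> fm" where
  "vertex_in v V i = (pair i v \<epsilon> V)"

definition edge_in :: "trm \<Rightarrow> trm \<Rightarrow> nat \<Rightarrow> trm \<Rightarrow> fm" where
  "edge_in u v E i = (pair i (pair u v) \<epsilon> E)"

text \<open>Bound variables: \<open>i = Var 2\<close>, \<open>u = Var 1\<close>, \<open>v = Var 0\<close>.\<close>

definition graph_sequence :: "nat \<Rightarrow> nat \<Rightarrow> fm" where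
  "graph_sequence V E =
    AllN (AllN (AllN (edge_in (Var 1) (Var 0) E (Var 2) \<^bold>\<longrightarrow>
      vertex_in (Var 1) V (Var 2) \<^bold>\<and> vertex_in (Var 0) V (Var 2)
      \<^bold>\<and> \<^bold>\<not> (Var 1 \<doteq> Var 0)
      \<^bold>\<and> edge_in (Var 0) (Var 1) E (Var 2))))"

text \<open>\<open>\<forall>n. \<exists>m. P n = m \<and> (\<forall>k. P n = k \<longrightarrow> k = m)\<close>\<close>

definition total_function :: "nat \<Rightarrow> fm" where
  "total_function P =
    AllN (ExN (pair (Var 1) (Var 0) \<epsilon> P
      \<^bold>\<and> AllN (pair (Var 2) (Var 0) \<epsilon> P \<^bold>\<longrightarrow> Var 0 \<doteq> Var 1)))"

text \<open>
  \<open>\<forall>n u. P n = u \<longrightarrow> u \<in> V\<^sub>i\<close> and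
  \<open>\<forall>n u v. P n = u \<and> P (n + 1) = v \<longrightarrow> (u, v) \<in> E\<^sub>i\<close>
\<close>

definition path :: "nat \<Rightarrow> nat \<Rightarrow> nat \<Rightarrow> nat \<Rightarrow> fm" where
  "path P V E i =
    (total_function P
     \<^bold>\<and> AllN (AllN (pair (Var 1) (Var 0) \<epsilon> P \<^bold>\<longrightarrow> vertex_in (Var 0) V (Var (i + 2))))
     \<^bold>\<and> AllN (AllN (AllN (pair (Var 2) (Var 1) \<epsilon> P \<^bold>\<and> pair (Var 2 \<oplus> \<one>) (Var 0) \<epsilon> P
          \<^bold>\<longrightarrow> edge_in (Var 1) (Var 0) E (Var (i + 3))))))"

text \<open>\<open>\<forall>v. v \<in> V\<^sub>i \<longrightarrow> (\<exists>n. P n = v \<and> (\<forall>m. P m = v \<longrightarrow> m = n))\<close>\<close>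

definition hamilton_path :: "nat \<Rightarrow> nat \<Rightarrow> nat \<Rightarrow> nat \<Rightarrow> fm" where
  "hamilton_path P V E i =
    (path P V E i
     \<^bold>\<and> AllN (vertex_in (Var 0) V (Var (i + 1)) \<^bold>\<longrightarrow>
          ExN (pair (Var 0) (Var 1) \<epsilon> P
            \<^bold>\<and> AllN (pair (Var 0) (Var 2) \<epsilon> P \<^bold>\<longrightarrow> Var 0 \<doteq> Var 1))))"

text \<open>
  \<open>\<forall>V E. graph_sequence V E \<longrightarrow> (\<exists>Z. \<forall>i. i \<in> Z \<longleftrightarrow> (\<exists>P. hamilton_path P V E i))\<close>.
  In the scope of all four set quantifiers, \<open>V = 3\<close>, \<open>E = 2\<close>, \<open>Z = 1\<close>, \<open>P = 0\<close>.
\<close>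

definition hamilton_sets_exist :: fm where
  "hamilton_sets_exist =
    AllS (AllS (graph_sequence 1 0 \<^bold>\<longrightarrow>
      ExS (AllN (Var 0 \<epsilon> 0 \<^bold>\<longleftrightarrow> ExS (hamilton_path 0 3 2 0)))))"

end

theory Submission
  imports Defs "HOL-Library.Countable_Set"
begin

text \<open>
  By completeness of the calculus, both implications can be checked in countable models of \<open>RCA0\<close>.
  Having a Hamilton path is a \<open>\<Sigma>\<close>-property (one existential set quantifier), so \<open>\<Pi>\<close>-comprehension
  decides it. Conversely, satisfiability of a countable set of infinite clauses reduces to the
  existence of a Hamilton path. The reduction is arranged such that the satisfying assignment and the
  path are bounded-definable from each other (each stage of the path has the same length), so that no
  coding of finite sequences and no recursion is needed in \<open>RCA0\<close>. Satisfiability of the clauses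
  \<open>{x. (i, x) \<in> A}\<close> is projection, which yields arithmetical comprehension; Tarski's conditions on a
  truth set, read as clauses, then express any \<open>\<Sigma>\<close>-formula as a satisfiability problem.
\<close>

section \<open>Substitution\<close>

text \<open>The models that completeness supplies are Henkin models, possibly nonstandard in both
  sorts. Inside one only recursive comprehension and \<Sigma>-induction are available, so every set
  that a reduction produces must be shown to lie in \<open>Sets\<close>. Clauses have to be
  infinite: by compactness the satisfiability of finite clauses is arithmetical, whereas "every
  clause has a true literal" with infinite clauses contains the alternation \<forall>\<exists> in
  the normal form of a formula with one existential set quantifier. A literal may serve infinitely
  many clauses, but a path visits a vertex only once; so every literal gets one copy per clause, and
  the graph has to keep the copies consistent. Projection comes before the truth sets because a true
  formula must yield its truth set as an element of the model, and the slices of that set are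
  arithmetical in the witness.\<close>

lemma subst_trm_subst_trm:
  "subst_trm \<sigma> (subst_trm \<tau> t) = subst_trm (\<lambda>i. subst_trm \<sigma> (\<tau> i)) t"
  by (induction t) auto

lemma subst_trm_Var [simp]: "subst_trm Var t = t"
  by (induction t) auto

lemma subst_trm_lift_trm: "subst_trm \<sigma> (lift_trm t) = subst_trm (\<lambda>i. \<sigma> (Suc i)) t"
  by (simp add: lift_trm_def subst_trm_subst_trm)

lemma lift_trm_subst_trm: "lift_trm (subst_trm \<sigma> t) = subst_trm (\<lambda>i. lift_trm (\<sigma> i)) t"
  by (simp add: lift_trm_def subst_trm_subst_trm)

lemma lift_trm_Var [simp]: "lift_trm (Var i) = Var (Suc i)"
  by (simp add: lift_trm_def)

lemma subst_subst:
  "subst \<sigma> \<rho> (subst \<tau> \<pi> \<phi>) = subst (\<lambda>i. subst_trm \<sigma> (\<tau> i)) (\<lambda>X. \<rho> (\<pi> X)) \<phi>"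
proof (induction \<phi> arbitrary: \<sigma> \<rho> \<tau> \<pi>)
  case (AllN \<phi>)
  have "(\<lambda>i. subst_trm (case_nat (Var 0) (\<lambda>i. lift_trm (\<sigma> i)))
           (case i of 0 \<Rightarrow> Var 0 | Suc i \<Rightarrow> lift_trm (\<tau> i)))
      = case_nat (Var 0) (\<lambda>i. lift_trm (subst_trm \<sigma> (\<tau> i)))"
    by (auto simp: fun_eq_iff subst_trm_lift_trm lift_trm_subst_trm split: nat.split)
  then show ?case by (simp add: AllN)
next
  case (AllS \<phi>)
  have "(\<lambda>X. case_nat 0 (\<lambda>X. Suc (\<rho> X)) (case_nat 0 (\<lambda>X. Suc (\<pi> X)) X))
      = case_nat 0 (\<lambda>X. Suc (\<rho> (\<pi> X)))"
    by (auto simp: fun_eq_iff split: nat.split)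
  then show ?case by (simp add: AllS)
qed (simp_all add: subst_trm_subst_trm)

lemma case_nat_Var_Suc [simp]: "case_nat (Var 0) (\<lambda>i. Var (Suc i)) = Var"
  by (auto simp: fun_eq_iff split: nat.split)

lemma case_nat_0_Suc [simp]: "case_nat 0 Suc = (\<lambda>X. X)"
  by (auto simp: fun_eq_iff split: nat.split)

lemma subst_Var [simp]: "subst Var (\<lambda>X. X) \<phi> = \<phi>"
  by (induction \<phi>) simp_all

text \<open>The substitution on the left is the one that \<open>subst\<close> pushes under
  \<open>AllN\<close>; instantiating afterwards cancels the lift. An instance of a substituted
  quantifier is thus again one simultaneous substitution, which is what the truth lemma of the
  completeness proof iterates.\<close>

lemma instN_subst:
  "instN (subst (case_nat (Var 0) (\<lambda>i. lift_trm (\<sigma> i))) \<rho> \<phi>) t = subst (case_nat t \<sigma>) \<rho> \<phi>"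
proof -
  have "(\<lambda>i. subst_trm (case_nat t Var) (case i of 0 \<Rightarrow> Var 0 | Suc i \<Rightarrow> lift_trm (\<sigma> i)))
      = case_nat t \<sigma>"
    by (auto simp: fun_eq_iff subst_trm_lift_trm split: nat.split)
  then show ?thesis by (simp add: instN_def subst_subst)
qed

lemma instS_subst: "instS (subst \<sigma> (case_nat 0 (\<lambda>X. Suc (\<rho> X))) \<phi>) Y = subst \<sigma> (case_nat Y \<rho>) \<phi>"
proof -
  have "(\<lambda>X. case_nat Y (\<lambda>Y. Y) (case_nat 0 (\<lambda>X. Suc (\<rho> X)) X)) = case_nat Y \<rho>"
    by (auto simp: fun_eq_iff split: nat.split)
  then show ?thesis by (simp add: instS_def subst_subst)
qed

lemma subst_instN: "subst \<sigma> \<rho> (instN \<phi> t) = subst (case_nat (subst_trm \<sigma> t) \<sigma>) \<rho> \<phi>"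
proof -
  have "(\<lambda>i. subst_trm \<sigma> (case_nat t Var i)) = case_nat (subst_trm \<sigma> t) \<sigma>"
    by (auto simp: fun_eq_iff split: nat.split)
  then show ?thesis by (simp add: instN_def subst_subst)
qed

lemma subst_instS: "subst \<sigma> \<rho> (instS \<phi> Y) = subst \<sigma> (case_nat (\<rho> Y) \<rho>) \<phi>"
proof -
  have "(\<lambda>X. \<rho> (case_nat Y (\<lambda>Y. Y) X)) = case_nat (\<rho> Y) \<rho>"
    by (auto simp: fun_eq_iff split: nat.split)
  then show ?thesis by (simp add: instS_def subst_subst)
qed

lemma subst_liftN: "subst \<sigma> \<rho> (liftN \<phi>) = subst (\<lambda>i. \<sigma> (Suc i)) \<rho> \<phi>"
  by (simp add: liftN_def subst_subst)

lemma liftN_subst: "liftN (subst \<sigma> \<rho> \<phi>) = subst (\<lambda>i. lift_trm (\<sigma> i)) \<rho> \<phi>"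
  by (simp add: liftN_def subst_subst lift_trm_def)

lemma subst_liftS: "subst \<sigma> \<rho> (liftS \<phi>) = subst \<sigma> (\<lambda>X. \<rho> (Suc X)) \<phi>"
  by (simp add: liftS_def subst_subst)

lemma liftS_subst: "liftS (subst \<sigma> \<rho> \<phi>) = subst \<sigma> (\<lambda>X. Suc (\<rho> X)) \<phi>"
  by (simp add: liftS_def subst_subst)

lemma instN_liftN_trm [simp]: "subst_trm (case_nat t Var) (lift_trm s) = s"
  by (simp add: subst_trm_lift_trm)

text \<open>Says through substitution that variables from \<open>m\<close> on do not occur free; one
  bound serves both sorts, and any variable beyond it is fresh. Sets of free variables never have to
  be computed.\<close>

definition supported :: "nat \<Rightarrow> fm \<Rightarrow> bool" where
  "supported m \<phi> \<longleftrightarrow>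
    (\<forall>\<sigma> \<tau> \<rho> \<pi>. (\<forall>i<m. \<sigma> i = \<tau> i \<and> \<rho> i = \<pi> i) \<longrightarrow> subst \<sigma> \<rho> \<phi> = subst \<tau> \<pi> \<phi>)"

lemma supported_mono: "supported m \<phi> \<Longrightarrow> m \<le> n \<Longrightarrow> supported n \<phi>"
  unfolding supported_def by (meson order_less_le_trans)

lemma trm_support_exists:
  "\<exists>m. \<forall>\<sigma> \<tau>. (\<forall>i<m. \<sigma> i = \<tau> i) \<longrightarrow> subst_trm \<sigma> t = subst_trm \<tau> t"
proof (induction t)
  case (Var i)
  then show ?case by (auto intro!: exI[of _ "Suc i"])
next
  case (TAdd s t)
  then obtain m n where
    "\<forall>\<sigma> \<tau>. (\<forall>i<m. \<sigma> i = \<tau> i) \<longrightarrow> subst_trm \<sigma> s = subst_trm \<tau> s"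
    "\<forall>\<sigma> \<tau>. (\<forall>i<n. \<sigma> i = \<tau> i) \<longrightarrow> subst_trm \<sigma> t = subst_trm \<tau> t" by blast
  then show ?case by (intro exI[of _ "max m n"]) (auto simp: less_max_iff_disj)
next
  case (TMul s t)
  then obtain m n where
    "\<forall>\<sigma> \<tau>. (\<forall>i<m. \<sigma> i = \<tau> i) \<longrightarrow> subst_trm \<sigma> s = subst_trm \<tau> s"
    "\<forall>\<sigma> \<tau>. (\<forall>i<n. \<sigma> i = \<tau> i) \<longrightarrow> subst_trm \<sigma> t = subst_trm \<tau> t" by blast
  then show ?case by (intro exI[of _ "max m n"]) (auto simp: less_max_iff_disj)
qed auto

lemma trm_support_exists2:
  "\<exists>m. \<forall>\<sigma> \<tau>. (\<forall>i<m. \<sigma> i = \<tau> i) \<longrightarrow> subst_trm \<sigma> s = subst_trm \<tau> s \<and> subst_trm \<sigma> t = subst_trm \<tau> t"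
  using trm_support_exists[of "s \<oplus> t"] by simp

lemma support_exists: "\<exists>m. supported m \<phi>"
proof (induction \<phi>)
  case (FEq s t)
  then show ?case using trm_support_exists2[of s t] by (simp add: supported_def) metis
next
  case (FLess s t)
  then show ?case using trm_support_exists2[of s t] by (simp add: supported_def) metis
next
  case (FMem t X)
  obtain m where "\<forall>\<sigma> \<tau>. (\<forall>i<m. \<sigma> i = \<tau> i) \<longrightarrow> subst_trm \<sigma> t = subst_trm \<tau> t"
    using trm_support_exists by metis
  then show ?case
    by (intro exI[of _ "max m (Suc X)"]) (auto simp: supported_def less_max_iff_disj)
next
  case Falsum
  then show ?case by (simp add: supported_def)
next
  case (FImp \<phi> \<psi>)
  then obtain m n where "supported m \<phi>" "supported n \<psi>" by blast
  then have "supported (max m n) \<phi>" "supported (max m n) \<psi>"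
    by (auto intro: supported_mono)
  then show ?case
    by (intro exI[of _ "max m n"]) (force simp: supported_def)
next
  case (AllN \<phi>)
  then obtain m where m: "supported m \<phi>" by blast
  have "subst \<sigma> \<rho> (AllN \<phi>) = subst \<tau> \<pi> (AllN \<phi>)"
    if "\<forall>i<m. \<sigma> i = \<tau> i \<and> \<rho> i = \<pi> i" for \<sigma> \<tau> \<rho> \<pi>
    using that by (auto intro!: m[unfolded supported_def, rule_format] split: nat.split)
  then show ?case unfolding supported_def by blast
next
  case (AllS \<phi>)
  then obtain m where m: "supported m \<phi>" by blast
  have "subst \<sigma> \<rho> (AllS \<phi>) = subst \<tau> \<pi> (AllS \<phi>)"
    if "\<forall>i<m. \<sigma> i = \<tau> i \<and> \<rho> i = \<pi> i" for \<sigma> \<tau> \<rho> \<pi>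
    using that by (auto intro!: m[unfolded supported_def, rule_format] split: nat.split)
  then show ?case unfolding supported_def by blast
qed

lemma support_exists_list: "\<exists>m. \<forall>\<phi>\<in>set \<Gamma>. supported m \<phi>"
proof (induction \<Gamma>)
  case (Cons \<phi> \<Gamma>)
  then obtain m n where "\<forall>\<psi>\<in>set \<Gamma>. supported m \<psi>" "supported n \<phi>"
    using support_exists by metis
  then show ?case
    by (intro exI[of _ "max m n"]) (auto intro: supported_mono)
qed simp


section \<open>Admissible rules\<close>

lemma deriv_weaken: "deriv T \<Gamma> \<phi> \<Longrightarrow> set \<Gamma> \<subseteq> set \<Delta> \<Longrightarrow> deriv T \<Delta> \<phi>"
proof (induction arbitrary: \<Delta> rule: deriv.induct)
  case (ImpI \<phi> \<Gamma> \<psi>)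
  then show ?case by (intro deriv.ImpI ImpI.IH) auto
next
  case (Raa \<phi> \<Gamma>)
  show ?case by (rule deriv.Raa, rule Raa.IH) (use Raa.prems in auto)
next
  case (AllNI \<Gamma> \<phi>)
  then show ?case by (intro deriv.AllNI AllNI.IH) auto
next
  case (AllSI \<Gamma> \<phi>)
  then show ?case by (intro deriv.AllSI AllSI.IH) auto
next
  case (EqSubst \<Gamma> s t \<phi>)
  then show ?case by (blast intro: deriv.EqSubst)
qed (auto intro: deriv.intros)

text \<open>The outer \<open>m\<close> quantifiers are removed first. The terms chosen for them get
  lifted under the remaining quantifier, and \<open>instN_subst\<close> undoes the lift.\<close>

lemma deriv_AllN_power:
  "deriv T [] ((AllN ^^ m) \<phi>) \<Longrightarrow>
    deriv T [] (subst (\<lambda>i. if i < m then \<sigma> i else Var (i - m)) (\<lambda>X. X) \<phi>)"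
proof (induction m arbitrary: \<phi> \<sigma>)
  case (Suc m)
  let ?\<tau> = "\<lambda>i. if i < m then \<sigma> (Suc i) else Var (i - m)"
  have "deriv T [] ((AllN ^^ m) (AllN \<phi>))"
    using Suc.prems by (simp add: funpow_swap1)
  from Suc.IH[OF this, of "\<lambda>i. \<sigma> (Suc i)"]
  have "deriv T [] (AllN (subst (case_nat (Var 0) (\<lambda>i. lift_trm (?\<tau> i))) (\<lambda>X. X) \<phi>))"
    by simp
  then have "deriv T [] (subst (case_nat (\<sigma> 0) ?\<tau>) (\<lambda>X. X) \<phi>)"
    by (metis AllNE instN_subst)
  moreover have "case_nat (\<sigma> 0) ?\<tau> = (\<lambda>i. if i < Suc m then \<sigma> i else Var (i - Suc m))"
    by (auto simp: fun_eq_iff split: nat.split)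
  ultimately show ?case by simp
qed simp

lemma deriv_AllS_power:
  "deriv T [] ((AllS ^^ m) \<phi>) \<Longrightarrow>
    deriv T [] (subst Var (\<lambda>i. if i < m then \<rho> i else i - m) \<phi>)"
proof (induction m arbitrary: \<phi> \<rho>)
  case (Suc m)
  let ?\<tau> = "\<lambda>i. if i < m then \<rho> (Suc i) else i - m"
  have "deriv T [] ((AllS ^^ m) (AllS \<phi>))"
    using Suc.prems by (simp add: funpow_swap1)
  from Suc.IH[OF this, of "\<lambda>i. \<rho> (Suc i)"]
  have "deriv T [] (AllS (subst Var (case_nat 0 (\<lambda>i. Suc (?\<tau> i))) \<phi>))"
    by simp
  then have "deriv T [] (subst Var (case_nat (\<rho> 0) ?\<tau>) \<phi>)"
    by (metis AllSE instS_subst)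
  moreover have "case_nat (\<rho> 0) ?\<tau> = (\<lambda>i. if i < Suc m then \<rho> i else i - Suc m)"
    by (auto simp: fun_eq_iff split: nat.split)
  ultimately show ?case by simp
qed simp

text \<open>Without hypotheses the generalisation rules have no side condition, so all variables in
  the support can be quantified and then instantiated at once. This takes care of axioms, whose set
  need not be closed under substitution.\<close>

lemma deriv_Nil_subst:
  assumes "deriv T [] \<phi>"
  shows "deriv T \<Gamma> (subst \<sigma> \<rho> \<phi>)"
proof -
  obtain m where m: "supported m \<phi>" using support_exists by blast
  have "deriv T [] ((AllN ^^ m) \<phi>)" for m
    by (induction m) (use assms in \<open>auto intro: AllNI\<close>)
  then have "deriv T [] (subst (\<lambda>i. if i < m then \<sigma> i else Var (i - m)) (\<lambda>X. X) \<phi>)"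
    by (rule deriv_AllN_power)
  also have "subst (\<lambda>i. if i < m then \<sigma> i else Var (i - m)) (\<lambda>X. X) \<phi> = subst \<sigma> (\<lambda>X. X) \<phi>"
    using m by (auto simp: supported_def)
  finally have 1: "deriv T [] (subst \<sigma> (\<lambda>X. X) \<phi>)" .
  obtain n where n: "supported n (subst \<sigma> (\<lambda>X. X) \<phi>)" using support_exists by blast
  have "deriv T [] ((AllS ^^ n) (subst \<sigma> (\<lambda>X. X) \<phi>))" for n
    by (induction n) (use 1 in \<open>auto intro: AllSI\<close>)
  then have "deriv T [] (subst Var (\<lambda>i. if i < n then \<rho> i else i - n) (subst \<sigma> (\<lambda>X. X) \<phi>))"
    by (rule deriv_AllS_power)
  also have "\<dots> = subst Var \<rho> (subst \<sigma> (\<lambda>X. X) \<phi>)"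
    using n by (auto simp: supported_def)
  also have "\<dots> = subst \<sigma> \<rho> \<phi>" by (simp add: subst_subst)
  finally show ?thesis by (rule deriv_weaken) simp
qed

lemma deriv_subst: "deriv T \<Gamma> \<phi> \<Longrightarrow> deriv T (map (subst \<sigma> \<rho>) \<Gamma>) (subst \<sigma> \<rho> \<phi>)"
proof (induction arbitrary: \<sigma> \<rho> rule: deriv.induct)
  case (Ax \<phi> \<Gamma>)
  then show ?case by (intro deriv_Nil_subst deriv.Ax)
next
  case (AllNI \<Gamma> \<phi>)
  have "map (subst (case_nat (Var 0) (\<lambda>i. lift_trm (\<sigma> i))) \<rho>) (map liftN \<Gamma>)
      = map liftN (map (subst \<sigma> \<rho>) \<Gamma>)"
    by (simp add: subst_liftN liftN_subst)
  with AllNI.IH[of "case_nat (Var 0) (\<lambda>i. lift_trm (\<sigma> i))" \<rho>] show ?case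
    by (simp only: subst.simps deriv.AllNI)
next
  case (AllNE \<Gamma> \<phi> t)
  have "deriv T (map (subst \<sigma> \<rho>) \<Gamma>)
      (instN (subst (case_nat (Var 0) (\<lambda>i. lift_trm (\<sigma> i))) \<rho> \<phi>) (subst_trm \<sigma> t))"
    using AllNE.IH[of \<sigma> \<rho>] by (intro deriv.AllNE) simp
  then show ?case by (simp add: instN_subst subst_instN)
next
  case (AllSI \<Gamma> \<phi>)
  have "map (subst \<sigma> (case_nat 0 (\<lambda>i. Suc (\<rho> i)))) (map liftS \<Gamma>)
      = map liftS (map (subst \<sigma> \<rho>) \<Gamma>)"
    by (simp add: subst_liftS liftS_subst)
  with AllSI.IH[of \<sigma> "case_nat 0 (\<lambda>i. Suc (\<rho> i))"] show ?case
    by (simp only: subst.simps deriv.AllSI)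
next
  case (AllSE \<Gamma> \<phi> X)
  have "deriv T (map (subst \<sigma> \<rho>) \<Gamma>) (instS (subst \<sigma> (case_nat 0 (\<lambda>X. Suc (\<rho> X))) \<phi>) (\<rho> X))"
    using AllSE.IH[of \<sigma> \<rho>] by (intro deriv.AllSE) simp
  then show ?case by (simp add: instS_subst subst_instS)
next
  case (EqSubst \<Gamma> s t \<phi>)
  let ?\<phi> = "subst (case_nat (Var 0) (\<lambda>i. lift_trm (\<sigma> i))) \<rho> \<phi>"
  have "deriv T (map (subst \<sigma> \<rho>) \<Gamma>) (instN ?\<phi> (subst_trm \<sigma> t))"
    by (rule deriv.EqSubst[of _ _ "subst_trm \<sigma> s"])
      (use EqSubst.IH[of \<sigma> \<rho>] in \<open>simp_all add: instN_subst subst_instN\<close>)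
  then show ?case by (simp add: instN_subst subst_instN)
next
  case (Hyp \<phi> \<Gamma>)
  then show ?case by (auto intro: deriv.Hyp)
next
  case (ImpI \<phi> \<Gamma> \<psi>)
  then show ?case by (auto intro: deriv.ImpI)
next
  case (ImpE \<Gamma> \<phi> \<psi>)
  from ImpE.IH[of \<sigma> \<rho>] show ?case by (auto intro: deriv.ImpE)
next
  case (Raa \<phi> \<Gamma>)
  from Raa.IH[of \<sigma> \<rho>] show ?case by (auto intro: deriv.Raa)
next
  case (EqRefl \<Gamma> t)
  then show ?case by (auto intro: deriv.EqRefl)
qed

text \<open>Generalisation over a named fresh variable. Renaming \<open>Var m\<close> to
  \<open>Var 0\<close> and shifting the other variables turns the hypotheses, which do not contain
  \<open>m\<close>, into their lifts and the instance back into \<open>\<psi>\<close>; this is the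
  premise of \<open>AllNI\<close>.\<close>

lemma deriv_AllN_fresh:
  assumes d: "deriv T \<Gamma> (instN \<psi> (Var m))" and \<Gamma>: "\<forall>\<phi>\<in>set \<Gamma>. supported m \<phi>"
    and \<psi>: "supported (Suc m) \<psi>"
  shows "deriv T \<Gamma> (AllN \<psi>)"
proof -
  let ?\<sigma> = "\<lambda>i. if i = m then Var 0 else Var (Suc i)"
  have 1: "subst ?\<sigma> (\<lambda>X. X) \<phi> = liftN \<phi>" if "\<phi> \<in> set \<Gamma>" for \<phi>
    unfolding liftN_def using \<Gamma> that by (auto simp: supported_def)
  have "subst (case_nat (Var 0) ?\<sigma>) (\<lambda>X. X) \<psi> = subst Var (\<lambda>X. X) \<psi>"
    by (rule \<psi>[unfolded supported_def, rule_format]) (auto split: nat.split)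
  then have "subst ?\<sigma> (\<lambda>X. X) (instN \<psi> (Var m)) = \<psi>"
    by (simp add: subst_instN)
  with deriv_subst[OF d, of ?\<sigma> "\<lambda>X. X"] 1 show ?thesis
    by (auto intro: AllNI cong: map_cong)
qed

lemma deriv_AllS_fresh:
  assumes d: "deriv T \<Gamma> (instS \<psi> m)" and \<Gamma>: "\<forall>\<phi>\<in>set \<Gamma>. supported m \<phi>"
    and \<psi>: "supported (Suc m) \<psi>"
  shows "deriv T \<Gamma> (AllS \<psi>)"
proof -
  let ?\<rho> = "\<lambda>i. if i = m then 0 else Suc i"
  have 1: "subst Var ?\<rho> \<phi> = liftS \<phi>" if "\<phi> \<in> set \<Gamma>" for \<phi>
    unfolding liftS_def using \<Gamma> that by (auto simp: supported_def)
  have "subst Var (case_nat 0 ?\<rho>) \<psi> = subst Var (\<lambda>X. X) \<psi>"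
    by (rule \<psi>[unfolded supported_def, rule_format]) (auto split: nat.split)
  then have "subst Var ?\<rho> (instS \<psi> m) = \<psi>"
    by (simp add: subst_instS)
  with deriv_subst[OF d, of Var ?\<rho>] 1 show ?thesis
    by (auto intro: AllSI cong: map_cong)
qed

lemma deriv_cut: "deriv T (\<phi> # \<Gamma>) \<psi> \<Longrightarrow> deriv T \<Gamma> \<phi> \<Longrightarrow> deriv T \<Gamma> \<psi>"
  by (blast intro: ImpI ImpE)

lemma deriv_FalsumE: "deriv T \<Gamma> \<^bold>\<bottom> \<Longrightarrow> deriv T \<Gamma> \<phi>"
  by (rule Raa) (auto intro: deriv_weaken)


section \<open>Structures and the completeness theorem\<close>

record 'a l2_structure =
  s_zero :: 'a
  s_one :: 'a
  s_plus :: "'a \<Rightarrow> 'a \<Rightarrow> 'a"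
  s_times :: "'a \<Rightarrow> 'a \<Rightarrow> 'a"
  s_less :: "'a \<Rightarrow> 'a \<Rightarrow> bool"
  s_sets :: "'a set set"

primrec eval :: "'a l2_structure \<Rightarrow> (nat \<Rightarrow> 'a) \<Rightarrow> trm \<Rightarrow> 'a" where
  "eval M e (Var i) = e i"
| "eval M e \<zero> = s_zero M"
| "eval M e \<one> = s_one M"
| "eval M e (s \<oplus> t) = s_plus M (eval M e s) (eval M e t)"
| "eval M e (s \<otimes> t) = s_times M (eval M e s) (eval M e t)"

primrec sat :: "'a l2_structure \<Rightarrow> (nat \<Rightarrow> 'a) \<Rightarrow> (nat \<Rightarrow> 'a set) \<Rightarrow> fm \<Rightarrow> bool" where
  "sat M e v (s \<doteq> t) \<longleftrightarrow> eval M e s = eval M e t"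
| "sat M e v (s \<prec> t) \<longleftrightarrow> s_less M (eval M e s) (eval M e t)"
| "sat M e v (t \<epsilon> X) \<longleftrightarrow> eval M e t \<in> v X"
| "sat M e v \<^bold>\<bottom> \<longleftrightarrow> False"
| "sat M e v (\<phi> \<^bold>\<longrightarrow> \<psi>) \<longleftrightarrow> (sat M e v \<phi> \<longrightarrow> sat M e v \<psi>)"
| "sat M e v (AllN \<phi>) \<longleftrightarrow> (\<forall>x. sat M (case_nat x e) v \<phi>)"
| "sat M e v (AllS \<phi>) \<longleftrightarrow> (\<forall>X\<in>s_sets M. sat M e (case_nat X v) \<phi>)"

definition models :: "'a l2_structure \<Rightarrow> fm set \<Rightarrow> bool" where
  "models M T \<longleftrightarrow> s_sets M \<noteq> {} \<and> (\<forall>\<phi>\<in>T. \<forall>e v. range v \<subseteq> s_sets M \<longrightarrow> sat M e v \<phi>)"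

definition consistent :: "fm set \<Rightarrow> fm list \<Rightarrow> bool" where
  "consistent T \<Gamma> \<longleftrightarrow> \<not> deriv T \<Gamma> \<^bold>\<bottom>"

text \<open>No new constants are needed as Henkin witnesses: \<open>\<Gamma>\<close> is a finite
  list, so a variable beyond all supports is fresh.\<close>

lemma consistent_witnessN:
  assumes c: "consistent T \<Gamma>" and \<psi>: "(\<^bold>\<not> AllN \<psi>) \<in> set \<Gamma>"
  shows "\<exists>t. consistent T ((\<^bold>\<not> instN \<psi> t) # \<Gamma>)"
proof -
  obtain m n where "\<forall>\<phi>\<in>set \<Gamma>. supported m \<phi>" "supported n \<psi>"
    using support_exists support_exists_list by metis
  then have *: "\<forall>\<phi>\<in>set \<Gamma>. supported (max m n) \<phi>" "supported (Suc (max m n)) \<psi>"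
    by (auto intro: supported_mono)
  have "consistent T ((\<^bold>\<not> instN \<psi> (Var (max m n))) # \<Gamma>)"
  proof (rule ccontr)
    assume "\<not> ?thesis"
    then have "deriv T \<Gamma> (instN \<psi> (Var (max m n)))"
      by (auto simp: consistent_def intro: Raa)
    then have "deriv T \<Gamma> (AllN \<psi>)" using * by (rule deriv_AllN_fresh)
    with \<psi> c show False
      by (auto simp: consistent_def intro: ImpE Hyp)
  qed
  then show ?thesis by blast
qed

lemma consistent_witnessS:
  assumes c: "consistent T \<Gamma>" and \<psi>: "(\<^bold>\<not> AllS \<psi>) \<in> set \<Gamma>"
  shows "\<exists>X. consistent T ((\<^bold>\<not> instS \<psi> X) # \<Gamma>)"
proof -
  obtain m n where "\<forall>\<phi>\<in>set \<Gamma>. supported m \<phi>" "supported n \<psi>"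
    using support_exists support_exists_list by metis
  then have *: "\<forall>\<phi>\<in>set \<Gamma>. supported (max m n) \<phi>" "supported (Suc (max m n)) \<psi>"
    by (auto intro: supported_mono)
  have "consistent T ((\<^bold>\<not> instS \<psi> (max m n)) # \<Gamma>)"
  proof (rule ccontr)
    assume "\<not> ?thesis"
    then have "deriv T \<Gamma> (instS \<psi> (max m n))"
      by (auto simp: consistent_def intro: Raa)
    then have "deriv T \<Gamma> (AllS \<psi>)" using * by (rule deriv_AllS_fresh)
    with \<psi> c show False
      by (auto simp: consistent_def intro: ImpE Hyp)
  qed
  then show ?thesis by blast
qed

instance trm :: countable by countable_datatype

instance fm :: countable by countable_datatype

definition henkin_step :: "fm set \<Rightarrow> fm \<Rightarrow> fm list \<Rightarrow> bool" where
  "henkin_step T \<phi> \<Gamma> \<longleftrightarrow> consistent T \<Gamma> \<and>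
    (\<phi> \<in> set \<Gamma> \<or> \<not> consistent T (\<phi> # \<Gamma>)) \<and>
    (\<forall>\<psi>. \<phi> = (\<^bold>\<not> AllN \<psi>) \<and> \<phi> \<in> set \<Gamma> \<longrightarrow> (\<exists>t. (\<^bold>\<not> instN \<psi> t) \<in> set \<Gamma>)) \<and>
    (\<forall>\<psi>. \<phi> = (\<^bold>\<not> AllS \<psi>) \<and> \<phi> \<in> set \<Gamma> \<longrightarrow> (\<exists>X. (\<^bold>\<not> instS \<psi> X) \<in> set \<Gamma>))"

lemma henkin_step_exists:
  assumes c: "consistent T \<Gamma>"
  shows "\<exists>\<Delta>. set \<Gamma> \<subseteq> set \<Delta> \<and> henkin_step T \<phi> \<Delta>"
proof (cases "consistent T (\<phi> # \<Gamma>)")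
  case False
  have "\<phi> \<notin> set \<Gamma>"
  proof
    assume "\<phi> \<in> set \<Gamma>"
    then have "set (\<phi> # \<Gamma>) \<subseteq> set \<Gamma>" by auto
    with False c show False by (meson consistent_def deriv_weaken)
  qed
  with False c show ?thesis by (auto simp: henkin_step_def)
next
  case True
  consider (N) \<psi> where "\<phi> = (\<^bold>\<not> AllN \<psi>)" | (S) \<psi> where "\<phi> = (\<^bold>\<not> AllS \<psi>)"
    | (no) "\<forall>\<psi>. \<phi> \<noteq> (\<^bold>\<not> AllN \<psi>) \<and> \<phi> \<noteq> (\<^bold>\<not> AllS \<psi>)" by blast
  then show ?thesis
  proof cases
    case N
    then obtain t where "consistent T ((\<^bold>\<not> instN \<psi> t) # \<phi> # \<Gamma>)"
      using consistent_witnessN[OF True] by auto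
    with N show ?thesis
      by (intro exI[of _ "(\<^bold>\<not> instN \<psi> t) # \<phi> # \<Gamma>"]) (auto simp: henkin_step_def)
  next
    case S
    then obtain X where "consistent T ((\<^bold>\<not> instS \<psi> X) # \<phi> # \<Gamma>)"
      using consistent_witnessS[OF True] by auto
    with S show ?thesis
      by (intro exI[of _ "(\<^bold>\<not> instS \<psi> X) # \<phi> # \<Gamma>"]) (auto simp: henkin_step_def)
  next
    case no
    with True show ?thesis
      by (intro exI[of _ "\<phi> # \<Gamma>"]) (auto simp: henkin_step_def)
  qed
qed

lemma henkin_set_exists:
  assumes c: "consistent T \<Gamma>"
  obtains H where "set \<Gamma> \<subseteq> H"
    and "\<And>\<phi>. (\<exists>\<Delta>. set \<Delta> \<subseteq> H \<and> deriv T \<Delta> \<phi>) \<Longrightarrow> \<phi> \<in> H"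
    and "\<^bold>\<bottom> \<notin> H" and "\<And>\<phi>. \<phi> \<in> H \<or> (\<^bold>\<not> \<phi>) \<in> H"
    and "\<And>\<psi>. (\<^bold>\<not> AllN \<psi>) \<in> H \<Longrightarrow> \<exists>t. (\<^bold>\<not> instN \<psi> t) \<in> H"
    and "\<And>\<psi>. (\<^bold>\<not> AllS \<psi>) \<in> H \<Longrightarrow> \<exists>X. (\<^bold>\<not> instS \<psi> X) \<in> H"
proof -
  have "\<exists>F. \<forall>n. (henkin_step T (from_nat n) (F n) \<and> set \<Gamma> \<subseteq> set (F n)) \<and>
      set (F n) \<subseteq> set (F (Suc n))"
  proof (rule dependent_nat_choice)
    show "\<exists>\<Delta>. henkin_step T (from_nat 0) \<Delta> \<and> set \<Gamma> \<subseteq> set \<Delta>"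
      using henkin_step_exists[OF c] by blast
    fix \<Delta> n
    assume "henkin_step T (from_nat n) \<Delta> \<and> set \<Gamma> \<subseteq> set \<Delta>"
    then show "\<exists>\<Delta>'. (henkin_step T (from_nat (Suc n)) \<Delta>' \<and> set \<Gamma> \<subseteq> set \<Delta>') \<and> set \<Delta> \<subseteq> set \<Delta>'"
      using henkin_step_exists[of T \<Delta> "from_nat (Suc n)"] henkin_step_def[of T "from_nat n" \<Delta>]
      by blast
  qed
  then obtain F where F: "\<And>n. henkin_step T (from_nat n) (F n)" "\<And>n. set \<Gamma> \<subseteq> set (F n)"
    "\<And>n. set (F n) \<subseteq> set (F (Suc n))" by blast
  have mono: "set (F m) \<subseteq> set (F n)" if "m \<le> n" for m n
    using lift_Suc_mono_le[of "\<lambda>n. set (F n)", OF F(3) that] .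
  define H where "H = (\<Union>n. set (F n))"
  have fin: "\<exists>n. set \<Delta> \<subseteq> set (F n)" if "set \<Delta> \<subseteq> H" for \<Delta>
    using that
  proof (induction \<Delta>)
    case (Cons \<phi> \<Delta>)
    then obtain m n where "set \<Delta> \<subseteq> set (F m)" "\<phi> \<in> set (F n)"
      by (auto simp: H_def)
    then show ?case
      using mono[of m "max m n"] mono[of n "max m n"] by (intro exI[of _ "max m n"]) auto
  qed simp
  have cons: "consistent T (F n)" for n using F(1) by (auto simp: henkin_step_def)
  have closed: "\<phi> \<in> H" if \<Delta>: "set \<Delta> \<subseteq> H" "deriv T \<Delta> \<phi>" for \<phi> \<Delta>
  proof (rule ccontr)
    assume "\<phi> \<notin> H"
    obtain n where n: "set \<Delta> \<subseteq> set (F n)" using fin \<Delta> by blast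
    let ?m = "to_nat \<phi>"
    have "\<not> consistent T (\<phi> # F ?m)"
      using F(1)[of ?m] \<open>\<phi> \<notin> H\<close> by (auto simp: henkin_step_def H_def)
    then have "deriv T (\<phi> # F (max n ?m)) \<^bold>\<bottom>"
      using mono[of ?m "max n ?m"] by (auto simp: consistent_def elim!: deriv_weaken)
    moreover have "deriv T (F (max n ?m)) \<phi>"
      using \<Delta>(2) n mono[of n "max n ?m"] by (auto elim!: deriv_weaken)
    ultimately show False using cons deriv_cut by (metis consistent_def)
  qed
  \<comment> \<open>Were \<open>\<phi>\<close> absent from its own stage, it would be inconsistent
    with that stage and hence with every later one. So each member of \<open>H\<close> is present
    when its witness is due.\<close>
  have in_stage: "\<phi> \<in> set (F (to_nat \<phi>))" if H: "\<phi> \<in> H" for \<phi>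
  proof (rule ccontr)
    let ?m = "to_nat \<phi>"
    obtain n where n: "\<phi> \<in> set (F n)" using H by (auto simp: H_def)
    assume "\<phi> \<notin> set (F ?m)"
    then have d: "deriv T (\<phi> # F ?m) \<^bold>\<bottom>"
      using F(1)[of ?m] by (auto simp: henkin_step_def consistent_def)
    have "deriv T (F (max n ?m)) \<^bold>\<bottom>"
      by (rule deriv_weaken[OF d]) (use mono[of ?m "max n ?m"] mono[of n "max n ?m"] n in auto)
    then show False using cons by (simp add: consistent_def)
  qed
  have "\<phi> \<in> H \<or> (\<^bold>\<not> \<phi>) \<in> H" for \<phi>
  proof (cases "\<phi> \<in> H")
    case False
    let ?m = "to_nat \<phi>"
    have "\<not> consistent T (\<phi> # F ?m)"
      using F(1)[of ?m] False by (auto simp: henkin_step_def H_def)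
    then have "deriv T (F ?m) (\<^bold>\<not> \<phi>)"
      by (auto simp: consistent_def intro: ImpI)
    then show ?thesis using closed[of "F ?m"] by (auto simp: H_def)
  qed simp
  moreover have "\<^bold>\<bottom> \<notin> H"
    using cons by (auto simp: H_def consistent_def intro: Hyp)
  moreover have "\<exists>t. (\<^bold>\<not> instN \<psi> t) \<in> H" if N: "(\<^bold>\<not> AllN \<psi>) \<in> H" for \<psi>
    using F(1)[of "to_nat (\<^bold>\<not> AllN \<psi>)"] in_stage[OF N] by (auto simp: henkin_step_def H_def)
  moreover have "\<exists>X. (\<^bold>\<not> instS \<psi> X) \<in> H" if N: "(\<^bold>\<not> AllS \<psi>) \<in> H" for \<psi>
    using F(1)[of "to_nat (\<^bold>\<not> AllS \<psi>)"] in_stage[OF N] by (auto simp: henkin_step_def H_def)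
  moreover have "set \<Gamma> \<subseteq> H" using F(2) by (auto simp: H_def)
  ultimately show ?thesis
    using that[of H] closed by blast
qed

primrec numeral_trm :: "nat \<Rightarrow> trm" where
  "numeral_trm 0 = \<zero>"
| "numeral_trm (Suc n) = numeral_trm n \<oplus> \<one>"

text \<open>
  The model is built on any given countably infinite type, so that there is no carrier set to carry
  along; provably equal terms are identified by \<open>J\<close>.
\<close>

theorem completeness:
  fixes enum :: "nat \<Rightarrow> 'a"
  assumes enum: "bij enum" and basic: "basic_axioms \<subseteq> T" and not_provable: "\<not> T \<turnstile> \<phi>"
  shows "\<exists>(M :: 'a l2_structure) e v. models M T \<and> range v \<subseteq> s_sets M \<and> \<not> sat M e v \<phi>"
proof -
  have "consistent T [\<^bold>\<not> \<phi>]"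
    using not_provable by (auto simp: consistent_def proves_def intro: Raa)
  then obtain H where H: "(\<^bold>\<not> \<phi>) \<in> H"
    and closed: "\<And>\<phi>. (\<exists>\<Delta>. set \<Delta> \<subseteq> H \<and> deriv T \<Delta> \<phi>) \<Longrightarrow> \<phi> \<in> H"
    and bot: "\<^bold>\<bottom> \<notin> H" and total: "\<And>\<phi>. \<phi> \<in> H \<or> (\<^bold>\<not> \<phi>) \<in> H"
    and witN: "\<And>\<psi>. (\<^bold>\<not> AllN \<psi>) \<in> H \<Longrightarrow> \<exists>t. (\<^bold>\<not> instN \<psi> t) \<in> H"
    and witS: "\<And>\<psi>. (\<^bold>\<not> AllS \<psi>) \<in> H \<Longrightarrow> \<exists>X. (\<^bold>\<not> instS \<psi> X) \<in> H"
    by (rule henkin_set_exists[where \<Gamma> = "[\<^bold>\<not> \<phi>]"]) auto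
  have ax: "subst \<sigma> \<rho> \<psi> \<in> H" if "\<psi> \<in> T" for \<sigma> \<rho> \<psi>
    using closed[of "subst \<sigma> \<rho> \<psi>"] deriv_Nil_subst[of T \<psi> "[]"] Ax[OF that] by force
  have mp: "\<psi> \<in> H" if "(\<chi> \<^bold>\<longrightarrow> \<psi>) \<in> H" "\<chi> \<in> H" for \<chi> \<psi>
    using closed[of \<psi>] that
    by (metis (no_types, lifting) Hyp ImpE empty_set insert_subset list.set_intros(1)
        list.set_intros(2) list.simps(15) empty_subsetI)
  have imp: "(\<chi> \<^bold>\<longrightarrow> \<psi>) \<in> H \<longleftrightarrow> (\<chi> \<in> H \<longrightarrow> \<psi> \<in> H)" for \<chi> \<psi>
  proof -
    have "(\<chi> \<^bold>\<longrightarrow> \<psi>) \<in> H" if "\<psi> \<in> H"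
    proof (intro closed exI[of _ "[\<psi>]"] conjI)
      show "deriv T [\<psi>] (\<chi> \<^bold>\<longrightarrow> \<psi>)" by (rule ImpI, rule Hyp) simp
    qed (use that in simp)
    moreover have "(\<chi> \<^bold>\<longrightarrow> \<psi>) \<in> H" if "(\<^bold>\<not> \<chi>) \<in> H"
    proof (intro closed exI[of _ "[\<^bold>\<not> \<chi>]"] conjI)
      have "deriv T [\<chi>, \<^bold>\<not> \<chi>] (\<^bold>\<not> \<chi>)" "deriv T [\<chi>, \<^bold>\<not> \<chi>] \<chi>"
        by (rule Hyp, simp)+
      then show "deriv T [\<^bold>\<not> \<chi>] (\<chi> \<^bold>\<longrightarrow> \<psi>)" by (rule ImpI[OF deriv_FalsumE[OF ImpE]])
    qed (use that in simp)
    ultimately show ?thesis using mp total by blast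
  qed
  have allN: "AllN \<psi> \<in> H \<longleftrightarrow> (\<forall>t. instN \<psi> t \<in> H)" for \<psi>
  proof
    assume "AllN \<psi> \<in> H"
    then show "\<forall>t. instN \<psi> t \<in> H"
      by (intro allI closed exI[of _ "[AllN \<psi>]"] conjI AllNE[of _ _ \<psi>] Hyp) auto
  next
    assume "\<forall>t. instN \<psi> t \<in> H"
    then show "AllN \<psi> \<in> H" using witN[of \<psi>] total[of "AllN \<psi>"] imp bot by blast
  qed
  have allS: "AllS \<psi> \<in> H \<longleftrightarrow> (\<forall>X. instS \<psi> X \<in> H)" for \<psi>
  proof
    assume "AllS \<psi> \<in> H"
    then show "\<forall>X. instS \<psi> X \<in> H"
      by (intro allI closed exI[of _ "[AllS \<psi>]"] conjI AllSE[of _ _ \<psi>] Hyp) auto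
  next
    assume "\<forall>X. instS \<psi> X \<in> H"
    then show "AllS \<psi> \<in> H" using witS[of \<psi>] total[of "AllS \<psi>"] imp bot by blast
  qed
  have refl: "(t \<doteq> t) \<in> H" for t
    by (rule closed, rule exI[of _ "[]"]) (simp add: EqRefl)
  have rep: "instN \<psi> t \<in> H" if "(s \<doteq> t) \<in> H" "instN \<psi> s \<in> H" for s t \<psi>
    using that by (intro closed exI[of _ "[s \<doteq> t, instN \<psi> s]"] conjI EqSubst[of _ _ s t \<psi>] Hyp) auto
  have sym: "(t \<doteq> s) \<in> H" if "(s \<doteq> t) \<in> H" for s t
    using rep[OF that, of "Var 0 \<doteq> lift_trm s"] refl by (simp add: instN_def)
  have trans: "(s \<doteq> u) \<in> H" if "(s \<doteq> t) \<in> H" "(t \<doteq> u) \<in> H" for s t u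
    using rep[OF that(2), of "lift_trm s \<doteq> Var 0"] that by (simp add: instN_def)
  define R where "R = {(s, t). (s \<doteq> t) \<in> H}"
  have R: "equiv UNIV R"
    unfolding equiv_def refl_on_def sym_def trans_def R_def using refl sym trans by blast
  have succ_inj: "(s \<doteq> t) \<in> H" if "(s \<oplus> \<one> \<doteq> t \<oplus> \<one>) \<in> H" for s t
  proof -
    have "(Var 0 \<oplus> \<one> \<doteq> Var 1 \<oplus> \<one> \<^bold>\<longrightarrow> Var 0 \<doteq> Var 1) \<in> T"
      using basic by (auto simp: basic_axioms_def)
    from ax[OF this, of "case_nat s (\<lambda>_. t)"] that show ?thesis by (simp add: imp)
  qed
  have succ_nz: "(s \<oplus> \<one> \<doteq> \<zero>) \<notin> H" for s
  proof -
    have "(\<^bold>\<not> (Var 0 \<oplus> \<one> \<doteq> \<zero>)) \<in> T"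
      using basic by (auto simp: basic_axioms_def)
    from ax[OF this, of "case_nat s (\<lambda>_. s)"] bot show ?thesis by (simp add: imp)
  qed
  have num_inj: "(numeral_trm m \<doteq> numeral_trm n) \<in> H \<Longrightarrow> m = n" for m n
  proof (induction m arbitrary: n)
    case 0
    then show ?case using succ_nz sym by (cases n) auto
  next
    case (Suc m)
    then show ?case using succ_nz succ_inj by (cases n) auto
  qed
  \<comment> \<open>The numerals give infinitely many classes, so the quotient is countably infinite
    and can be matched with the given type.\<close>
  have inf: "infinite (UNIV // R)"
  proof
    assume "finite (UNIV // R)"
    moreover have "range (\<lambda>n. R `` {numeral_trm n}) \<subseteq> UNIV // R"
      by (auto simp: quotient_def)
    moreover have "inj (\<lambda>n. R `` {numeral_trm n})"
    proof (rule injI)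
      fix m n assume "R `` {numeral_trm m} = R `` {numeral_trm n}"
      then have "(numeral_trm m, numeral_trm n) \<in> R" by (simp add: eq_equiv_class_iff[OF R])
      then show "m = n" using num_inj by (simp add: R_def)
    qed
    ultimately show False using finite_imageD finite_subset infinite_UNIV_nat by metis
  qed
  have count: "countable (UNIV // R)"
    unfolding quotient_def by simp
  define J where "J t = enum (to_nat_on (UNIV // R) (R `` {t}))" for t
  have bij_cls: "bij_betw (\<lambda>A. enum (to_nat_on (UNIV // R) A)) (UNIV // R) UNIV"
    using bij_betw_trans[OF to_nat_on_infinite[OF count inf] enum] by (simp add: comp_def)
  have J_eq: "J s = J t \<longleftrightarrow> (s \<doteq> t) \<in> H" for s t
  proof -
    have "J s = J t \<longleftrightarrow> R `` {s} = R `` {t}"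
      unfolding J_def
      by (rule inj_on_eq_iff[OF bij_betw_imp_inj_on[OF bij_cls]]) (auto intro: quotientI)
    also have "\<dots> \<longleftrightarrow> (s \<doteq> t) \<in> H"
      using eq_equiv_class_iff[OF R, of s t] by (simp add: R_def)
    finally show ?thesis .
  qed
  have J_surj: "\<exists>t. J t = x" for x
  proof -
    obtain A where A: "A \<in> UNIV // R" "x = enum (to_nat_on (UNIV // R) A)"
      using bij_betw_imp_surj_on[OF bij_cls] by (metis (no_types, lifting) UNIV_I imageE)
    from A(1) obtain t where "A = R `` {t}" by (rule quotientE)
    with A(2) show ?thesis by (auto simp: J_def)
  qed
  define K where "K = inv J"
  have JK [simp]: "J (K x) = x" for x
  proof -
    have "surj J" unfolding surj_def using J_surj by metis
    then show ?thesis unfolding K_def by (rule surj_f_inv_f)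
  qed
  have instN2: "instN \<psi> t \<in> H \<longleftrightarrow> instN \<psi> s \<in> H" if "J s = J t" for s t \<psi>
    using that J_eq[of s t] rep[of s t] rep[of t s] sym[of s t] by blast
  \<comment> \<open>Every set of the model is named by a set variable. The language has no equality
    between sets, so no quotient is taken: variables with the same members name the same
    set.\<close>
  define SS where "SS X = {x. (K x \<epsilon> X) \<in> H}" for X
  define M where "M = \<lparr>s_zero = J \<zero>, s_one = J \<one>, s_plus = (\<lambda>x y. J (K x \<oplus> K y)),
    s_times = (\<lambda>x y. J (K x \<otimes> K y)), s_less = (\<lambda>x y. (K x \<prec> K y) \<in> H), s_sets = range SS\<rparr>"
  have cong: "J (c (K (J s)) (K (J t))) = J (c s t)" if c: "c = TAdd \<or> c = TMul" for c s t
  proof -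
    have sub: "subst_trm \<sigma> (c a b) = c (subst_trm \<sigma> a) (subst_trm \<sigma> b)" for \<sigma> a b using c by auto
    have "(c (K (J s)) (K (J t)) \<doteq> c s (K (J t))) \<in> H"
      using instN2[of s "K (J s)" "c (Var 0) (lift_trm (K (J t))) \<doteq> lift_trm (c s (K (J t)))"] refl
      by (simp add: instN_def sub)
    moreover have "(c s (K (J t)) \<doteq> c s t) \<in> H"
      using instN2[of t "K (J t)" "c (lift_trm s) (Var 0) \<doteq> lift_trm (c s t)"] refl
      by (simp add: instN_def sub)
    ultimately show ?thesis using trans J_eq by blast
  qed
  have less: "(K (J s) \<prec> K (J t)) \<in> H \<longleftrightarrow> (s \<prec> t) \<in> H" for s t
  proof -
    have "(K (J s) \<prec> K (J t)) \<in> H \<longleftrightarrow> (s \<prec> K (J t)) \<in> H"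
      using instN2[of s "K (J s)" "Var 0 \<prec> lift_trm (K (J t))"] by (simp add: instN_def)
    moreover have "(s \<prec> K (J t)) \<in> H \<longleftrightarrow> (s \<prec> t) \<in> H"
      using instN2[of t "K (J t)" "lift_trm s \<prec> Var 0"] by (simp add: instN_def)
    ultimately show ?thesis by blast
  qed
  have mem: "(K (J t) \<epsilon> X) \<in> H \<longleftrightarrow> (t \<epsilon> X) \<in> H" for t X
    using instN2[of t "K (J t)" "Var 0 \<epsilon> X"] by (simp add: instN_def)
  have ev: "eval M (\<lambda>i. J (\<sigma> i)) t = J (subst_trm \<sigma> t)" for \<sigma> t
    by (induction t) (simp_all add: M_def cong)
  have truth: "sat M (\<lambda>i. J (\<sigma> i)) (\<lambda>X. SS (\<rho> X)) \<psi> \<longleftrightarrow> subst \<sigma> \<rho> \<psi> \<in> H" for \<sigma> \<rho> \<psi>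
  proof (induction \<psi> arbitrary: \<sigma> \<rho>)
    case (FEq s t)
    then show ?case by (simp add: ev J_eq)
  next
    case (FLess s t)
    have "s_less M (J s) (J t) \<longleftrightarrow> (s \<prec> t) \<in> H" for s t
      by (simp add: M_def less)
    then show ?case by (simp add: ev)
  next
    case (FMem t X)
    then show ?case by (simp add: ev SS_def mem)
  next
    case Falsum
    then show ?case by (simp add: bot)
  next
    case (FImp \<psi> \<chi>)
    then show ?case by (simp add: imp)
  next
    case (AllN \<psi>)
    have "sat M (\<lambda>i. J (\<sigma> i)) (\<lambda>X. SS (\<rho> X)) (AllN \<psi>) \<longleftrightarrow>
        (\<forall>t. sat M (case_nat (J t) (\<lambda>i. J (\<sigma> i))) (\<lambda>X. SS (\<rho> X)) \<psi>)"
      using J_surj by (metis sat.simps(6))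
    also have "\<dots> \<longleftrightarrow> (\<forall>t. subst (case_nat t \<sigma>) \<rho> \<psi> \<in> H)"
    proof -
      have "case_nat (J t) (\<lambda>i. J (\<sigma> i)) = (\<lambda>i. J (case_nat t \<sigma> i))" for t
        by (auto simp: fun_eq_iff split: nat.split)
      then show ?thesis using AllN by simp
    qed
    also have "\<dots> \<longleftrightarrow> subst \<sigma> \<rho> (AllN \<psi>) \<in> H"
      by (simp add: allN instN_subst)
    finally show ?case .
  next
    case (AllS \<psi>)
    have "sat M (\<lambda>i. J (\<sigma> i)) (\<lambda>X. SS (\<rho> X)) (AllS \<psi>) \<longleftrightarrow>
        (\<forall>Y. sat M (\<lambda>i. J (\<sigma> i)) (case_nat (SS Y) (\<lambda>X. SS (\<rho> X))) \<psi>)"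
      by (auto simp: M_def)
    also have "\<dots> \<longleftrightarrow> (\<forall>Y. subst \<sigma> (case_nat Y \<rho>) \<psi> \<in> H)"
    proof -
      have "case_nat (SS Y) (\<lambda>X. SS (\<rho> X)) = (\<lambda>X. SS (case_nat Y \<rho> X))" for Y
        by (auto simp: fun_eq_iff split: nat.split)
      then show ?thesis using AllS by simp
    qed
    also have "\<dots> \<longleftrightarrow> subst \<sigma> \<rho> (AllS \<psi>) \<in> H"
      by (simp add: allS instS_subst)
    finally show ?case .
  qed
  have "models M T"
    unfolding models_def
  proof (intro conjI ballI allI impI)
    show "s_sets M \<noteq> {}" by (simp add: M_def)
    fix \<psi> e and v :: "nat \<Rightarrow> 'a set"
    assume "\<psi> \<in> T" and v: "range v \<subseteq> s_sets M"
    have "\<forall>X. \<exists>Y. v X = SS Y" using v by (auto simp: M_def image_subset_iff)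
    then obtain \<rho> where "\<And>X. v X = SS (\<rho> X)" by metis
    then have "v = (\<lambda>X. SS (\<rho> X))" by (simp add: fun_eq_iff)
    moreover have "sat M (\<lambda>i. J (K (e i))) (\<lambda>X. SS (\<rho> X)) \<psi>"
      unfolding truth by (rule ax[OF \<open>\<psi> \<in> T\<close>])
    ultimately show "sat M e v \<psi>" by simp
  qed
  moreover have "\<not> sat M (\<lambda>i. J (Var i)) (\<lambda>X. SS X) \<phi>"
    using truth[of Var "\<lambda>X. X" \<phi>] H imp bot by auto
  moreover have "range (\<lambda>X. SS X) \<subseteq> s_sets M" by (simp add: M_def)
  ultimately show ?thesis by blast
qed


section \<open>Models of \<open>RCA0\<close> as a type class\<close>

definition standard_structure :: "nat l2_structure" where
  "standard_structure = \<lparr>s_zero = 0, s_one = 1, s_plus = (+), s_times = (*), s_less = (<), s_sets = UNIV\<rparr>"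

lemma eval_subst_trm: "eval M e (subst_trm \<sigma> t) = eval M (\<lambda>i. eval M e (\<sigma> i)) t"
  by (induction t) simp_all

lemma eval_lift_trm [simp]: "eval M (case_nat x e) (lift_trm t) = eval M e t"
  by (simp add: lift_trm_def eval_subst_trm)

lemma sat_subst: "sat M e v (subst \<sigma> \<rho> \<phi>) \<longleftrightarrow> sat M (\<lambda>i. eval M e (\<sigma> i)) (\<lambda>X. v (\<rho> X)) \<phi>"
proof (induction \<phi> arbitrary: e v \<sigma> \<rho>)
  case (AllN \<phi>)
  have "(\<lambda>i. eval M (case_nat x e) (case i of 0 \<Rightarrow> Var 0 | Suc i \<Rightarrow> lift_trm (\<sigma> i)))
      = case_nat x (\<lambda>i. eval M e (\<sigma> i))" for x
    by (auto simp: fun_eq_iff split: nat.split)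
  then show ?case by (simp add: AllN)
next
  case (AllS \<phi>)
  have "(\<lambda>X. case_nat Y v (case X of 0 \<Rightarrow> 0 | Suc X \<Rightarrow> Suc (\<rho> X))) = case_nat Y (\<lambda>X. v (\<rho> X))" for Y
    by (auto simp: fun_eq_iff split: nat.split)
  then show ?case by (simp add: AllS)
qed (simp_all add: eval_subst_trm)

lemma sat_instN: "sat M e v (instN \<phi> t) \<longleftrightarrow> sat M (case_nat (eval M e t) e) v \<phi>"
proof -
  have "(\<lambda>i. eval M e (case i of 0 \<Rightarrow> t | Suc i \<Rightarrow> Var i)) = case_nat (eval M e t) e"
    by (auto simp: fun_eq_iff split: nat.split)
  then show ?thesis by (simp add: instN_def sat_subst)
qed

lemma sat_liftS [simp]: "sat M e (case_nat X v) (liftS \<phi>) \<longleftrightarrow> sat M e v \<phi>"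
  by (simp add: liftS_def sat_subst)

lemma sat_comprehension:
  "sat M e v (comprehension \<phi>) \<longleftrightarrow> (\<exists>X\<in>s_sets M. X = {x. sat M (case_nat x e) v \<phi>})"
  by (simp add: comprehension_def set_eq_iff) blast

lemma sat_induction:
  "sat M e v (induction \<phi>) \<longleftrightarrow>
    (sat M (case_nat (s_zero M) e) v \<phi> \<longrightarrow>
     (\<forall>x. sat M (case_nat x e) v \<phi> \<longrightarrow> sat M (case_nat (s_plus M x (s_one M)) e) v \<phi>) \<longrightarrow>
     (\<forall>x. sat M (case_nat x e) v \<phi>))"
proof -
  have "(\<lambda>i. eval M (case_nat x e) (case i of 0 \<Rightarrow> Var 0 \<oplus> \<one> | Suc i \<Rightarrow> Var (Suc i)))
      = case_nat (s_plus M x (s_one M)) e" for x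
    by (auto simp: fun_eq_iff split: nat.split)
  then show ?thesis by (simp add: induction_def sat_instN sat_subst imp_conjL cong del: imp_cong)
qed

lemma standard_structure_models_RCA0: "models standard_structure RCA0"
proof -
  have "sat standard_structure e v \<phi>" if "\<phi> \<in> basic_axioms" for e v \<phi>
    using that by (auto simp: basic_axioms_def standard_structure_def)
  moreover have "sat standard_structure e v (induction \<phi>)" for e v \<phi>
    unfolding sat_induction
  proof (intro impI allI)
    fix n
    assume "sat standard_structure (case_nat (s_zero standard_structure) e) v \<phi>"
      "\<forall>x. sat standard_structure (case_nat x e) v \<phi> \<longrightarrow>
        sat standard_structure (case_nat (s_plus standard_structure x (s_one standard_structure)) e) v \<phi>"
    then show "sat standard_structure (case_nat n e) v \<phi>"
      by (induction n) (simp_all add: standard_structure_def)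
  qed
  moreover have "sat standard_structure e v (comprehension \<phi>)" for e v \<phi>
    unfolding sat_comprehension by (simp add: standard_structure_def)
  ultimately have "sat standard_structure e v \<phi>" if "\<phi> \<in> RCA0" for e v \<phi>
    using that unfolding RCA0_def by (elim UnE) (fastforce simp only: mem_Collect_eq sat.simps)+
  then show ?thesis
    unfolding models_def by (simp add: standard_structure_def)
qed

text \<open>
  A model that refutes the theorem, if there is one, is turned into a type. Models can then be
  treated as a type class and are available with the algebraic classes of the library.
\<close>

definition equivalence_holds :: "nat l2_structure \<Rightarrow> bool" where
  "equivalence_holds M \<longleftrightarrow> (models M Pi11_CA0 \<longleftrightarrow> models M {hamilton_sets_exist})"

text \<open>The instance proof below must not depend on the existence of a counterexample, hence the
  standard model as default. Once the equivalence is proved for this one structure, it holds for all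
  models of \<open>RCA0\<close> with carrier \<open>nat\<close>.\<close>

definition chosen_structure :: "nat l2_structure" where
  "chosen_structure =
    (if \<exists>M. models M RCA0 \<and> \<not> equivalence_holds M
     then SOME M. models M RCA0 \<and> \<not> equivalence_holds M else standard_structure)"

lemma chosen_structure_refutes:
  assumes "\<exists>M. models M RCA0 \<and> \<not> equivalence_holds M"
  shows "models chosen_structure RCA0 \<and> \<not> equivalence_holds chosen_structure"
  unfolding chosen_structure_def if_P[OF assms] using assms by (rule someI_ex)

lemma chosen_structure_models_RCA0: "models chosen_structure RCA0"
proof (cases "\<exists>M. models M RCA0 \<and> \<not> equivalence_holds M")
  case True
  then show ?thesis using chosen_structure_refutes by blast
next
  case False
  show ?thesis
    unfolding chosen_structure_def if_not_P[OF False] by (rule standard_structure_models_RCA0)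
qed

class model_carrier = zero + one + plus + times + ord + minus +
  fixes Sets :: "'a set set"

definition "struct" :: "'a::model_carrier l2_structure" where
  "struct = \<lparr>s_zero = 0, s_one = 1, s_plus = (+), s_times = (*), s_less = (<), s_sets = Sets\<rparr>"

lemma struct_simps [simp]:
  "s_zero struct = 0" "s_one struct = 1" "s_plus struct = (+)" "s_times struct = (*)"
  "s_less struct = (<)" "s_sets struct = Sets"
  by (simp_all add: struct_def)

text \<open>The last two axioms concern symbols outside the language of arithmetic; they fix \<le>
  and truncated subtraction so that ordered semidomains become applicable.\<close>

class rca0_model = model_carrier +
  assumes models_RCA0:
    "models \<lparr>s_zero = 0, s_one = 1, s_plus = (+), s_times = (*), s_less = (<), s_sets = Sets\<rparr> RCA0"
    and le_iff_less_or_eq: "a \<le> b \<longleftrightarrow> a < b \<or> a = b"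
    and minus_eq: "a - b = (if \<exists>c. a = b + c then THE c. a = b + c else 0)"

lemma struct_models_RCA0: "models (struct :: 'a::rca0_model l2_structure) RCA0"
  unfolding struct_def by (rule models_RCA0)

typedef number = "UNIV :: nat set" by simp

instantiation number :: model_carrier
begin

definition "0 = Abs_number (s_zero chosen_structure)"
definition "1 = Abs_number (s_one chosen_structure)"
definition "a + b = Abs_number (s_plus chosen_structure (Rep_number a) (Rep_number b))"
definition "a * b = Abs_number (s_times chosen_structure (Rep_number a) (Rep_number b))"
definition "a < b \<longleftrightarrow> s_less chosen_structure (Rep_number a) (Rep_number b)"
definition "a \<le> b \<longleftrightarrow> a < b \<or> a = (b :: number)"
definition "a - b = (if \<exists>c. a = b + c then THE c :: number. a = b + c else 0)"
definition "Sets = (\<lambda>X. Abs_number ` X) ` s_sets chosen_structure"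

instance ..

end

lemma Rep_number_eval: "Rep_number (eval struct e t) = eval chosen_structure (\<lambda>i. Rep_number (e i)) t"
  by (induction t)
    (simp_all add: zero_number_def one_number_def plus_number_def times_number_def Abs_number_inverse)

lemma Abs_number_mem: "x \<in> Abs_number ` X \<longleftrightarrow> Rep_number x \<in> X"
  by (metis Abs_number_inverse Rep_number_inverse UNIV_I image_iff)

lemma sat_number:
  "sat struct e (\<lambda>X. Abs_number ` v X) \<phi> \<longleftrightarrow> sat chosen_structure (\<lambda>i. Rep_number (e i)) v \<phi>"
proof (induction \<phi> arbitrary: e v)
  case (AllN \<phi>)
  have "(\<lambda>i. Rep_number (case_nat x e i)) = case_nat (Rep_number x) (\<lambda>i. Rep_number (e i))" for x
    by (auto simp: fun_eq_iff split: nat.split)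
  with AllN show ?case
    by simp (metis Abs_number_inverse UNIV_I)
next
  case (AllS \<phi>)
  have "(\<lambda>X. Abs_number ` case_nat Y v X) = case_nat (Abs_number ` Y) (\<lambda>X. Abs_number ` v X)" for Y
    by (auto simp: fun_eq_iff split: nat.split)
  with AllS[of e "case_nat _ v"] show ?case by (simp add: Sets_number_def)
qed (simp_all add: Rep_number_eval[symmetric] Rep_number_inject less_number_def Abs_number_mem)

lemma models_number: "models (struct :: number l2_structure) T \<longleftrightarrow> models chosen_structure T"
proof
  assume number: "models (struct :: number l2_structure) T"
  show "models chosen_structure T"
    unfolding models_def
  proof (intro conjI ballI allI impI)
    show "s_sets chosen_structure \<noteq> {}" using number by (simp add: models_def Sets_number_def)
    fix \<phi> e and v :: "nat \<Rightarrow> nat set"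
    assume "\<phi> \<in> T" "range v \<subseteq> s_sets chosen_structure"
    then have "sat struct (\<lambda>i. Abs_number (e i)) (\<lambda>X. Abs_number ` v X) \<phi>"
      using number by (auto simp: models_def Sets_number_def image_subset_iff)
    then show "sat chosen_structure e v \<phi>" by (simp add: sat_number Abs_number_inverse)
  qed
next
  assume chosen: "models chosen_structure T"
  show "models (struct :: number l2_structure) T"
    unfolding models_def
  proof (intro conjI ballI allI impI)
    show "s_sets (struct :: number l2_structure) \<noteq> {}"
      using chosen by (simp add: models_def Sets_number_def)
    fix \<phi> and e :: "nat \<Rightarrow> number" and v :: "nat \<Rightarrow> number set"
    assume "\<phi> \<in> T" "range v \<subseteq> s_sets (struct :: number l2_structure)"
    then have "\<forall>X. \<exists>Y\<in>s_sets chosen_structure. v X = Abs_number ` Y"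
      by (simp add: Sets_number_def image_subset_iff image_iff)
    then obtain w where "\<And>X. w X \<in> s_sets chosen_structure" "\<And>X. v X = Abs_number ` w X"
      by metis
    then have "v = (\<lambda>X. Abs_number ` w X)" "sat chosen_structure (\<lambda>i. Rep_number (e i)) w \<phi>"
      using chosen \<open>\<phi> \<in> T\<close> by (auto simp: models_def image_subset_iff)
    then show "sat struct e v \<phi>" by (simp add: sat_number)
  qed
qed

instance number :: rca0_model
proof
  show "models \<lparr>s_zero = 0, s_one = 1, s_plus = (+), s_times = (*), s_less = (<),
      s_sets = (Sets :: number set set)\<rparr> RCA0"
    using chosen_structure_models_RCA0 models_number[of RCA0] by (simp add: struct_def)
qed (simp_all add: less_eq_number_def minus_number_def)


section \<open>Definability\<close>

text \<open>
  Shallow counterparts of terms and bounded formulas with arbitrary number and set parameters: a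
  predicate on environments takes the place of a formula.
\<close>

inductive tm :: "((nat \<Rightarrow> 'a::model_carrier) \<Rightarrow> 'a) \<Rightarrow> bool" where
  tm_var: "tm (\<lambda>e. e i)"
| tm_const: "tm (\<lambda>e. c)"
| tm_plus: "tm f \<Longrightarrow> tm g \<Longrightarrow> tm (\<lambda>e. f e + g e)"
| tm_times: "tm f \<Longrightarrow> tm g \<Longrightarrow> tm (\<lambda>e. f e * g e)"

inductive bd :: "((nat \<Rightarrow> 'a::model_carrier) \<Rightarrow> bool) \<Rightarrow> bool" where
  bd_eq: "tm f \<Longrightarrow> tm g \<Longrightarrow> bd (\<lambda>e. f e = g e)"
| bd_less: "tm f \<Longrightarrow> tm g \<Longrightarrow> bd (\<lambda>e. f e < g e)"
| bd_mem: "tm f \<Longrightarrow> A \<in> Sets \<Longrightarrow> bd (\<lambda>e. f e \<in> A)"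
| bd_False: "bd (\<lambda>e. False)"
| bd_imp: "bd P \<Longrightarrow> bd Q \<Longrightarrow> bd (\<lambda>e. P e \<longrightarrow> Q e)"
| bd_all_less_env: "tm f \<Longrightarrow> bd Q \<Longrightarrow> bd (\<lambda>e. \<forall>x. x < f e \<longrightarrow> Q (case_nat x e))"

definition sig :: "((nat \<Rightarrow> 'a::model_carrier) \<Rightarrow> bool) \<Rightarrow> bool" where
  "sig P \<longleftrightarrow> (\<exists>Q. bd Q \<and> (\<forall>e. P e \<longleftrightarrow> (\<exists>y. Q (case_nat y e))))"

text \<open>A formula has a single environment. Its even variables carry the varying environment and
  its odd ones the fixed number parameters; the same interleaving merges the parameters of two
  formulas.\<close>

definition mix :: "(nat \<Rightarrow> 'b) \<Rightarrow> (nat \<Rightarrow> 'b) \<Rightarrow> nat \<Rightarrow> 'b" where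
  "mix e p i = (if even i then e (i div 2) else p (i div 2))"

lemma mix_simps [simp]: "mix e p (2 * i) = e i" "mix e p (Suc (2 * i)) = p i"
  by (simp_all add: mix_def)

lemma sat_reindex:
  assumes "\<And>i. E' i = E (h i)" "\<And>X. v' X = v (k X)"
  shows "sat M E v (subst (\<lambda>i. Var (h i)) k \<phi>) \<longleftrightarrow> sat M E' v' \<phi>"
proof -
  have "E' = (\<lambda>i. E (h i))" "v' = (\<lambda>X. v (k X))" using assms by auto
  then show ?thesis by (simp add: sat_subst)
qed

lemma bounded_subst: "bounded \<phi> \<Longrightarrow> bounded (subst \<sigma> \<rho> \<phi>)"
proof (induction arbitrary: \<sigma> \<rho> rule: bounded.induct)
  case (6 \<phi> t)
  have "subst_trm (case_nat (Var 0) (\<lambda>i. lift_trm (\<sigma> i))) (lift_trm t) = lift_trm (subst_trm \<sigma> t)"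
    by (simp add: subst_trm_lift_trm lift_trm_subst_trm)
  then show ?case using 6 by (auto intro: bounded.intros)
qed (auto intro: bounded.intros)

lemma mix_index_cases:
  obtains "i = 0" | k where "i = 2 * Suc k" | k where "i = Suc (2 * k)"
proof (cases "even i")
  case True
  then obtain k where "i = 2 * k" by (rule evenE)
  then show ?thesis using that(1,2) by (cases k) auto
next
  case False
  then obtain k where "i = 2 * k + 1" by (rule oddE)
  then show ?thesis using that(3) by simp
qed

lemma mix_case_nat:
  "mix (case_nat x e) r i = case_nat x (mix e r) (if i = 0 then 0 else if even i then i - 1 else Suc i)"
  by (cases rule: mix_index_cases[of i]) (simp_all add: mix_def)

lemma mix_case_nat2:
  "mix (case_nat y (case_nat x e)) r i = case_nat y (case_nat x (mix e r))
    (if i = 0 then 0 else if i = 2 then 1 else if even i then i - 2 else Suc (Suc i))"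
proof (cases rule: mix_index_cases[of i])
  case (2 k)
  then show ?thesis by (cases k) (simp_all add: mix_def)
next
  case (3 k)
  then have "i \<noteq> 2" by presburger
  with 3 show ?thesis by (simp add: mix_def)
qed (simp add: mix_def)

text \<open>A binder prepends its value to the whole interleaved environment, whereas the
  represented predicate prepends it to the even part alone. This renaming mediates between the two
  layouts.\<close>

definition unmix1 :: "fm \<Rightarrow> fm" where
  "unmix1 = subst (\<lambda>i. Var (if i = 0 then 0 else if even i then i - 1 else Suc i)) (\<lambda>X. X)"

definition unmix2 :: "fm \<Rightarrow> fm" where
  "unmix2 = subst (\<lambda>i. Var (if i = 0 then 0 else if i = 2 then 1 else if even i then i - 2
    else Suc (Suc i))) (\<lambda>X. X)"

lemma sat_unmix1: "sat M (case_nat x (mix e p)) v (unmix1 \<phi>) \<longleftrightarrow> sat M (mix (case_nat x e) p) v \<phi>"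
  unfolding unmix1_def by (rule sat_reindex) (rule mix_case_nat, rule refl)

lemma sat_unmix2:
  "sat M (case_nat y (case_nat x (mix e p))) v (unmix2 \<phi>) \<longleftrightarrow>
    sat M (mix (case_nat y (case_nat x e)) p) v \<phi>"
  unfolding unmix2_def by (rule sat_reindex) (rule mix_case_nat2, rule refl)

lemma bounded_unmix: "bounded \<phi> \<Longrightarrow> bounded (unmix1 \<phi>)" "bounded \<phi> \<Longrightarrow> bounded (unmix2 \<phi>)"
  by (simp_all add: unmix1_def unmix2_def bounded_subst)

definition represents :: "fm \<Rightarrow> (nat \<Rightarrow> 'a::model_carrier) \<Rightarrow> (nat \<Rightarrow> 'a set) \<Rightarrow> ((nat \<Rightarrow> 'a) \<Rightarrow> bool) \<Rightarrow> bool" where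
  "represents \<phi> p v Q \<longleftrightarrow> bounded \<phi> \<and> range v \<subseteq> Sets \<and> (\<forall>e. Q e \<longleftrightarrow> sat struct (mix e p) v \<phi>)"

lemma represents_reparam:
  assumes "represents \<phi> p v Q" "range w \<subseteq> Sets" "\<And>i. p i = q (h i)" "\<And>X. v X = w (k X)"
  shows "\<exists>\<psi>. represents \<psi> q w Q"
proof -
  let ?h = "\<lambda>i. if even i then i else Suc (2 * h (i div 2))"
  have "sat struct (mix e q) w (subst (\<lambda>i. Var (?h i)) k \<phi>) \<longleftrightarrow> sat struct (mix e p) v \<phi>" for e
    by (rule sat_reindex) (auto simp: assms mix_def)
  then show ?thesis
    using assms(1,2) by (auto simp: represents_def intro!: exI[of _ "subst (\<lambda>i. Var (?h i)) k \<phi>"] bounded_subst)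
qed

lemma range_mix: "range v \<subseteq> A \<Longrightarrow> range w \<subseteq> A \<Longrightarrow> range (mix v w) \<subseteq> A"
  by (auto simp: mix_def)

lemma represents_common:
  assumes P: "represents \<phi> p v P" and Q: "represents \<psi> q w Q"
  shows "\<exists>\<phi>' \<psi>'. represents \<phi>' (mix p q) (mix v w) P \<and> represents \<psi>' (mix p q) (mix v w) Q"
proof -
  have "range v \<subseteq> Sets" "range w \<subseteq> Sets" using P Q by (auto simp: represents_def)
  then have "range (mix v w) \<subseteq> Sets" by (rule range_mix)
  then show ?thesis
    using represents_reparam[OF P, of "mix v w" "mix p q" "\<lambda>i. 2 * i" "\<lambda>i. 2 * i"]
      represents_reparam[OF Q, of "mix v w" "mix p q" "\<lambda>i. Suc (2 * i)" "\<lambda>i. Suc (2 * i)"]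
    by auto
qed

lemma eval_mix_reparam:
  assumes "\<And>i. p i = q (h i)"
  shows "\<exists>t'. \<forall>e. eval M (mix e q) t' = eval M (mix e p) t"
proof -
  let ?h = "\<lambda>i. if even i then i else Suc (2 * h (i div 2))"
  have "(\<lambda>i. mix e q (?h i)) = mix e p" for e
    by (auto simp: assms mix_def fun_eq_iff)
  then have "eval M (mix e q) (subst_trm (\<lambda>i. Var (?h i)) t) = eval M (mix e p) t" for e
    by (simp add: eval_subst_trm)
  then show ?thesis by blast
qed

lemma eval_mix_common:
  "\<exists>s' t'. \<forall>e. eval M (mix e (mix p q)) s' = eval M (mix e p) s \<and>
    eval M (mix e (mix p q)) t' = eval M (mix e q) t"
  using eval_mix_reparam[of p "mix p q" "\<lambda>i. 2 * i" M s]
    eval_mix_reparam[of q "mix p q" "\<lambda>i. Suc (2 * i)" M t] by auto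

lemma tm_represented_op:
  assumes "\<exists>t p. \<forall>e. f e = eval struct (mix e p) t" "\<exists>t p. \<forall>e. g e = eval struct (mix e p) t"
    and c: "\<And>e s t. eval struct e (c s t) = h (eval struct e s) (eval struct e t)"
  shows "\<exists>t p. \<forall>e. h (f e) (g e) = eval struct (mix e p) t"
proof -
  obtain s p t q where st: "\<And>e. f e = eval struct (mix e p) s" "\<And>e. g e = eval struct (mix e q) t"
    using assms(1,2) by blast
  obtain s' t' where "\<And>e. eval struct (mix e (mix p q)) s' = eval struct (mix e p) s"
    "\<And>e. eval struct (mix e (mix p q)) t' = eval struct (mix e q) t"
    using eval_mix_common by blast
  then have "h (f e) (g e) = eval struct (mix e (mix p q)) (c s' t')" for e
    by (simp add: st c)
  then show ?thesis by blast
qed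

lemma tm_represented: "tm f \<Longrightarrow> \<exists>t p. \<forall>e. f e = eval struct (mix e p) t"
proof (induction rule: tm.induct)
  case (tm_var i)
  then show ?case by (auto intro!: exI[of _ "Var (2 * i)"])
next
  case (tm_const c)
  then show ?case by (auto simp: mix_def intro!: exI[of _ "Var 1"] exI[of _ "\<lambda>_. c"])
next
  case (tm_plus f g)
  show ?case by (rule tm_represented_op[where c = TAdd, OF tm_plus.IH]) simp
next
  case (tm_times f g)
  show ?case by (rule tm_represented_op[where c = TMul, OF tm_times.IH]) simp
qed

lemma Sets_nonempty: "(Sets :: 'a::rca0_model set set) \<noteq> {}"
  using struct_models_RCA0[where 'a='a] by (simp add: models_def)

lemma represents_atom:
  fixes f :: "(nat \<Rightarrow> 'a::rca0_model) \<Rightarrow> 'a"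
  assumes f: "tm f" and g: "tm g" and a: "\<And>s t. bounded (a s t)"
    "\<And>s t e v. sat (struct :: 'a l2_structure) e v (a s t) \<longleftrightarrow> R (eval struct e s) (eval struct e t)"
  shows "\<exists>\<phi> p v. represents \<phi> p v (\<lambda>e. R (f e) (g e))"
proof -
  obtain A where A: "(A :: 'a set) \<in> Sets" using Sets_nonempty by blast
  obtain s p where s: "\<And>e. f e = eval struct (mix e p) s"
    using f tm_represented by blast
  obtain t q where t: "\<And>e. g e = eval struct (mix e q) t"
    using g tm_represented by blast
  obtain s' t' where "\<And>e. eval struct (mix e (mix p q)) s' = eval struct (mix e p) s"
    "\<And>e. eval struct (mix e (mix p q)) t' = eval struct (mix e q) t"
    using eval_mix_common by blast
  then have "represents (a s' t') (mix p q) (\<lambda>_. A) (\<lambda>e. R (f e) (g e))"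
    using A by (auto simp: represents_def a s t)
  then show ?thesis by blast
qed

lemma bd_represented:
  fixes Q :: "(nat \<Rightarrow> 'a::rca0_model) \<Rightarrow> bool"
  shows "bd Q \<Longrightarrow> \<exists>\<phi> p v. represents \<phi> p v Q"
proof (induction rule: bd.induct)
  case (bd_eq f g)
  then show ?case by (rule represents_atom[where a = FEq]) (simp_all add: bounded.intros)
next
  case (bd_less f g)
  then show ?case by (rule represents_atom[where a = FLess]) (simp_all add: bounded.intros)
next
  case (bd_mem f A)
  obtain t p where "\<And>e. f e = eval struct (mix e p) t" using bd_mem tm_represented by blast
  then have "represents (t \<epsilon> 0) p (\<lambda>_. A) (\<lambda>e. f e \<in> A)"
    using bd_mem by (simp add: represents_def bounded.intros)
  then show ?case by blast
next
  case bd_False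
  obtain A where A: "(A :: 'a set) \<in> Sets" using Sets_nonempty by blast
  then have "represents \<^bold>\<bottom> p (\<lambda>_. A) (\<lambda>e. False)" for p
    by (auto simp: represents_def intro: bounded.intros)
  then show ?case by blast
next
  case (bd_imp P Q)
  then obtain \<phi> \<psi> p v where "represents \<phi> p v P" "represents \<psi> p v Q"
    using represents_common by blast
  then have "represents (\<phi> \<^bold>\<longrightarrow> \<psi>) p v (\<lambda>e. P e \<longrightarrow> Q e)"
    by (auto simp: represents_def intro: bounded.intros)
  then show ?case by blast
next
  case (bd_all_less_env f Q)
  obtain t p where t: "\<And>e. f e = eval struct (mix e p) t"
    using bd_all_less_env tm_represented by blast
  obtain \<phi> q v where \<phi>: "represents \<phi> q v Q" using bd_all_less_env by blast
  obtain t' where t': "\<And>e. f e = eval struct (mix e (mix p q)) t'"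
    unfolding t using eval_mix_reparam[of p "mix p q" "\<lambda>i. 2 * i" struct t] by (metis mix_simps(1))
  obtain \<phi>' where \<phi>': "represents \<phi>' (mix p q) v Q"
    using represents_reparam[OF \<phi>, of v "mix p q" "\<lambda>i. Suc (2 * i)" "\<lambda>X. X"] \<phi>
    by (auto simp: represents_def)
  let ?\<psi> = "AllN (Var 0 \<prec> lift_trm t' \<^bold>\<longrightarrow> unmix1 \<phi>')"
  have "bounded ?\<psi>"
    using \<phi>' by (auto simp: represents_def intro: bounded.intros bounded_unmix)
  moreover have "range v \<subseteq> Sets" using \<phi> by (simp add: represents_def)
  ultimately have "represents ?\<psi> (mix p q) v (\<lambda>e. \<forall>x. x < f e \<longrightarrow> Q (case_nat x e))"
    using t' \<phi>' by (simp add: represents_def sat_unmix1)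
  then show ?case by blast
qed

text \<open>The \<Pi>-formula that the comprehension axiom asks for is the negation of the
  \<Sigma>-formula for the complement. The parameters of both are merged first, so that they refer
  to one environment.\<close>

lemma Delta01_comprehension:
  fixes e :: "nat \<Rightarrow> 'a::rca0_model"
  assumes "sig P" "sig (\<lambda>e. \<not> P e)"
  shows "{x. P (case_nat x e)} \<in> Sets"
proof -
  obtain Q R where Q: "bd Q" "\<And>e. P e \<longleftrightarrow> (\<exists>y. Q (case_nat y e))"
    and R: "bd R" "\<And>e. \<not> P e \<longleftrightarrow> (\<exists>y. R (case_nat y e))"
    using assms unfolding sig_def by blast
  then obtain \<phi> \<psi> p v where \<phi>: "represents \<phi> p v Q" and \<psi>: "represents \<psi> p v R"
    using bd_represented represents_common by metis
  have \<phi>': "sat struct (case_nat y (case_nat x (mix e p))) v (unmix2 \<phi>) \<longleftrightarrow> Q (case_nat y (case_nat x e))"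
    for x y using \<phi> by (simp add: represents_def sat_unmix2)
  have \<psi>': "sat struct (case_nat y (case_nat x (mix e p))) v (unmix2 \<psi>) \<longleftrightarrow> R (case_nat y (case_nat x e))"
    for x y using \<psi> by (simp add: represents_def sat_unmix2)
  have b: "bounded (unmix2 \<phi>)" "bounded (\<^bold>\<not> unmix2 \<psi>)"
    using \<phi> \<psi> by (auto simp: represents_def intro!: bounded.intros bounded_unmix)
  have "(AllN (ExN (unmix2 \<phi>) \<^bold>\<longleftrightarrow> AllN (\<^bold>\<not> unmix2 \<psi>)) \<^bold>\<longrightarrow> comprehension (ExN (unmix2 \<phi>))) \<in> RCA0"
    using b unfolding RCA0_def Sigma01_def Pi01_def by blast
  then have "sat struct (mix e p) v (AllN (ExN (unmix2 \<phi>) \<^bold>\<longleftrightarrow> AllN (\<^bold>\<not> unmix2 \<psi>)) \<^bold>\<longrightarrow> comprehension (ExN (unmix2 \<phi>)))"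
    using struct_models_RCA0[where 'a='a] \<phi> unfolding models_def represents_def struct_simps by blast
  moreover have "sat struct (mix e p) v (AllN (ExN (unmix2 \<phi>) \<^bold>\<longleftrightarrow> AllN (\<^bold>\<not> unmix2 \<psi>)))"
    unfolding sat.simps \<phi>' \<psi>' using Q(2) R(2) by metis
  ultimately have "sat struct (mix e p) v (comprehension (ExN (unmix2 \<phi>)))"
    by (simp only: sat.simps)
  then show ?thesis
    unfolding sat_comprehension by (simp add: \<phi>' Q(2) del: subst.simps)
qed

lemma sat_ExN: "sat M e v (ExN \<phi>) \<longleftrightarrow> (\<exists>x. sat M (case_nat x e) v \<phi>)"
  by simp

lemma sig_induct_env:
  fixes e :: "nat \<Rightarrow> 'a::rca0_model"
  assumes "sig P" "P (case_nat 0 e)" "\<And>x. P (case_nat x e) \<Longrightarrow> P (case_nat (x + 1) e)"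
  shows "P (case_nat x e)"
proof -
  obtain Q where Q: "bd Q" "\<And>e. P e \<longleftrightarrow> (\<exists>y. Q (case_nat y e))"
    using assms unfolding sig_def by blast
  then obtain \<phi> p v where \<phi>: "represents \<phi> p v Q"
    using bd_represented by metis
  have \<phi>': "sat struct (case_nat y (case_nat x (mix e p))) v (unmix2 \<phi>) \<longleftrightarrow> Q (case_nat y (case_nat x e))"
    for x y using \<phi> by (simp add: represents_def sat_unmix2)
  have "ExN (unmix2 \<phi>) \<in> Sigma01"
    using \<phi> by (auto simp: represents_def Sigma01_def intro!: bounded_unmix)
  then have "induction (ExN (unmix2 \<phi>)) \<in> RCA0"
    unfolding RCA0_def by blast
  then have "sat struct (mix e p) v (induction (ExN (unmix2 \<phi>)))"
    using struct_models_RCA0[where 'a='a] \<phi> unfolding models_def represents_def struct_simps by blast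
  then have "P (case_nat 0 e) \<longrightarrow> (\<forall>x. P (case_nat x e) \<longrightarrow> P (case_nat (x + 1) e)) \<longrightarrow> (\<forall>x. P (case_nat x e))"
    unfolding sat_induction sat_ExN \<phi>' struct_simps Q(2) .
  then show ?thesis using assms(2,3) by blast
qed

section \<open>Closure rules for bounded definability\<close>

lemma tm_reindex: "tm f \<Longrightarrow> tm (\<lambda>e. f (\<lambda>i. e (h i)))"
  by (induction rule: tm.induct) (auto intro: tm.intros)

lemma bd_reindex: "bd Q \<Longrightarrow> bd (\<lambda>e. Q (\<lambda>i. e (h i)))"
proof (induction arbitrary: h rule: bd.induct)
  case (bd_all_less_env f Q)
  have "(\<lambda>i. case_nat x e (case_nat 0 (\<lambda>i. Suc (h i)) i)) = case_nat x (\<lambda>i. e (h i))" for x and e :: "nat \<Rightarrow> 'a"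
    by (auto simp: fun_eq_iff split: nat.split)
  with bd.bd_all_less_env[OF tm_reindex[OF bd_all_less_env(1)] bd_all_less_env(3)[of "case_nat 0 (\<lambda>i. Suc (h i))"]]
  show ?case by simp
qed (auto intro: bd.intros tm_reindex)

text \<open>With the bound value and the environment as separate arguments, the rule can be applied
  backwards to a displayed quantifier; definability proofs then become mere applications of
  \<open>intro\<close>.\<close>

lemma bd_all_less:
  assumes "tm f" "bd (\<lambda>e. Q (e 0) (\<lambda>i. e (Suc i)))"
  shows "bd (\<lambda>e. \<forall>x. x < f e \<longrightarrow> Q x e)"
  using bd_all_less_env[OF assms] by simp

lemma bd_not: "bd P \<Longrightarrow> bd (\<lambda>e. \<not> P e)"
  using bd_imp[of P "\<lambda>_. False"] bd_False by simp

lemma bd_or: "bd P \<Longrightarrow> bd Q \<Longrightarrow> bd (\<lambda>e. P e \<or> Q e)"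
  using bd_imp[of "\<lambda>e. \<not> P e" Q] by (simp add: bd_not disj_imp)

lemma bd_and: "bd P \<Longrightarrow> bd Q \<Longrightarrow> bd (\<lambda>e. P e \<and> Q e)"
  using bd_not[OF bd_or[of "\<lambda>e. \<not> P e" "\<lambda>e. \<not> Q e"]] by (simp add: bd_not)

lemma bd_iff: "bd P \<Longrightarrow> bd Q \<Longrightarrow> bd (\<lambda>e. P e \<longleftrightarrow> Q e)"
  unfolding iff_conv_conj_imp by (intro bd_and bd_imp)

lemma bd_if: "bd P \<Longrightarrow> bd Q \<Longrightarrow> bd R \<Longrightarrow> bd (\<lambda>e. if P e then Q e else R e)"
  unfolding if_bool_eq_conj by (intro bd_and bd_imp bd_not)

lemma bd_True: "bd (\<lambda>e. True)"
  using bd_not[OF bd_False] by simp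

lemma bd_ex_less:
  assumes "tm f" "bd (\<lambda>e. Q (e 0) (\<lambda>i. e (Suc i)))"
  shows "bd (\<lambda>e. \<exists>x. x < f e \<and> Q x e)"
  using bd_not[OF bd_all_less[of f "\<lambda>x e. \<not> Q x e"]] assms by (simp add: bd_not)

lemma sig_ex_bd:
  assumes "bd (\<lambda>e. Q (e 0) (\<lambda>i. e (Suc i)))"
  shows "sig (\<lambda>e. \<exists>x. Q x e)"
  unfolding sig_def by (rule exI, rule conjI[OF assms]) simp

lemma sig_bd: "bd Q \<Longrightarrow> sig Q"
  using sig_ex_bd[of "\<lambda>x. Q"] bd_reindex[of Q Suc] by simp

lemmas bd_intros = tm_var tm_const tm_plus tm_times bd_eq bd_less bd_mem bd_False bd_True bd_imp
  bd_and bd_or bd_iff bd_if bd_not bd_all_less bd_ex_less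

lemma Sets_bd:
  fixes P :: "'a::rca0_model \<Rightarrow> bool"
  assumes "bd (\<lambda>e. P (e 0))"
  shows "{x. P x} \<in> Sets"
  using Delta01_comprehension[OF sig_bd[OF assms] sig_bd[OF bd_not[OF assms]], of "\<lambda>_. 0"] by simp

lemma sig_induct:
  fixes P :: "'a::rca0_model \<Rightarrow> bool"
  assumes "sig (\<lambda>e. P (e 0))" "P 0" "\<And>x. P x \<Longrightarrow> P (x + 1)"
  shows "P x"
  using sig_induct_env[OF assms(1), of "\<lambda>_. 0" x] assms(2,3) by simp

lemma bd_induct:
  fixes P :: "'a::rca0_model \<Rightarrow> bool"
  assumes "P 0" "\<And>x. P x \<Longrightarrow> P (x + 1)" "bd (\<lambda>e. P (e 0))"
  shows "P x"
  using sig_induct[OF sig_bd] assms by blast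


section \<open>Arithmetic\<close>

lemma basic_axioms_semantic:
  fixes a b :: "'a::rca0_model"
  shows "a + 1 \<noteq> 0" "a + 1 = b + 1 \<Longrightarrow> a = b" "a + 0 = a" "a + (b + 1) = (a + b) + 1"
  "a * 0 = 0" "a * (b + 1) = a * b + a" "\<not> a < 0" "a < b + 1 \<longleftrightarrow> a < b \<or> a = b"
proof -
  obtain A where A: "(A :: 'a set) \<in> Sets" using Sets_nonempty by blast
  then have "range (\<lambda>_::nat. A) \<subseteq> Sets" by blast
  then have "\<forall>\<phi>\<in>basic_axioms. sat struct (case_nat a (\<lambda>_. b)) (\<lambda>_. A) \<phi>"
    using struct_models_RCA0[where 'a='a] unfolding models_def RCA0_def struct_simps by blast
  note * = this[unfolded basic_axioms_def ball_simps sat.simps eval.simps struct_simps One_nat_def nat.case]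
  show "a + 1 \<noteq> 0" "a + 0 = a" "a + (b + 1) = (a + b) + 1"
    "a * 0 = 0" "a * (b + 1) = a * b + a" "\<not> a < 0" "a < b + 1 \<longleftrightarrow> a < b \<or> a = b"
    using * by blast+
  show "a = b" if "a + 1 = b + 1"
    using that * by metis
qed

instance rca0_model \<subseteq> comm_semiring_1
proof
  fix a b c :: 'a
  note S = basic_axioms_semantic
  show assoc: "a + b + c = a + (b + c)" for a b c :: 'a
    by (rule bd_induct[where P = "\<lambda>c. a + b + c = a + (b + c)"]) (simp_all add: S(3,4), intro bd_intros)
  show zero: "0 + a = a" for a :: 'a
    by (rule bd_induct[where P = "\<lambda>a. 0 + a = a"]) (simp_all add: S(3,4), intro bd_intros)
  have succ: "a + 1 + b = a + b + 1" for a b :: 'a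
    by (rule bd_induct[where P = "\<lambda>b. a + 1 + b = a + b + 1"]) (simp_all add: S(3,4), intro bd_intros)
  show comm: "a + b = b + a" for a b :: 'a
    by (rule bd_induct[where P = "\<lambda>b. a + b = b + a"]) (simp_all add: S(3,4) zero succ, intro bd_intros)
  have left_comm: "a + (b + c) = b + (a + c)" for a b c :: 'a
    by (metis assoc comm)
  note ac = assoc comm left_comm
  show zero_mult: "0 * a = 0" for a :: 'a
    by (rule bd_induct[where P = "\<lambda>a. 0 * a = 0"]) (simp_all add: S(3,5,6), intro bd_intros)
  show "a * 0 = 0" by (rule S)
  have succ_mult: "(a + 1) * b = a * b + b" for a b :: 'a
    by (rule bd_induct[where P = "\<lambda>b. (a + 1) * b = a * b + b"]) (simp_all add: S(5,6), simp_all add: ac S(3), intro bd_intros)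
  show mult_comm: "a * b = b * a" for a b :: 'a
    by (rule bd_induct[where P = "\<lambda>b. a * b = b * a"]) (simp_all add: S(5,6) zero_mult succ_mult, intro bd_intros)
  have mult_one: "a * 1 = a" for a :: 'a
    using S(6)[of a 0] by (simp only: zero S(5))
  have distrib: "a * (b + c) = a * b + a * c" for a b c :: 'a
  proof (rule bd_induct[where P = "\<lambda>c. a * (b + c) = a * b + a * c"])
    fix c
    assume "a * (b + c) = a * b + a * c"
    then show "a * (b + (c + 1)) = a * b + a * (c + 1)" by (simp add: S(4,6)) (simp add: ac)
  qed (simp_all add: S(3,5), intro bd_intros)
  show "(a + b) * c = a * c + b * c" by (simp add: mult_comm[of _ c] distrib)
  show "a * b * c = a * (b * c)" for a b c :: 'a
  proof (rule bd_induct[where P = "\<lambda>c. a * b * c = a * (b * c)"])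
    show "a * b * 0 = a * (b * 0)" by (simp only: S(5))
    fix c
    assume "a * b * c = a * (b * c)"
    then show "a * b * (c + 1) = a * (b * (c + 1))" by (simp only: distrib mult_one)
  qed (intro bd_intros)
  show "1 * a = a" by (simp only: mult_comm[of 1] mult_one)
  show "(0::'a) \<noteq> 1" using S(1)[of 0] by (metis zero)
qed

lemma zero_or_succ: "x = 0 \<or> (\<exists>y. x = y + (1::'a::rca0_model))"
proof -
  \<comment> \<open>The quantifier stands in front of the disjunction so that the induction formula
    has the shape of \<open>sig_ex_bd\<close>.\<close>
  have "\<exists>y. x = 0 \<or> x = y + 1"
    by (rule sig_induct[where P = "\<lambda>x. \<exists>y. x = 0 \<or> x = y + 1"]) (rule sig_ex_bd, intro bd_intros, auto)
  then show ?thesis by blast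
qed

lemma less_iff_ex_add: "a < b \<longleftrightarrow> (\<exists>c. b = a + c + (1::'a::rca0_model))"
proof
  have "\<exists>c. a < b \<longrightarrow> b = a + c + 1"
  proof (rule sig_induct[where P = "\<lambda>b. \<exists>c. a < b \<longrightarrow> b = a + c + 1"])
    show "\<exists>c. a < 0 \<longrightarrow> 0 = a + c + 1" using basic_axioms_semantic(7)[of a] by blast
    fix b assume "\<exists>c. a < b \<longrightarrow> b = a + c + 1"
    then obtain c where c: "a < b \<longrightarrow> b = a + c + 1" by blast
    show "\<exists>c. a < b + 1 \<longrightarrow> b + 1 = a + c + 1"
    proof (cases "a < b")
      case True
      with c show ?thesis by (intro exI[of _ "c + 1"]) (simp add: ac_simps)
    next
      case False
      then show ?thesis
        by (intro exI[of _ 0]) (auto simp: basic_axioms_semantic(8))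
    qed
  qed (rule sig_ex_bd, intro bd_intros)
  then show "a < b \<Longrightarrow> \<exists>c. b = a + c + 1" by blast
  have "a < a + c + 1" for c
    by (rule bd_induct[where P = "\<lambda>c. a < a + c + 1"])
      (auto simp: basic_axioms_semantic(8) add.assoc[symmetric] intro!: bd_intros)
  then show "\<exists>c. b = a + c + 1 \<Longrightarrow> a < b" by blast
qed

section \<open>Cancellation, linear order and truncated subtraction\<close>

lemma add_right_imp_eq_M: "a + c = b + c \<Longrightarrow> a = (b::'a::rca0_model)"
proof -
  have "a + c = b + c \<longrightarrow> a = b"
  proof (rule bd_induct[where P = "\<lambda>c. a + c = b + c \<longrightarrow> a = b"])
    fix c assume "a + c = b + c \<longrightarrow> a = b"
    then show "a + (c + 1) = b + (c + 1) \<longrightarrow> a = b"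
      using basic_axioms_semantic(2)[of "a + c" "b + c"] by (simp add: ac_simps)
  qed (simp, intro bd_intros)
  then show "a + c = b + c \<Longrightarrow> a = b" by blast
qed

lemma add_left_imp_eq_M: "c + a = c + b \<Longrightarrow> a = (b::'a::rca0_model)"
  using add_right_imp_eq_M[of a c b] by (simp add: ac_simps)

lemma add_eq_self_M: "a = a + c \<Longrightarrow> c = (0::'a::rca0_model)"
  using add_left_imp_eq_M[of a 0 c] by simp

lemma less_total_M: "a < b \<or> a = b \<or> b < (a::'a::rca0_model)"
proof (rule bd_induct[where P = "\<lambda>b. a < b \<or> a = b \<or> b < a"])
  show "a < 0 \<or> a = 0 \<or> 0 < a" using zero_or_succ[of a] by (auto simp: less_iff_ex_add)
  fix b assume "a < b \<or> a = b \<or> b < a"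
  then show "a < b + 1 \<or> a = b + 1 \<or> b + 1 < a"
  proof (elim disjE)
    assume "b < a"
    then obtain c where "a = b + c + 1" by (auto simp: less_iff_ex_add)
    with zero_or_succ[of c] show ?thesis by (auto simp: less_iff_ex_add ac_simps)
  qed (simp_all add: basic_axioms_semantic(8))
qed (intro bd_intros)

lemma minus_eq_iff_M: "a + b - a = (b::'a::rca0_model)"
proof -
  have "(THE c. a + b = a + c) = b" by (rule the_equality) (auto dest: add_left_imp_eq_M)
  then show ?thesis by (subst minus_eq) auto
qed

lemma le_iff_ex_add_M: "a \<le> b \<longleftrightarrow> (\<exists>c. b = a + (c::'a::rca0_model))"
proof
  assume "a \<le> b"
  then show "\<exists>c. b = a + c"
    unfolding le_iff_less_or_eq less_iff_ex_add by (metis add.assoc add.right_neutral)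
next
  assume "\<exists>c. b = a + c"
  then obtain c where "b = a + c" by blast
  with zero_or_succ[of c] show "a \<le> b"
    unfolding le_iff_less_or_eq less_iff_ex_add by (metis add.assoc add.right_neutral)
qed

lemma minus_eq_0_M: "\<not> b \<le> a \<Longrightarrow> a - b = (0::'a::rca0_model)"
  unfolding le_iff_ex_add_M by (subst minus_eq) auto

instance rca0_model \<subseteq> linordered_semidom
proof
  fix a b c :: 'a
  have irrefl: "\<not> a < a" for a :: 'a
  proof
    assume "a < a"
    then obtain c where "a = a + (c + 1)" unfolding less_iff_ex_add by (auto simp: add.assoc)
    then have "c + 1 = 0" by (rule add_eq_self_M)
    then show False using basic_axioms_semantic(1) by blast
  qed
  have trans: "a < c" if "a < b" "b < c" for a b c :: 'a
  proof -
    obtain d e where "b = a + d + 1" "c = b + e + 1" using \<open>a < b\<close> \<open>b < c\<close> unfolding less_iff_ex_add by blast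
    then have "c = a + (d + 1 + e) + 1" by (simp add: ac_simps)
    then show ?thesis unfolding less_iff_ex_add by blast
  qed
  show less_le: "a < b \<longleftrightarrow> a \<le> b \<and> \<not> b \<le> a" for a b :: 'a
    unfolding le_iff_less_or_eq using irrefl trans by metis
  show "a \<le> a" by (simp add: le_iff_less_or_eq)
  show "a \<le> b \<Longrightarrow> b \<le> c \<Longrightarrow> a \<le> c"
    unfolding le_iff_less_or_eq using trans by blast
  show "a \<le> b \<Longrightarrow> b \<le> a \<Longrightarrow> a = b"
    unfolding le_iff_less_or_eq using trans irrefl by metis
  show "a \<le> b \<or> b \<le> a"
    unfolding le_iff_less_or_eq using less_total_M by blast
  show "a + b - a = b" by (rule minus_eq_iff_M)
  show "a \<le> b \<Longrightarrow> c + a \<le> c + b"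
    unfolding le_iff_ex_add_M by (auto simp: add.assoc)
  show "0 < (1::'a)" unfolding less_iff_ex_add by (intro exI[of _ 0]) simp
  show "b \<le> a \<Longrightarrow> a - b + b = a"
  proof -
    assume "b \<le> a"
    then obtain c where "a = b + c" unfolding le_iff_ex_add_M by blast
    then have "a - b + b = c + b" by (simp only: minus_eq_iff_M)
    then show ?thesis using \<open>a = b + c\<close> by (simp only: add.commute)
  qed
  show "a - b - c = a - (b + c)"
  proof (cases "b \<le> a")
    case True
    then obtain d where d: "a = b + d" unfolding le_iff_ex_add_M by blast
    show ?thesis
    proof (cases "c \<le> d")
      case True
      then obtain e where "d = c + e" unfolding le_iff_ex_add_M by blast
      then show ?thesis
        using d minus_eq_iff_M[of b d] minus_eq_iff_M[of c e] minus_eq_iff_M[of "b + c" e]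
        by (simp add: add.assoc)
    next
      case False
      have *: "\<not> b + c \<le> b + d"
      proof
        assume "b + c \<le> b + d"
        then obtain f where "b + d = b + (c + f)" unfolding le_iff_ex_add_M by (auto simp: add.assoc)
        then show False using False add_left_imp_eq_M unfolding le_iff_ex_add_M by blast
      qed
      show ?thesis
        unfolding d minus_eq_iff_M minus_eq_0_M[OF False] minus_eq_0_M[OF *] ..
    qed
  next
    case False
    have *: "\<not> b + c \<le> a" using False unfolding le_iff_ex_add_M by (auto simp: add.assoc)
    have "0 - c = 0"
    proof (cases "c \<le> 0")
      case True
      then obtain d where "c + d = 0" unfolding le_iff_ex_add_M by metis
      then have "c = 0" using zero_or_succ[of c] basic_axioms_semantic(1)
        by (metis add.assoc add.commute)
      then show ?thesis using minus_eq_iff_M[of 0 0] by simp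
    qed (rule minus_eq_0_M)
    then show ?thesis unfolding minus_eq_0_M[OF False] minus_eq_0_M[OF *] by simp
  qed
  show pos: "c * a < c * b" if less: "a < b" "0 < c" for a b c :: 'a
  proof -
    obtain d e where "b = a + d + 1" "c = 0 + e + 1" using less unfolding less_iff_ex_add by blast
    then have "c * b = c * a + (d * e + d + e) + 1" by (simp add: algebra_simps)
    then show ?thesis unfolding less_iff_ex_add by blast
  qed
  show "a * (b - c) = a * b - a * c"
  proof (cases "c \<le> b")
    case True
    then obtain d where "b = c + d" unfolding le_iff_ex_add_M by blast
    then show ?thesis by (simp add: distrib_left minus_eq_iff_M)
  next
    case False
    then have "b < c" using less_total_M[of b c] unfolding le_iff_less_or_eq by blast
    show ?thesis
    proof (cases "a = 0")
      case True
      then show ?thesis using minus_eq_iff_M[of 0 0] by simp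
    next
      case nz: False
      then have "0 < a" using less_total_M[of 0 a] basic_axioms_semantic(7)[of a] by blast
      then have "a * b < a * c" using pos \<open>b < c\<close> by blast
      then have "\<not> a * c \<le> a * b" by (simp add: less_le)
      then have "a * b - a * c = 0" by (rule minus_eq_0_M)
      then show ?thesis unfolding minus_eq_0_M[OF False] by simp
    qed
  qed
  show "a \<noteq> 0 \<Longrightarrow> b \<noteq> 0 \<Longrightarrow> a * b \<noteq> 0"
  proof -
    assume "a \<noteq> 0" "b \<noteq> 0"
    then obtain c d where "a = c + 1" "b = d + 1" using zero_or_succ[of a] zero_or_succ[of b] by metis
    then have "a * b = c * d + c + d + 1" by (simp add: algebra_simps)
    then show "a * b \<noteq> 0" using basic_axioms_semantic(1) by simp
  qed
qed


lemma zero_le_M [simp]: "0 \<le> (a::'a::rca0_model)"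
  unfolding le_iff_ex_add_M by simp

lemma less_iff_succ_le: "a < b \<longleftrightarrow> a + 1 \<le> (b::'a::rca0_model)"
  unfolding le_iff_ex_add_M less_iff_ex_add by (simp add: ac_simps)

lemma less_succ_iff: "a < b + 1 \<longleftrightarrow> a \<le> (b::'a::rca0_model)"
  by (simp add: basic_axioms_semantic(8) order_le_less)

lemma le_square: "b \<le> b * (b::'a::rca0_model)"
proof (cases "b = 0")
  case False
  then have "1 \<le> b" using less_iff_succ_le[of 0 b] by (simp add: less_le)
  then show ?thesis using mult_left_mono[of 1 b b] by simp
qed simp

subsection \<open>Pairs\<close>

definition pr :: "'a::rca0_model \<Rightarrow> 'a \<Rightarrow> 'a" where
  "pr a b = (a + b) * (a + b) + a"

lemma eval_pair [simp]: "eval struct e (pair s t) = pr (eval struct e s) (eval struct e t)"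
  by (simp add: pair_def pr_def)

text \<open>Pairs with sum \<open>s\<close> lie between \<open>s * s\<close> and
  \<open>(s + 1) * (s + 1)\<close>: the latter exceeds \<open>pr a b\<close> by exactly
  \<open>b + s + 1\<close>.\<close>

lemma pr_mono_sum:
  assumes "a + b < c + (d::'a::rca0_model)"
  shows "pr a b < pr c d"
proof -
  let ?s = "a + b"
  have "?s + 1 \<le> c + d" using assms less_iff_succ_le by blast
  then have "(?s + 1) * (?s + 1) \<le> (c + d) * (c + d)" by (intro mult_mono) auto
  moreover have "(?s + 1) * (?s + 1) = pr a b + (b + ?s + 1)"
    unfolding pr_def by (simp add: algebra_simps)
  moreover have "pr a b < pr a b + (b + ?s + 1)"
    unfolding less_iff_ex_add by (intro exI[of _ "b + ?s"]) (simp add: ac_simps)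
  moreover have "(c + d) * (c + d) \<le> pr c d" unfolding pr_def le_iff_ex_add_M by blast
  ultimately show ?thesis by (metis order_less_le_trans)
qed

lemma pr_inject [simp]: "pr a b = pr c d \<longleftrightarrow> a = c \<and> b = (d::'a::rca0_model)"
proof
  assume eq: "pr a b = pr c d"
  then have "a + b = c + d"
    using pr_mono_sum[of a b c d] pr_mono_sum[of c d a b] less_total_M[of "a + b" "c + d"] by auto
  with eq show "a = c \<and> b = d" by (auto simp: pr_def)
qed simp

lemma le_pr1: "a \<le> pr a (b::'a::rca0_model)"
  unfolding pr_def le_iff_ex_add_M by (metis add.commute)

lemma le_pr2: "b \<le> pr a (b::'a::rca0_model)"
proof -
  have "b \<le> a + b" by simp
  also have "\<dots> \<le> (a + b) * (a + b)" by (rule le_square)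
  also have "\<dots> \<le> pr a b" by (simp add: pr_def)
  finally show ?thesis .
qed

lemma tm_pr: "tm f \<Longrightarrow> tm g \<Longrightarrow> tm (\<lambda>e. pr (f e) (g e))"
  unfolding pr_def by (intro tm_plus tm_times)

lemma bd_le:
  fixes f :: "(nat \<Rightarrow> 'a::rca0_model) \<Rightarrow> 'a"
  shows "tm f \<Longrightarrow> tm g \<Longrightarrow> bd (\<lambda>e. f e \<le> g e)"
  unfolding less_succ_iff[symmetric] by (intro bd_intros)

lemma bd_ex_le:
  fixes f :: "(nat \<Rightarrow> 'a::rca0_model) \<Rightarrow> 'a"
  assumes "tm f" "bd (\<lambda>e. Q (e 0) (\<lambda>i. e (Suc i)))"
  shows "bd (\<lambda>e. \<exists>x. x \<le> f e \<and> Q x e)"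
  unfolding less_succ_iff[symmetric] using assms by (intro bd_ex_less tm_plus tm_const)

text \<open>A pair bounds its components, so taking a number apart costs only bounded quantifiers.
  Later definitions are written as nested decompositions
  \<open>\<exists>x y. z = pr x y \<and> ...\<close>, with the other conditions in one bracket, to
  match this rule.\<close>

lemma bd_ex_pr:
  fixes f :: "(nat \<Rightarrow> 'a::rca0_model) \<Rightarrow> 'a"
  assumes f: "tm f" and Q: "bd (\<lambda>e. Q (e 1) (e 0) (\<lambda>i. e (Suc (Suc i))))"
  shows "bd (\<lambda>e. \<exists>x y. f e = pr x y \<and> Q x y e)"
proof -
  have "bd (\<lambda>e. \<exists>x. x \<le> f e \<and> (\<exists>y. y \<le> f e \<and> (f e = pr x y \<and> Q x y e)))"
    using Q by (intro bd_ex_le bd_and bd_eq f tm_pr tm_var tm_reindex[OF f, of "\<lambda>i. Suc (Suc i)"]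
      tm_reindex[OF f, of "Suc"]) simp
  moreover have "(\<exists>x. x \<le> f e \<and> (\<exists>y. y \<le> f e \<and> (f e = pr x y \<and> Q x y e)))
      \<longleftrightarrow> (\<exists>x y. f e = pr x y \<and> Q x y e)" for e
    using le_pr1 le_pr2 by metis
  ultimately show ?thesis by simp
qed

lemma bd_ex_succ:
  fixes f :: "(nat \<Rightarrow> 'a::rca0_model) \<Rightarrow> 'a"
  assumes f: "tm f" and Q: "bd (\<lambda>e. Q (e 0) (\<lambda>i. e (Suc i)))"
  shows "bd (\<lambda>e. \<exists>x. f e = x + 1 \<and> Q x e)"
proof -
  have "bd (\<lambda>e. \<exists>x. x < f e \<and> (f e = x + 1 \<and> Q x e))"
    using Q by (intro bd_intros f tm_reindex[OF f, of "Suc"])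
  moreover have "(\<exists>x. x < f e \<and> (f e = x + 1 \<and> Q x e)) \<longleftrightarrow> (\<exists>x. f e = x + 1 \<and> Q x e)" for e
    by (auto simp: less_succ_iff)
  ultimately show ?thesis by simp
qed

lemmas bd_pr_intros = bd_intros tm_pr bd_le bd_ex_le bd_ex_pr bd_ex_succ

lemma Sets_pr:
  fixes Q :: "'a::rca0_model \<Rightarrow> 'a \<Rightarrow> bool"
  assumes "bd (\<lambda>e. Q (e 1) (e 0))"
  shows "{z. \<exists>x y. z = pr x y \<and> Q x y} \<in> Sets"
  by (intro Sets_bd bd_ex_pr tm_var) (use assms in simp)


subsection \<open>Functions and \<open>\<Sigma>\<close>-definability\<close>

definition fn :: "('a::rca0_model \<Rightarrow> 'a) \<Rightarrow> bool" where
  "fn F \<longleftrightarrow> {z. \<exists>x. z = pr x (F x)} \<in> Sets"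

lemma fn_graph_mem: "pr x y \<in> {z. \<exists>x. z = pr x (F x)} \<longleftrightarrow> F x = y"
  by auto

text \<open>A value of \<open>F\<close> need not be bounded by any term, so \<open>F\<close> enters
  bounded formulas only through equations of this kind, as membership of a pair in its graph. Nested
  applications are resolved either by decomposing a pair or by an unbounded quantifier.\<close>

lemma bd_fn_eq: "fn F \<Longrightarrow> tm f \<Longrightarrow> tm g \<Longrightarrow> bd (\<lambda>e. F (f e) = g e)"
  unfolding fn_graph_mem[symmetric] by (intro bd_mem tm_pr) (auto simp: fn_def)

lemma Sets_sig:
  fixes P :: "'a::rca0_model \<Rightarrow> bool"
  assumes "sig (\<lambda>e. P (e 0))" "sig (\<lambda>e. \<not> P (e 0))"
  shows "{x. P x} \<in> Sets"
  using Delta01_comprehension[OF assms, of "\<lambda>_. 0"] by simp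

lemma fn_of_graph:
  assumes G: "G \<in> Sets" and ex: "\<And>x. \<exists>!y. pr x y \<in> G"
  obtains F where "fn F" "\<And>x y. pr x y \<in> G \<longleftrightarrow> F x = y"
proof -
  obtain F where F: "\<And>x. pr x (F x) \<in> G" using ex by metis
  then have *: "pr x y \<in> G \<longleftrightarrow> F x = y" for x y using ex[of x] by blast
  \<comment> \<open>\<open>G\<close> may contain numbers that are not pairs; these are cut
    off.\<close>
  have "{z. \<exists>x y. z = pr x y \<and> pr x y \<in> G} \<in> Sets"
    using G by (intro Sets_pr bd_pr_intros)
  then have "fn F" unfolding fn_def * by simp
  then show ?thesis using that * by blast
qed


subsection \<open>Division by standard numbers\<close>

lemma division_exists:
  assumes "0 < (d::'a::rca0_model)"
  shows "\<exists>q r. r < d \<and> x = d * q + r"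
proof (rule sig_induct[where P = "\<lambda>x. \<exists>q r. r < d \<and> x = d * q + r"])
  show "\<exists>q r. r < d \<and> 0 = d * q + r" using assms by (intro exI[of _ 0]) simp
  fix x assume "\<exists>q r. r < d \<and> x = d * q + r"
  then obtain q r where qr: "r < d" "x = d * q + r" by blast
  show "\<exists>q r. r < d \<and> x + 1 = d * q + r"
  proof (cases "r + 1 < d")
    case True
    with qr show ?thesis by (intro exI[of _ q] exI[of _ "r + 1"]) (simp add: ac_simps)
  next
    case False
    then have "r + 1 = d" using qr less_iff_succ_le[of r d] by simp
    with qr show ?thesis using assms
      by (intro exI[of _ "q + 1"] exI[of _ 0]) (auto simp: algebra_simps)
  qed
qed (rule sig_ex_bd, intro bd_intros)

lemma division_less:
  assumes "r < d" "q < (q'::'a::rca0_model)"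
  shows "d * q + r < d * q' + r'"
proof -
  have "d * q + r < d * (q + 1)" using assms by (simp add: algebra_simps)
  also have "\<dots> \<le> d * q'" using assms less_iff_succ_le by (intro mult_left_mono) auto
  also have "\<dots> \<le> d * q' + r'" by simp
  finally show ?thesis .
qed

lemma division_unique:
  assumes "r < d" "r' < (d::'a::rca0_model)"
  shows "d * q + r = d * q' + r' \<longleftrightarrow> q = q' \<and> r = r'"
  using division_less[of r d q q' r'] division_less[of r' d q' q r] assms less_total_M[of q q'] by auto

lemma less_3_cases: "(x::'a::rca0_model) < 3 \<longleftrightarrow> x = 0 \<or> x = 1 \<or> x = 2"
  using less_succ_iff[of x 0] less_succ_iff[of x 1] less_succ_iff[of x 2]
  by (auto simp: order_le_less basic_axioms_semantic(7))

lemma less_7_cases: "(x::'a::rca0_model) < 7 \<longleftrightarrow> x = 0 \<or> x = 1 \<or> x = 2 \<or> x = 3 \<or> x = 4 \<or> x = 5 \<or> x = 6"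
  using less_succ_iff[of x 3] less_succ_iff[of x 4] less_succ_iff[of x 5] less_succ_iff[of x 6] less_3_cases[of x]
  by (auto simp: order_le_less)


section \<open>Hamilton paths in a model\<close>

definition graph_seq :: "'a::rca0_model set \<Rightarrow> 'a set \<Rightarrow> bool" where
  "graph_seq V E \<longleftrightarrow> (\<forall>i u v. pr i (pr u v) \<in> E \<longrightarrow>
    pr i u \<in> V \<and> pr i v \<in> V \<and> u \<noteq> v \<and> pr i (pr v u) \<in> E)"

definition hamilton :: "'a::rca0_model set \<Rightarrow> 'a set \<Rightarrow> 'a \<Rightarrow> ('a \<Rightarrow> 'a) \<Rightarrow> bool" where
  "hamilton V E i F \<longleftrightarrow> fn F \<and> (\<forall>n. pr i (F n) \<in> V) \<and> (\<forall>n. pr i (pr (F n) (F (n + 1))) \<in> E) \<and>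
    (\<forall>v. pr i v \<in> V \<longrightarrow> (\<exists>!n. F n = v))"

lemma sat_graph_sequence: "sat struct e v (graph_sequence V E) \<longleftrightarrow> graph_seq (v V) (v E)"
  by (simp add: graph_sequence_def graph_seq_def edge_in_def vertex_in_def)

lemma add_3_eq_Suc': "n + 3 = Suc (Suc (Suc n))"
  by simp

lemma sat_hamilton_path:
  fixes e :: "nat \<Rightarrow> 'a::rca0_model"
  shows "sat struct e v (hamilton_path P V E i) \<longleftrightarrow>
    (\<forall>n. \<exists>!m. pr n m \<in> v P) \<and> (\<forall>n u. pr n u \<in> v P \<longrightarrow> pr (e i) u \<in> v V) \<and>
    (\<forall>n u w. pr n u \<in> v P \<and> pr (n + 1) w \<in> v P \<longrightarrow> pr (e i) (pr u w) \<in> v E) \<and>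
    (\<forall>u. pr (e i) u \<in> v V \<longrightarrow> (\<exists>!n. pr n u \<in> v P))"
proof -
  have ex: "((\<forall>x. Q x \<longrightarrow> False) \<longrightarrow> False) \<longleftrightarrow> (\<exists>x. Q x)" for Q :: "'a \<Rightarrow> bool" by blast
  have conj: "((A \<longrightarrow> B \<longrightarrow> False) \<longrightarrow> False) \<longleftrightarrow> A \<and> B" for A B by blast
  show ?thesis
    unfolding hamilton_path_def path_def total_function_def edge_in_def vertex_in_def sat.simps eval_pair eval.simps Ex1_def numeral_2_eq_2 add_3_eq_Suc' add_2_eq_Suc' Suc_eq_plus1[symmetric]
    One_nat_def nat.case struct_simps
    unfolding ex conj conj_assoc add_Suc_right add_0_right nat.case ..
qed

lemma hamilton_path_iff:
  fixes v :: "nat \<Rightarrow> 'a::rca0_model set"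
  shows "(\<exists>X\<in>Sets. sat struct e (case_nat X v) (hamilton_path 0 (Suc V) (Suc E) i)) \<longleftrightarrow>
    (\<exists>F. hamilton (v V) (v E) (e i) F)"
proof
  assume "\<exists>X\<in>Sets. sat struct e (case_nat X v) (hamilton_path 0 (Suc V) (Suc E) i)"
  then obtain X where X: "X \<in> Sets" "\<And>n. \<exists>!m. pr n m \<in> X" "\<And>n u. pr n u \<in> X \<Longrightarrow> pr (e i) u \<in> v V"
    "\<And>n u w. pr n u \<in> X \<Longrightarrow> pr (n + 1) w \<in> X \<Longrightarrow> pr (e i) (pr u w) \<in> v E"
    "\<And>u. pr (e i) u \<in> v V \<Longrightarrow> \<exists>!n. pr n u \<in> X"
    unfolding sat_hamilton_path by auto
  obtain F where F: "fn F" "\<And>x y. pr x y \<in> X \<longleftrightarrow> F x = y"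
    using fn_of_graph[OF X(1,2)] by blast
  show "\<exists>F. hamilton (v V) (v E) (e i) F"
    unfolding hamilton_def using F(1) X(3-5) unfolding F(2) by blast
next
  assume "\<exists>F. hamilton (v V) (v E) (e i) F"
  then obtain F where F: "hamilton (v V) (v E) (e i) F" by blast
  then have "{z. \<exists>x. z = pr x (F x)} \<in> Sets" by (simp add: hamilton_def fn_def)
  then show "\<exists>X\<in>Sets. sat struct e (case_nat X v) (hamilton_path 0 (Suc V) (Suc E) i)"
  proof (rule bexI[rotated])
    show "sat struct e (case_nat {z. \<exists>x. z = pr x (F x)} v) (hamilton_path 0 (Suc V) (Suc E) i)"
      using F unfolding sat_hamilton_path hamilton_def nat.case fn_graph_mem by auto
  qed
qed

definition hamilton_comprehension :: "'a::rca0_model itself \<Rightarrow> bool" where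
  "hamilton_comprehension _ \<longleftrightarrow> (\<forall>V\<in>Sets. \<forall>E\<in>Sets. graph_seq V E \<longrightarrow>
    {i::'a. \<exists>F. hamilton V E i F} \<in> Sets)"

lemma models_hamilton_sets_exist:
  "models (struct :: 'a::rca0_model l2_structure) {hamilton_sets_exist} \<longleftrightarrow>
    hamilton_comprehension TYPE('a)"
proof -
  have *: "(\<exists>X\<in>Sets. sat struct (case_nat i e) (case_nat X (case_nat Z (case_nat E (case_nat V v))))
      (hamilton_path 0 3 2 0)) \<longleftrightarrow> (\<exists>F. hamilton V E i F)" for i :: 'a and Z E V e v
    using hamilton_path_iff[of "case_nat i e" "case_nat Z (case_nat E (case_nat V v))" 2 1 0]
    by (simp add: numeral_2_eq_2 numeral_3_eq_3)
  have ExS: "sat M e v (ExS \<phi>) \<longleftrightarrow> (\<exists>X\<in>s_sets M. sat M e (case_nat X v) \<phi>)" for M :: "'a l2_structure" and e v \<phi>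
    by simp
  have AllN: "sat M e v (AllN (\<phi> \<^bold>\<longleftrightarrow> \<psi>)) \<longleftrightarrow> (\<forall>x. sat M (case_nat x e) v \<phi> \<longleftrightarrow> sat M (case_nat x e) v \<psi>)"
    for M :: "'a l2_structure" and e v \<phi> \<psi> by auto
  have Z: "(\<exists>Z\<in>Sets. \<forall>i. i \<in> Z \<longleftrightarrow> P i) \<longleftrightarrow> {i. P i} \<in> Sets" for P :: "'a \<Rightarrow> bool"
  proof -
    have "(\<forall>i. i \<in> Z \<longleftrightarrow> P i) \<longleftrightarrow> Z = {i. P i}" for Z by auto
    then show ?thesis by simp
  qed
  have "sat struct e v hamilton_sets_exist \<longleftrightarrow> hamilton_comprehension TYPE('a)" for e and v :: "nat \<Rightarrow> 'a set"
  proof -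
    have "sat struct e (case_nat E (case_nat V v)) (ExS (AllN (Var 0 \<epsilon> 0 \<^bold>\<longleftrightarrow> ExS (hamilton_path 0 3 2 0))))
        \<longleftrightarrow> {i. \<exists>F. hamilton V E i F} \<in> Sets" for V E
      unfolding ExS AllN sat.simps(3) eval.simps nat.case struct_simps * Z ..
    then show ?thesis
      unfolding hamilton_sets_exist_def hamilton_comprehension_def sat.simps(5,7) sat_graph_sequence
      by simp
  qed
  moreover obtain A where "(A :: 'a set) \<in> Sets" using Sets_nonempty by blast
  then have "range (\<lambda>_ :: nat. A) \<subseteq> Sets" by blast
  ultimately show ?thesis
    using Sets_nonempty unfolding models_def struct_simps by blast
qed


section \<open>Directed Hamilton paths\<close>

text \<open>One vertex set serves all instances; only the arcs depend on \<open>i\<close>.\<close>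

definition dhamilton :: "'a::rca0_model set \<Rightarrow> 'a set \<Rightarrow> 'a \<Rightarrow> ('a \<Rightarrow> 'a) \<Rightarrow> bool" where
  "dhamilton W A i D \<longleftrightarrow> fn D \<and> (\<forall>n. D n \<in> W) \<and> (\<forall>n. pr i (pr (D n) (D (n + 1))) \<in> A) \<and>
    (\<forall>w\<in>W. \<exists>!n. D n = w)"

lemma fnI:
  assumes "\<And>x y. F x = y \<longleftrightarrow> Q x y" "bd (\<lambda>e. Q (e 1) (e 0))"
  shows "fn F"
proof -
  have "{z. \<exists>x. z = pr x (F x)} = {z. \<exists>x y. z = pr x y \<and> Q x y}"
    by (auto simp: assms(1)[symmetric])
  then show ?thesis unfolding fn_def using Sets_pr[of Q] assms(2) by simp
qed

lemma mod3_cases: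
  obtains n where "x = 3 * n" | n where "x = 3 * n + 1" | n where "x = 3 * n + (2::'a::rca0_model)"
proof -
  obtain q r where "r < 3" "x = 3 * q + r" using division_exists[of 3 x] by auto
  then show ?thesis using that by (auto simp: less_3_cases)
qed

text \<open>
  A vertex \<open>w\<close> of the directed graph becomes the path \<open>(w, 0) - (w, 1) - (w, 2)\<close>, which is entered
  at \<open>(w, 0)\<close> and left at \<open>(w, 2)\<close>.
\<close>

definition split_adjacent :: "'a::rca0_model set \<Rightarrow> 'a set \<Rightarrow> 'a \<Rightarrow> 'a \<Rightarrow> 'a \<Rightarrow> bool" where
  "split_adjacent W A i u v \<longleftrightarrow> (\<exists>a k. u = pr a k \<and> (\<exists>b l. v = pr b l \<and> a \<in> W \<and> b \<in> W \<and>
    (a = b \<and> (k = 0 \<and> l = 1 \<or> k = 1 \<and> l = 0 \<or> k = 1 \<and> l = 2 \<or> k = 2 \<and> l = 1) \<or>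
     k = 2 \<and> l = 0 \<and> pr i (pr a b) \<in> A \<or> k = 0 \<and> l = 2 \<and> pr i (pr b a) \<in> A)))"

text \<open>Position \<open>3 * n + l\<close> of the new path carries \<open>pr (D n) l\<close>.
  Division by 3 is expressed by a bounded quantifier over the quotient, so the new path exists by
  recursive comprehension.\<close>

lemma dhamilton_imp_hamilton:
  assumes D: "dhamilton W A i D"
    and V: "\<And>v. pr i v \<in> V \<longleftrightarrow> (\<exists>w l. v = pr w l \<and> w \<in> W \<and> (l = 0 \<or> l = 1 \<or> l = 2))"
    and E: "\<And>u v. pr i (pr u v) \<in> E \<longleftrightarrow> split_adjacent W A i u v"
  shows "\<exists>F. hamilton V E i F"
proof -
  define Q where "Q x y \<longleftrightarrow> (\<exists>w l. y = pr w l \<and> (l = 0 \<or> l = 1 \<or> l = 2) \<and>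
    (\<exists>n. n \<le> x \<and> x = 3 * n + l \<and> D n = w))" for x y
  have le: "n \<le> 3 * n + l" for n l :: 'a
  proof -
    have "(1 + 2) * n = n + 2 * n" by (simp only: distrib_right mult_1)
    then have "3 * n + l = n + (2 * n + l)" by (simp add: add.assoc)
    then show ?thesis unfolding le_iff_ex_add_M by blast
  qed
  have Q: "Q (3 * n + l) y \<longleftrightarrow> y = pr (D n) l" if l: "l = 0 \<or> l = 1 \<or> l = 2" for n l y
  proof
    assume "Q (3 * n + l) y"
    then obtain l' m where m: "y = pr (D m) l'" "l' = 0 \<or> l' = 1 \<or> l' = 2" "3 * n + l = 3 * m + l'"
      unfolding Q_def by blast
    have "l < 3" "l' < 3" using l m(2) by (simp_all only: less_3_cases)
    then have "n = m \<and> l = l'" using division_unique[of l 3 l' n m] m(3) by blast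
    with m show "y = pr (D n) l" by simp
  next
    assume "y = pr (D n) l"
    then show "Q (3 * n + l) y" unfolding Q_def using l le[of n l] by blast
  qed
  have "\<exists>!y. Q x y" for x
  proof (cases x rule: mod3_cases)
    case (1 n)
    with Q[of 0 n] show ?thesis by simp
  next
    case (2 n)
    with Q[of 1 n] show ?thesis by simp
  next
    case (3 n)
    with Q[of 2 n] show ?thesis by simp
  qed
  then have "\<exists>F. \<forall>x y. F x = y \<longleftrightarrow> Q x y" by metis
  then obtain F where F: "\<And>x y. F x = y \<longleftrightarrow> Q x y" by blast
  have fnD: "fn D" using D by (simp add: dhamilton_def)
  have "fn F"
    by (rule fnI[OF F]) (unfold Q_def, intro bd_pr_intros bd_fn_eq fnD)
  have Fl: "F (3 * n + l) = pr (D n) l" if "l = 0 \<or> l = 1 \<or> l = 2" for n l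
    unfolding F using that by (simp only: Q)
  have F0: "F (3 * n) = pr (D n) 0" and F1: "F (3 * n + 1) = pr (D n) 1" and F2: "F (3 * n + 2) = pr (D n) 2" for n
    using Fl[of 0 n] Fl[of 1 n] Fl[of 2 n] by simp_all
  have DW: "D n \<in> W" and DA: "pr i (pr (D n) (D (n + 1))) \<in> A" for n
    using D by (auto simp: dhamilton_def)
  have "pr i (F n) \<in> V" for n
    by (cases n rule: mod3_cases) (auto simp: V F0 F1 F2 DW)
  moreover have "pr i (pr (F n) (F (n + 1))) \<in> E" for n
  proof (cases n rule: mod3_cases)
    case (1 m)
    then show ?thesis by (simp add: F0 F1 E split_adjacent_def DW)
  next
    case (2 m)
    then have "n + 1 = 3 * m + 2" by (simp add: add.assoc)
    with 2 show ?thesis by (simp add: F2 F1 E split_adjacent_def DW)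
  next
    case (3 m)
    then have "n + 1 = 3 * (m + 1)" by (simp add: add.assoc distrib_left)
    with 3 show ?thesis by (simp only: F2 F0) (simp add: E split_adjacent_def DW DA)
  qed
  moreover have "\<exists>!n. F n = v" if vV: "pr i v \<in> V" for v
  proof -
    obtain w l where v: "v = pr w l" "w \<in> W" "l = 0 \<or> l = 1 \<or> l = 2"
      using vV unfolding V by blast
    have "\<exists>!n. D n = w" using D v(2) by (simp add: dhamilton_def)
    then obtain n where n: "D n = w" and n_unique: "\<And>m. D m = w \<Longrightarrow> m = n" by blast
    show ?thesis
    proof (rule ex1I[of _ "3 * n + l"])
      show "F (3 * n + l) = v" using v n F0 F1 F2 by auto
      fix x assume x: "F x = v"
      show "x = 3 * n + l"
      proof (cases x rule: mod3_cases)
        case (1 m)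
        then have "D m = w" "l = 0" using x v(1) F0[of m] by simp_all
        with 1 n_unique[of m] show ?thesis by simp
      next
        case (2 m)
        then have "D m = w" "l = 1" using x v(1) F1[of m] by simp_all
        with 2 n_unique[of m] show ?thesis by blast
      next
        case (3 m)
        then have "D m = w" "l = 2" using x v(1) F2[of m] by simp_all
        with 3 n_unique[of m] show ?thesis by blast
      qed
    qed
  qed
  ultimately show ?thesis
    using \<open>fn F\<close> unfolding hamilton_def by blast
qed

text \<open>An undirected path might run through the triples backwards. The source \<open>s\<close>
  excludes this: the path has to begin at \<open>pr s 0\<close>, and from there the direction is
  passed on from triple to triple.\<close>

lemma hamilton_imp_dhamilton:
  assumes s: "s \<in> W" "\<And>u. pr i (pr u s) \<notin> A" and F: "hamilton V E i F"
    and V: "\<And>v. pr i v \<in> V \<longleftrightarrow> (\<exists>w l. v = pr w l \<and> w \<in> W \<and> (l = 0 \<or> l = 1 \<or> l = 2))"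
    and E: "\<And>u v. pr i (pr u v) \<in> E \<longleftrightarrow> split_adjacent W A i u v"
  shows "\<exists>D. dhamilton W A i D"
proof -
  have fnF: "fn F" and FV: "\<And>n. pr i (F n) \<in> V" and step: "\<And>n. split_adjacent W A i (F n) (F (n + 1))"
    and cover: "\<And>v. pr i v \<in> V \<Longrightarrow> \<exists>!n. F n = v"
    using F E by (auto simp: hamilton_def)
  have inj: "F m = F n \<longleftrightarrow> m = n" for m n using cover[OF FV[of m]] by metis
  have sym: "split_adjacent W A i v u" if "split_adjacent W A i u v" for u v
    using that by (auto simp: split_adjacent_def)
  have step': "split_adjacent W A i (F (n + 1)) (F n)" for n
    by (rule sym[OF step])
  have adj0: "split_adjacent W A i (pr w 0) v \<Longrightarrow> v = pr w 1 \<or> (\<exists>u. v = pr u 2 \<and> pr i (pr u w) \<in> A)" for w v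
    by (auto simp: split_adjacent_def)
  have adj1: "split_adjacent W A i (pr w 1) v \<Longrightarrow> v = pr w 0 \<or> v = pr w 2" for w v
    by (auto simp: split_adjacent_def)
  have adj2: "split_adjacent W A i (pr w 2) v \<Longrightarrow> v = pr w 1 \<or> (\<exists>u. v = pr u 0 \<and> pr i (pr w u) \<in> A)" for w v
    by (auto simp: split_adjacent_def)
  \<comment> \<open>No arc enters \<open>s\<close>, so \<open>pr s 1\<close> is the only neighbour
    of \<open>pr s 0\<close>; at any later position two distinct neighbours would be needed.\<close>
  have F0: "F 0 = pr s 0"
  proof -
    obtain q where q: "F q = pr s 0" using cover[of "pr s 0"] V s(1) by blast
    have "q = 0"
    proof (rule ccontr)
      assume "q \<noteq> 0"
      then obtain p where p: "q = p + 1" using zero_or_succ by blast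
      have "F p = pr s 1" using adj0[of s "F p"] step'[of p] q p s(2) by auto
      moreover have "F (q + 1) = pr s 1" using adj0[of s "F (q + 1)"] step[of q] q s(2) by auto
      ultimately have "p = q + 1" using inj by metis
      with p show False by (simp add: add.assoc)
    qed
    with q show ?thesis by simp
  qed
  have blocks: "\<exists>w. F (3 * n) = pr w 0 \<and> F (3 * n + 1) = pr w 1 \<and> F (3 * n + 2) = pr w 2" for n
  proof (rule sig_induct[where P = "\<lambda>n. \<exists>w. F (3 * n) = pr w 0 \<and> F (3 * n + 1) = pr w 1 \<and> F (3 * n + 2) = pr w 2"])
    show "sig (\<lambda>e. \<exists>w. F (3 * e 0) = pr w 0 \<and> F (3 * e 0 + 1) = pr w 1 \<and> F (3 * e 0 + 2) = pr w 2)"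
      by (rule sig_ex_bd) (intro bd_pr_intros bd_fn_eq fnF)
    have F1: "F 1 = pr s 1" using adj0[of s "F 1"] step[of 0] F0 s(2) by auto
    have "F 2 = pr s 0 \<or> F 2 = pr s 2" using adj1[of s "F 2"] step[of 1] F1 by auto
    then have "F 2 = pr s 2" using inj[of 2 0] F0 by auto
    with F0 F1 show "\<exists>w. F (3 * 0) = pr w 0 \<and> F (3 * 0 + 1) = pr w 1 \<and> F (3 * 0 + 2) = pr w 2" by auto
    fix n
    assume "\<exists>w. F (3 * n) = pr w 0 \<and> F (3 * n + 1) = pr w 1 \<and> F (3 * n + 2) = pr w 2"
    then obtain w where w: "F (3 * n + 1) = pr w 1" "F (3 * n + 2) = pr w 2" by blast
    define p where "p = 3 * n + 2"
    have p: "3 * (n + 1) = p + 1" "3 * n + 1 \<noteq> p + 1"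
      unfolding p_def by (simp_all add: add.assoc distrib_left)
    obtain u where u: "F (p + 1) = pr u 0"
    proof -
      have "F (p + 1) = pr w 1 \<or> (\<exists>u. F (p + 1) = pr u 0)"
        using adj2[of w "F (p + 1)"] step[of p] w(2) by (auto simp: p_def)
      then show ?thesis using that inj[of "3 * n + 1" "p + 1"] w(1) p(2) by auto
    qed
    have "u \<in> W" using FV[of "p + 1"] u by (auto simp: V)
    have "F (p + 1 + 1) = pr u 1"
    proof -
      \<comment> \<open>The path neighbours of \<open>pr u 1\<close> are distinct and can only be
        \<open>pr u 0\<close> and \<open>pr u 2\<close>, so \<open>pr u 1\<close> stands next to
        \<open>pr u 0\<close>, which is at \<open>p + 1\<close>. Position \<open>p\<close> is taken
        by \<open>pr w 2\<close>, which leaves \<open>p + 2\<close>.\<close>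
      obtain q where q: "F q = pr u 1" using cover[of "pr u 1"] V \<open>u \<in> W\<close> by blast
      have "q \<noteq> 0" using q F0 by auto
      then obtain q' where q': "q = q' + 1" using zero_or_succ by blast
      have *: "F q' = pr u 0 \<or> F q' = pr u 2" "F (q + 1) = pr u 0 \<or> F (q + 1) = pr u 2"
        using adj1[of u] step'[of q'] step[of q] q q' by auto
      moreover have "F q' \<noteq> F (q + 1)" unfolding inj q' by (simp add: add.assoc)
      ultimately have "F q' = pr u 0 \<or> F (q + 1) = pr u 0" by metis
      then show ?thesis
      proof
        assume "F q' = pr u 0"
        then have "q' = p + 1" using u inj by metis
        with q q' show ?thesis by simp
      next
        assume "F (q + 1) = pr u 0"
        then have "q + 1 = p + 1" using u inj by metis
        with q w(2) show ?thesis by (simp add: p_def)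
      qed
    qed
    moreover from this have "F (p + 1 + 1 + 1) = pr u 0 \<or> F (p + 1 + 1 + 1) = pr u 2"
      using adj1[of u] step[of "p + 1 + 1"] by auto
    moreover have "p + 1 + 1 + 1 \<noteq> p + 1" by (simp add: add.assoc)
    ultimately have "F (p + 1 + 1 + 1) = pr u 2" using u inj by metis
    moreover have "p + 1 + 1 + 1 = p + 1 + 2" by (simp add: add.assoc)
    ultimately show "\<exists>w. F (3 * (n + 1)) = pr w 0 \<and> F (3 * (n + 1) + 1) = pr w 1 \<and> F (3 * (n + 1) + 2) = pr w 2"
      unfolding p(1) using u \<open>F (p + 1 + 1) = pr u 1\<close> by auto
  qed
  then obtain D where D: "\<And>n. F (3 * n) = pr (D n) 0" "\<And>n. F (3 * n + 1) = pr (D n) 1"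
    "\<And>n. F (3 * n + 2) = pr (D n) 2" by metis
  have "D n = w \<longleftrightarrow> F (3 * n) = pr w 0" for n w by (simp add: D(1))
  then have "fn D"
    by (rule fnI) (intro bd_pr_intros bd_fn_eq fnF)
  moreover have "D n \<in> W" for n using FV[of "3 * n"] by (auto simp: D V)
  moreover have "pr i (pr (D n) (D (n + 1))) \<in> A" for n
  proof -
    have "3 * n + 2 + 1 = 3 * (n + 1)" by (simp add: add.assoc distrib_left)
    then show ?thesis
      using step[of "3 * n + 2"] adj2[of "D n" "F (3 * n + 2 + 1)"] by (simp only: D) auto
  qed
  moreover have "\<exists>!n. D n = w" if "w \<in> W" for w
  proof -
    obtain x where x: "F x = pr w 0" using cover[of "pr w 0"] V \<open>w \<in> W\<close> by blast
    then obtain n where n: "x = 3 * n" by (cases x rule: mod3_cases) (auto simp: D)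
    have "m = n" if "D m = w" for m
    proof -
      have "F (3 * m) = F (3 * n)" using that x n by (simp add: D(1))
      then show ?thesis using division_unique[of 0 3 0 m n] by (simp add: inj)
    qed
    moreover have "D n = w" using x n by (simp add: D(1))
    ultimately show ?thesis by blast
  qed
  ultimately show ?thesis unfolding dhamilton_def by blast
qed

lemma dhamilton_comprehension:
  fixes A :: "'a::rca0_model set"
  assumes ham: "hamilton_comprehension TYPE('a)"
    and A: "A \<in> Sets" and W: "W \<in> Sets" and s: "s \<in> W" "\<And>i u. pr i (pr u s) \<notin> A"
  shows "{i. \<exists>D. dhamilton W A i D} \<in> Sets"
proof -
  define V where "V = {z. \<exists>i v. z = pr i v \<and> (\<exists>w l. v = pr w l \<and> w \<in> W \<and> (l = 0 \<or> l = 1 \<or> l = 2))}"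
  define E where "E = {z. \<exists>i p. z = pr i p \<and> (\<exists>u v. p = pr u v \<and> split_adjacent W A i u v)}"
  have V: "pr i v \<in> V \<longleftrightarrow> (\<exists>w l. v = pr w l \<and> w \<in> W \<and> (l = 0 \<or> l = 1 \<or> l = 2))" for i v
    by (simp add: V_def)
  have E: "pr i (pr u v) \<in> E \<longleftrightarrow> split_adjacent W A i u v" for i u v
    by (simp add: E_def)
  have "V \<in> Sets" unfolding V_def using W by (intro Sets_pr bd_pr_intros)
  moreover have "E \<in> Sets"
    unfolding E_def split_adjacent_def using W A by (intro Sets_pr bd_pr_intros)
  moreover have "graph_seq V E"
    unfolding graph_seq_def V E by (auto simp: split_adjacent_def)
  ultimately have "{i. \<exists>F. hamilton V E i F} \<in> Sets"
    using ham unfolding hamilton_comprehension_def by blast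
  moreover have "(\<exists>F. hamilton V E i F) \<longleftrightarrow> (\<exists>D. dhamilton W A i D)" for i
    using hamilton_imp_dhamilton[OF s _ V E] dhamilton_imp_hamilton[OF _ V E] by blast
  ultimately show ?thesis by simp
qed


section \<open>Infinite satisfiability\<close>

definition is_lit :: "'a::rca0_model \<Rightarrow> bool" where
  "is_lit r \<longleftrightarrow> (\<exists>x s. r = pr x s \<and> (s = 0 \<or> s = 1))"

text \<open>The literal \<open>pr x 0\<close> is the variable \<open>x\<close>, and \<open>pr x 1\<close> is its negation.\<close>

definition true_lit :: "'a::rca0_model set \<Rightarrow> 'a \<Rightarrow> bool" where
  "true_lit L r \<longleftrightarrow> (\<exists>x s. r = pr x s \<and> (s = 0 \<and> x \<in> L \<or> s = 1 \<and> x \<notin> L))"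

definition false_lit :: "'a::rca0_model set \<Rightarrow> 'a \<Rightarrow> bool" where
  "false_lit L r \<longleftrightarrow> (\<exists>x s. r = pr x s \<and> (s = 0 \<and> x \<notin> L \<or> s = 1 \<and> x \<in> L))"

text \<open>\<open>pr i (pr c r) \<in> C\<close> says that the literal \<open>r\<close> belongs to the \<open>c\<close>-th clause of the \<open>i\<close>-th instance.\<close>

definition satisfies :: "'a::rca0_model set \<Rightarrow> 'a \<Rightarrow> 'a set \<Rightarrow> bool" where
  "satisfies C i L \<longleftrightarrow> (\<forall>c. \<exists>r. pr i (pr c r) \<in> C \<and> true_lit L r)"

text \<open>
  The slot \<open>pr r c\<close> is the \<open>c\<close>-th copy of the literal \<open>r\<close>; it is used to satisfy the clause \<open>c\<close>.
\<close>

definition occurs :: "'a::rca0_model set \<Rightarrow> 'a \<Rightarrow> 'a \<Rightarrow> 'a \<Rightarrow> bool" where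
  "occurs C i c o' \<longleftrightarrow> (\<exists>r c'. o' = pr r c' \<and> (c' = c \<and> pr i (pr c r) \<in> C \<and> is_lit r))"

definition next_copy :: "'a::rca0_model \<Rightarrow> 'a \<Rightarrow> bool" where
  "next_copy n n' \<longleftrightarrow> (\<exists>r k'. n' = pr r k' \<and> (\<exists>k. k' = k + 1 \<and> n = pr r k))"

definition first_copy :: "'a::rca0_model \<Rightarrow> 'a \<Rightarrow> bool" where
  "first_copy n x \<longleftrightarrow> (\<exists>r k. n = pr r k \<and> (k = 0 \<and> (\<exists>y s. r = pr y s \<and> (y = x \<and> (s = 0 \<or> s = 1)))))"

text \<open>
  Stage \<open>n\<close> of a Hamilton path runs from \<open>pr 0 n\<close> to \<open>pr 0 (n + 1)\<close>. Between \<open>pr 0 n\<close> and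
  \<open>pr 2 n\<close> it visits \<open>pr 1 o\<close> for a slot \<open>o\<close> of a literal of the clause \<open>n\<close>. It then passes one of the
  two tokens next to slot \<open>n\<close>: its own token \<open>pr 3 n - pr 4 n - pr 5 n\<close> in this direction (slot \<open>n\<close>
  is then outer, which makes its literal true), or the token of the preceding copy of the same
  literal in the opposite direction. The token \<open>pr 7 x - pr 8 x - pr 9 x\<close> is shared by the first
  copies of the literals \<open>x\<close> and \<open>\<not> x\<close>. Finally it visits \<open>pr 1 n\<close> or, if \<open>n\<close> is an outer slot
  chosen for the clause \<open>c\<close>, the vertex \<open>pr 6 c\<close> of that clause. Every token is passed exactly once,
  so either all copies of a literal are outer or none is.
\<close>

definition arc :: "'a::rca0_model set \<Rightarrow> 'a \<Rightarrow> 'a \<Rightarrow> 'a \<Rightarrow> bool" where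
  "arc C i u v \<longleftrightarrow> (\<exists>t x. u = pr t x \<and> (\<exists>t' y. v = pr t' y \<and>
    (t = 0 \<and> t' = 1 \<and> occurs C i x y \<or>
     t = 1 \<and> t' = 2 \<and> occurs C i y x \<or>
     t = 1 \<and> t' = 0 \<and> y = x + 1 \<or>
     t = 2 \<and> t' = 3 \<and> y = x \<or>
     t = 3 \<and> t' = 4 \<and> y = x \<or>
     t = 4 \<and> t' = 5 \<and> y = x \<or>
     t = 5 \<and> t' = 4 \<and> y = x \<or>
     t = 4 \<and> t' = 3 \<and> y = x \<or>
     t = 5 \<and> t' = 1 \<and> y = x \<or>
     t = 5 \<and> t' = 6 \<and> occurs C i y x \<or>
     t = 6 \<and> t' = 0 \<and> (\<exists>o'. y = o' + 1 \<and> occurs C i x o') \<or>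
     t = 2 \<and> t' = 5 \<and> next_copy y x \<or>
     t = 3 \<and> t' = 1 \<and> next_copy x y \<or>
     t = 2 \<and> t' = 7 \<and> first_copy x y \<or>
     t = 7 \<and> t' = 8 \<and> y = x \<or>
     t = 8 \<and> t' = 9 \<and> y = x \<or>
     t = 9 \<and> t' = 1 \<and> first_copy y x)))"

definition vertices :: "'a::rca0_model set" where
  "vertices = {w. \<exists>t x. w = pr t x \<and>
    (t = 0 \<or> t = 1 \<or> t = 2 \<or> t = 3 \<or> t = 4 \<or> t = 5 \<or> t = 6 \<or> t = 7 \<or> t = 8 \<or> t = 9)}"

lemma bd_occurs:
  "C \<in> Sets \<Longrightarrow> tm f \<Longrightarrow> tm g \<Longrightarrow> tm h \<Longrightarrow> bd (\<lambda>e. occurs C (f e) (g e) (h e))"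
  unfolding occurs_def is_lit_def
  by (intro bd_pr_intros tm_reindex[of f "\<lambda>i. Suc (Suc i)"] tm_reindex[of g "\<lambda>i. Suc (Suc i)"])

lemma bd_next_copy: "tm f \<Longrightarrow> tm g \<Longrightarrow> bd (\<lambda>e. next_copy (f e) (g e))"
  unfolding next_copy_def
  by (intro bd_pr_intros tm_reindex[of f "\<lambda>i. Suc (Suc (Suc i))"])

lemma bd_first_copy: "tm f \<Longrightarrow> tm g \<Longrightarrow> bd (\<lambda>e. first_copy (f e) (g e))"
  unfolding first_copy_def
  by (intro bd_pr_intros tm_reindex[of g "\<lambda>i. Suc (Suc (Suc (Suc i)))"])

lemma bd_true_lit: "L \<in> Sets \<Longrightarrow> tm f \<Longrightarrow> bd (\<lambda>e. true_lit L (f e))"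
  unfolding true_lit_def by (intro bd_pr_intros)

lemma bd_false_lit: "L \<in> Sets \<Longrightarrow> tm f \<Longrightarrow> bd (\<lambda>e. false_lit L (f e))"
  unfolding false_lit_def by (intro bd_pr_intros)

lemma vertices_in_Sets: "(vertices :: 'a::rca0_model set) \<in> Sets"
  unfolding vertices_def by (intro Sets_bd bd_pr_intros)

section \<open>Reading an assignment off a Hamilton path\<close>

lemma arc_pred:
  "arc C i u (pr 0 0) \<Longrightarrow> False"
  "arc C i u (pr 3 x) \<Longrightarrow> u = pr 2 x \<or> u = pr 4 x"
  "arc C i u (pr 4 x) \<Longrightarrow> u = pr 3 x \<or> u = pr 5 x"
  "arc C i u (pr 5 x) \<Longrightarrow> u = pr 4 x \<or> (\<exists>n. u = pr 2 n \<and> next_copy x n)"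
  "arc C i u (pr 6 c) \<Longrightarrow> \<exists>n. u = pr 5 n \<and> occurs C i c n"
  "arc C i u (pr 7 x) \<Longrightarrow> \<exists>n. u = pr 2 n \<and> first_copy n x"
  unfolding arc_def by (auto simp: basic_axioms_semantic(1) basic_axioms_semantic(1)[symmetric])

lemma next_copy_unique: "next_copy n m \<Longrightarrow> next_copy n m' \<Longrightarrow> m = m'"
  unfolding next_copy_def by auto

text \<open>The assignment is read off the direction in which tokens are passed. Since the path is a
  total function, both \<open>outer\<close> and its negation are \<Sigma>; hence \<open>L\<close>
  exists by recursive comprehension, and induction along the copies of a literal is
  available.\<close>

lemma dhamilton_imp_satisfiable:
  assumes A: "\<And>u v. pr i (pr u v) \<in> A \<longleftrightarrow> arc C i u v" and D: "dhamilton vertices A i D"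
  shows "\<exists>L\<in>Sets. satisfies C i L"
proof -
  have fnD: "fn D" and Dv: "\<And>n. D n \<in> vertices" and Darc: "\<And>n. arc C i (D n) (D (n + 1))"
    and cover: "\<And>w. w \<in> vertices \<Longrightarrow> \<exists>!n. D n = w"
    using D A by (auto simp: dhamilton_def)
  have inj: "D m = D n \<Longrightarrow> m = n" for m n using cover[OF Dv[of m]] by metis
  define step where "step u v \<longleftrightarrow> (\<exists>n. D n = u \<and> D (n + 1) = v)" for u v
  have step_arc: "arc C i u v" if "step u v" for u v using that Darc by (auto simp: step_def)
  have step_right: "v = v'" if "step u v" "step u v'" for u v v'
    using that inj by (metis step_def)
  have step_left: "u = u'" if "step u v" "step u' v" for u u' v
    using that inj basic_axioms_semantic(2) by (metis step_def)
  have step_succ: "\<exists>v. step u v" if "u \<in> vertices" for u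
    using cover[OF that] by (auto simp: step_def)
  have step_pred: "\<exists>u. step u v" if v: "v \<in> vertices" "v \<noteq> pr 0 0" for v
  proof -
    obtain n where n: "D n = v" using cover[OF v(1)] by auto
    obtain m where m: "D m = pr 0 0" using cover[of "pr 0 0"] by (auto simp: vertices_def)
    have "m = 0"
    proof (rule ccontr)
      assume "m \<noteq> 0"
      then obtain k where "m = k + 1" using zero_or_succ by blast
      then show False using Darc[of k] m arc_pred(1) by simp
    qed
    with m n v(2) have "n \<noteq> 0" by auto
    then obtain k where "n = k + 1" using zero_or_succ by blast
    with n show ?thesis by (auto simp: step_def)
  qed
  have no_2_cycle: "\<not> step v u" if "step u v" for u v
  proof
    assume "step v u"
    with that obtain m n where "D m = u" "D (m + 1) = v" "D n = v" "D (n + 1) = u"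
      by (auto simp: step_def)
    then have "m + 1 = n" "n + 1 = m" using inj by metis+
    then have "m + (1 + 1) = m" by (simp only: add.assoc[symmetric])
    then show False by simp
  qed
  have v: "pr 3 n \<in> vertices" "pr 4 n \<in> vertices" "pr 5 n \<in> vertices" "pr 6 n \<in> vertices" "pr 7 n \<in> vertices"
    "pr 2 n \<in> vertices" for n :: 'a
    by (auto simp: vertices_def)
  define outer where "outer n \<longleftrightarrow> step (pr 2 n) (pr 3 n)" for n
  have not_outer_iff: "\<not> outer n \<longleftrightarrow> (\<exists>m. D m = pr 2 n \<and> D (m + 1) \<noteq> pr 3 n)" for n
  proof
    assume "\<not> outer n"
    then show "\<exists>m. D m = pr 2 n \<and> D (m + 1) \<noteq> pr 3 n"
      using step_succ[OF v(6)[of n]] unfolding outer_def step_def by blast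
  next
    assume "\<exists>m. D m = pr 2 n \<and> D (m + 1) \<noteq> pr 3 n"
    then obtain m where "D m = pr 2 n" "D (m + 1) \<noteq> pr 3 n" by blast
    then show "\<not> outer n" using inj unfolding outer_def step_def by metis
  qed
  have sig_outer: "sig (\<lambda>e. outer (f e))" "sig (\<lambda>e. \<not> outer (f e))" if "tm f" for f
    unfolding not_outer_iff unfolding outer_def step_def
    by (intro sig_ex_bd bd_and bd_not bd_fn_eq[OF fnD] tm_plus tm_pr tm_var tm_const
        tm_reindex[OF that, of Suc])+
  \<comment> \<open>If the path leaves \<open>pr 5 n\<close> for a clause vertex, it does not go on
    to \<open>pr 4 n\<close>. So \<open>pr 4 n\<close> is entered from \<open>pr 3 n\<close>, and
    \<open>pr 3 n\<close>, which cannot be entered from \<open>pr 4 n\<close> as well, from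
    \<open>pr 2 n\<close>.\<close>
  have clause_outer: "outer n" if "step (pr 5 n) (pr 6 c)" for n c
  proof -
    obtain w where w: "step (pr 4 n) w" using step_succ v by blast
    obtain u where u: "step u (pr 4 n)" using step_pred[OF v(2)] by auto
    have "u \<noteq> pr 5 n" using step_right[OF that, of "pr 4 n"] u by auto
    then have u3: "u = pr 3 n" using arc_pred(3)[OF step_arc[OF u]] by blast
    obtain x where x: "step x (pr 3 n)" using step_pred[OF v(1)] by auto
    have "x \<noteq> pr 4 n" using no_2_cycle u u3 x by blast
    then show ?thesis using arc_pred(2)[OF step_arc[OF x]] x unfolding outer_def by blast
  qed
  \<comment> \<open>A token not entered from its own stage is passed backwards from
    \<open>pr 5 n\<close>, and only the stage of the next copy has an arc to that end. The vertex
    \<open>pr 2 n'\<close> is then left towards \<open>pr 5 n\<close> instead of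
    \<open>pr 3 n'\<close>.\<close>
  have inner_next: "\<not> outer n'" if "\<not> outer n" "next_copy n n'" for n n'
  proof -
    obtain x where x: "step x (pr 3 n)" using step_pred[OF v(1)] by auto
    then have x4: "step (pr 4 n) (pr 3 n)"
      using arc_pred(2)[OF step_arc[OF x]] that(1) unfolding outer_def by blast
    obtain y where y: "step y (pr 5 n)" using step_pred[OF v(3)] by auto
    have "y \<noteq> pr 4 n" using step_right[OF x4, of "pr 5 n"] y by auto
    then obtain m where m: "y = pr 2 m" "next_copy n m"
      using arc_pred(4)[OF step_arc[OF y]] by blast
    then have "step (pr 2 n') (pr 5 n)" using y next_copy_unique that(2) by blast
    then show ?thesis using step_right unfolding outer_def by fastforce
  qed
  have inner_all: "\<not> outer (pr r k)" if "\<not> outer (pr r 0)" for r k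
  proof (rule sig_induct[where P = "\<lambda>k. \<not> outer (pr r k)"])
    show "sig (\<lambda>e. \<not> outer (pr r (e 0)))" by (intro sig_outer tm_pr tm_const tm_var)
    show "\<not> outer (pr r (k + 1))" if "\<not> outer (pr r k)" for k
      using inner_next[OF that] by (auto simp: next_copy_def)
  qed (rule that)
  \<comment> \<open>The vertex \<open>pr 7 x\<close> is entered only from a first copy of
    \<open>x\<close> or of its negation, and that slot is then inner. So the two first copies are
    never both outer, which makes the assignment consistent.\<close>
  have inner_exists: "\<exists>s. (s = 0 \<or> s = 1) \<and> \<not> outer (pr (pr x s) 0)" for x
  proof -
    obtain u where u: "step u (pr 7 x)" using step_pred[OF v(5)] by auto
    then obtain n where n: "u = pr 2 n" "first_copy n x" using arc_pred(6)[OF step_arc[OF u]] by blast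
    have "\<not> outer n"
      using step_right[of "pr 2 n" "pr 7 x" "pr 3 n"] u n(1) unfolding outer_def by auto
    with n(2) show ?thesis unfolding first_copy_def by auto
  qed
  define L where "L = {x. outer (pr (pr x 0) 0)}"
  have "L \<in> Sets"
    unfolding L_def by (intro Sets_sig sig_outer tm_pr tm_var tm_const)
  moreover have "satisfies C i L"
    unfolding satisfies_def
  proof
    fix c
    obtain u where u: "step u (pr 6 c)" using step_pred[OF v(4)] by auto
    then obtain n where n: "u = pr 5 n" "occurs C i c n" using arc_pred(5)[OF step_arc[OF u]] by blast
    then obtain r where r: "n = pr r c" "pr i (pr c r) \<in> C" "is_lit r" by (auto simp: occurs_def)
    have "outer (pr r c)" using clause_outer u n(1) r(1) by blast
    then have outer: "outer (pr r 0)" using inner_all by blast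
    obtain x s where x: "r = pr x s" "s = 0 \<or> s = 1" using r(3) by (auto simp: is_lit_def)
    have "true_lit L r"
      using x(2)
    proof
      assume "s = 1"
      then have "x \<notin> L" using inner_exists[of x] outer x(1) by (auto simp: L_def)
      with \<open>s = 1\<close> x(1) show ?thesis by (auto simp: true_lit_def)
    qed (use outer x(1) in \<open>auto simp: true_lit_def L_def\<close>)
    with r(2) show "\<exists>r. pr i (pr c r) \<in> C \<and> true_lit L r" by blast
  qed
  ultimately show ?thesis by blast
qed

section \<open>Building a Hamilton path from an assignment\<close>

lemma least_exists:
  fixes P :: "'a::rca0_model \<Rightarrow> bool"
  assumes "bd (\<lambda>e. P (e 0))" "P x"
  shows "\<exists>m. P m \<and> (\<forall>y. y < m \<longrightarrow> \<not> P y)"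
proof (rule ccontr)
  assume no: "\<not> ?thesis"
  have "\<forall>y. y < z \<longrightarrow> \<not> P y" for z
  proof (rule bd_induct[where P = "\<lambda>z. \<forall>y. y < z \<longrightarrow> \<not> P y"])
    show "\<forall>y. y < z + 1 \<longrightarrow> \<not> P y" if "\<forall>y. y < z \<longrightarrow> \<not> P y" for z
      using no that unfolding basic_axioms_semantic(8) by blast
    show "bd (\<lambda>e. \<forall>y. y < e 0 \<longrightarrow> \<not> P y)"
      using assms(1) by (intro bd_intros)
  qed (simp add: basic_axioms_semantic(7))
  then show False using assms(2) basic_axioms_semantic(8)[of x x] by blast
qed

text \<open>Taking the least witness keeps the graph of the choice function
  bounded-definable.\<close>

lemma bd_choice:
  fixes P :: "'a::rca0_model \<Rightarrow> 'a \<Rightarrow> bool"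
  assumes bd: "bd (\<lambda>e. P (e 0) (e 1))" and ex: "\<And>c. \<exists>r. P c r"
  shows "\<exists>f. fn f \<and> (\<forall>c. P c (f c))"
proof -
  define Q where "Q c r \<longleftrightarrow> P c r \<and> (\<forall>y. y < r \<longrightarrow> \<not> P c y)" for c r
  let ?h = "\<lambda>c. case_nat c (\<lambda>_. c)"
  \<comment> \<open>Renaming variables cannot insert the constant \<open>c\<close>, so the predicate
    is first turned into a set of pairs.\<close>
  have bd1: "bd (\<lambda>e. P c (e 0))" for c
  proof -
    have "{z. \<exists>x y. z = pr x y \<and> P x y} \<in> Sets"
      using bd_reindex[OF bd, of "\<lambda>i. 1 - i"] by (intro Sets_pr) simp
    then have "bd (\<lambda>e. pr c (e 0) \<in> {z. \<exists>x y. z = pr x y \<and> P x y})"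
      by (intro bd_pr_intros)
    then show ?thesis by simp
  qed
  have "\<exists>!r. Q c r" for c
  proof -
    obtain m where m: "Q c m"
      using ex[of c] least_exists[OF bd1[of c]] unfolding Q_def by blast
    have "r = m" if "Q c r" for r
      using that m less_total_M[of r m] unfolding Q_def by blast
    with m show ?thesis by blast
  qed
  then have "\<exists>f. \<forall>c r. f c = r \<longleftrightarrow> Q c r" by metis
  then obtain f where f: "\<And>c r. f c = r \<longleftrightarrow> Q c r" by blast
  have "bd (\<lambda>e. Q (e 1) (e 0))"
    unfolding Q_def
    using bd_reindex[OF bd, of "\<lambda>i. 1 - i"] bd_reindex[OF bd, of "\<lambda>i. if i = 0 then 2 else 0"]
    by (intro bd_intros) (simp_all add: numeral_2_eq_2)
  with f have "fn f" by (rule fnI)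
  moreover have "P c (f c)" for c using f[of c "f c"] by (simp add: Q_def)
  ultimately show ?thesis by blast
qed

text \<open>All other numbers count as outer, including those that are not slots of a literal at
  all; their stages pass their own token.\<close>

definition inner_slot :: "'a::rca0_model set \<Rightarrow> 'a \<Rightarrow> bool" where
  "inner_slot L n \<longleftrightarrow> (\<exists>r k. n = pr r k \<and> false_lit L r)"

definition chosen_slot :: "('a::rca0_model \<Rightarrow> 'a) \<Rightarrow> 'a \<Rightarrow> bool" where
  "chosen_slot f n \<longleftrightarrow> (\<exists>r c. n = pr r c \<and> f c = r)"

text \<open>The value \<open>f n\<close> has no bounding term. Therefore \<open>w\<close> is taken
  apart and its component compared with \<open>f n\<close>, which keeps the relation bounded
  although the vertex at position 1 depends on \<open>f\<close>.\<close>

definition stage :: "'a::rca0_model set \<Rightarrow> ('a \<Rightarrow> 'a) \<Rightarrow> 'a \<Rightarrow> 'a \<Rightarrow> 'a \<Rightarrow> bool" where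
  "stage L f n j w \<longleftrightarrow>
    j = 0 \<and> w = pr 0 n \<or>
    j = 1 \<and> (\<exists>t o'. w = pr t o' \<and> (t = 1 \<and> (\<exists>r c. o' = pr r c \<and> (c = n \<and> f n = r)))) \<or>
    j = 2 \<and> w = pr 2 n \<or>
    \<not> inner_slot L n \<and> (j = 3 \<and> w = pr 3 n \<or> j = 4 \<and> w = pr 4 n \<or> j = 5 \<and> w = pr 5 n) \<or>
    (\<exists>r k. n = pr r k \<and> (false_lit L r \<and>
      (k = 0 \<and> (\<exists>x s. r = pr x s \<and> (j = 3 \<and> w = pr 7 x \<or> j = 4 \<and> w = pr 8 x \<or> j = 5 \<and> w = pr 9 x)) \<or>
      (\<exists>m. k = m + 1 \<and> (j = 3 \<and> w = pr 5 (pr r m) \<or> j = 4 \<and> w = pr 4 (pr r m) \<or> j = 5 \<and> w = pr 3 (pr r m)))))) \<or>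
    j = 6 \<and> ((\<exists>r c. n = pr r c \<and> (f c = r \<and> w = pr 6 c)) \<or> \<not> chosen_slot f n \<and> w = pr 1 n)"

lemma succ_neq_0 [simp]: "k + 1 \<noteq> (0::'a::rca0_model)" "(0::'a::rca0_model) \<noteq> k + 1"
  using basic_axioms_semantic(1)[of k] by auto

lemma slot_cases:
  obtains (outer) "\<not> inner_slot L n"
  | (first) x s where "n = pr (pr x s) 0" "false_lit L (pr x s)" "s = 0 \<or> s = 1"
  | (later) r m where "n = pr r (m + 1)" "false_lit L r"
proof (cases "inner_slot L n")
  case True
  then obtain r k where "n = pr r k" "false_lit L r" by (auto simp: inner_slot_def)
  moreover from this(2) obtain x s where "r = pr x s" "s = 0 \<or> s = 1" by (auto simp: false_lit_def)
  ultimately show ?thesis using that zero_or_succ[of k] by blast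
qed (rule that)

lemma stage_012:
  "stage L f n 0 w \<longleftrightarrow> w = pr 0 n"
  "stage L f n 1 w \<longleftrightarrow> w = pr 1 (pr (f n) n)"
  "stage L f n 2 w \<longleftrightarrow> w = pr 2 n"
  unfolding stage_def by simp_all

lemma not_inner_slot:
  "\<not> inner_slot L n \<Longrightarrow> (\<exists>r k. n = pr r k \<and> (false_lit L r \<and> Q r k)) \<longleftrightarrow> False"
  unfolding inner_slot_def by blast

lemma stage_outer:
  assumes "\<not> inner_slot L n"
  shows "stage L f n 3 w \<longleftrightarrow> w = pr 3 n" "stage L f n 4 w \<longleftrightarrow> w = pr 4 n" "stage L f n 5 w \<longleftrightarrow> w = pr 5 n"
  using assms by (simp_all add: stage_def not_inner_slot)

lemma stage_first:
  assumes "false_lit L (pr x s)"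
  shows "stage L f (pr (pr x s) 0) 3 w \<longleftrightarrow> w = pr 7 x"
    "stage L f (pr (pr x s) 0) 4 w \<longleftrightarrow> w = pr 8 x"
    "stage L f (pr (pr x s) 0) 5 w \<longleftrightarrow> w = pr 9 x"
  using assms by (simp_all add: stage_def inner_slot_def)

lemma stage_later:
  assumes "false_lit L r"
  shows "stage L f (pr r (m + 1)) 3 w \<longleftrightarrow> w = pr 5 (pr r m)"
    "stage L f (pr r (m + 1)) 4 w \<longleftrightarrow> w = pr 4 (pr r m)"
    "stage L f (pr r (m + 1)) 5 w \<longleftrightarrow> w = pr 3 (pr r m)"
  using assms by (simp_all add: stage_def inner_slot_def)

lemma stage_6:
  "stage L f (pr (f c) c) 6 w \<longleftrightarrow> w = pr 6 c"
  "\<not> chosen_slot f n \<Longrightarrow> stage L f n 6 w \<longleftrightarrow> w = pr 1 n"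
proof -
  have "chosen_slot f (pr (f c) c)" unfolding chosen_slot_def by blast
  then show "stage L f (pr (f c) c) 6 w \<longleftrightarrow> w = pr 6 c" unfolding stage_def by simp
  assume n: "\<not> chosen_slot f n"
  then have *: "(\<exists>r c. n = pr r c \<and> (f c = r \<and> w = pr 6 c)) \<longleftrightarrow> False"
    unfolding chosen_slot_def by blast
  show "stage L f n 6 w \<longleftrightarrow> w = pr 1 n" using n unfolding stage_def * by simp
qed

lemma stage_unique:
  assumes "j < 7"
  shows "\<exists>!w. stage L f n j w"
proof -
  have 6: "\<exists>!w. stage L f n 6 w"
  proof (cases "chosen_slot f n")
    case True
    then obtain c where "n = pr (f c) c" unfolding chosen_slot_def by blast
    then show ?thesis by (simp add: stage_6(1))
  qed (simp add: stage_6(2))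
  have 345: "(\<exists>!w. stage L f n 3 w) \<and> (\<exists>!w. stage L f n 4 w) \<and> (\<exists>!w. stage L f n 5 w)"
  proof (cases L n rule: slot_cases)
    case outer
    then show ?thesis by (simp add: stage_outer)
  next
    case (first x s)
    then show ?thesis by (simp add: stage_first)
  next
    case (later r m)
    then show ?thesis by (simp add: stage_later)
  qed
  have "j = 0 \<or> j = 1 \<or> j = 2 \<or> j = 3 \<or> j = 4 \<or> j = 5 \<or> j = 6"
    using assms by (simp only: less_7_cases)
  then show ?thesis using 6 345 by (elim disjE) (simp_all only: stage_012 HOL.ex1_eq)
qed

text \<open>The vertex \<open>pr 1 x\<close> is used at position 1 of stage \<open>c\<close> if
  \<open>x\<close> is the slot chosen for \<open>c\<close>, and otherwise at position 6 of its own
  stage. The token of an inner slot is used backwards by the stage of the next copy, and the shared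
  token of \<open>x\<close> by the first copy of whichever literal of \<open>x\<close> is
  false.\<close>

lemma stage_cover:
  fixes w :: "'a::rca0_model"
  assumes w: "w \<in> vertices"
  shows "\<exists>n j. j < 7 \<and> stage L f n j w \<and> (\<forall>n' j'. stage L f n' j' w \<longrightarrow> n' = n \<and> j' = j)"
proof -
  obtain t x where tx: "w = pr t x" "t = 0 \<or> t = 1 \<or> t = 2 \<or> t = 3 \<or> t = 4 \<or> t = 5 \<or> t = 6 \<or> t = 7 \<or> t = 8 \<or> t = 9"
    using w unfolding vertices_def by blast
  have less: "(0::'a) < 7" "(1::'a) < 7" "(2::'a) < 7" "(6::'a) < 7" by simp_all
  have u0: "n' = x \<and> j' = 0" if "stage L f n' j' (pr 0 x)" for n' j'
    using that unfolding stage_def by simp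
  have u2: "n' = x \<and> j' = 2" if "stage L f n' j' (pr 2 x)" for n' j'
    using that unfolding stage_def by simp
  have u6: "n' = pr (f x) x \<and> j' = 6" if "stage L f n' j' (pr 6 x)" for n' j'
    using that unfolding stage_def by auto
  have u1: "(\<exists>c. x = pr (f c) c \<and> n' = c \<and> j' = 1) \<or> \<not> chosen_slot f x \<and> n' = x \<and> j' = 6"
    if "stage L f n' j' (pr 1 x)" for n' j'
    using that unfolding stage_def by auto
  have u345: "\<not> inner_slot L x \<and> n' = x \<and> j' = t \<or>
      (\<exists>r m. x = pr r m \<and> n' = pr r (m + 1) \<and> false_lit L r \<and> (t = 3 \<and> j' = 5 \<or> t = 4 \<and> j' = 4 \<or> t = 5 \<and> j' = 3))"
    if "t = 3 \<or> t = 4 \<or> t = 5" "stage L f n' j' (pr t x)" for n' j' t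
    using that unfolding stage_def by (elim disjE) auto
  have u789: "\<exists>s. n' = pr (pr x s) 0 \<and> false_lit L (pr x s) \<and> (t = 7 \<and> j' = 3 \<or> t = 8 \<and> j' = 4 \<or> t = 9 \<and> j' = 5)"
    if "t = 7 \<or> t = 8 \<or> t = 9" "stage L f n' j' (pr t x)" for n' j' t
    using that unfolding stage_def by (elim disjE) auto
  \<comment> \<open>The sign of the false literal of \<open>x\<close>; its first copy takes the
    shared token.\<close>
  define s where "s = (if x \<in> L then 1 else 0 :: 'a)"
  have s_iff: "false_lit L (pr x s') \<longleftrightarrow> s' = s" for s'
    by (auto simp: false_lit_def s_def)
  then have s: "false_lit L (pr x s)" by simp
  consider "t = 0 \<or> t = 2 \<or> t = 6" | "t = 1" | "t = 3 \<or> t = 4 \<or> t = 5" | "t = 7 \<or> t = 8 \<or> t = 9"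
    using tx(2) by blast
  then show ?thesis
  proof cases
    case 1
    then show ?thesis
    proof (elim disjE)
      assume t: "t = 0"
      have "stage L f x 0 w" unfolding tx(1) t stage_012 ..
      then show ?thesis using u0 less(1) unfolding tx(1) t by blast
    next
      assume t: "t = 2"
      have "stage L f x 2 w" unfolding tx(1) t stage_012 ..
      then show ?thesis using u2 less(3) unfolding tx(1) t by blast
    next
      assume t: "t = 6"
      have "stage L f (pr (f x) x) 6 w" unfolding tx(1) t stage_6 ..
      then show ?thesis using u6 less(4) unfolding tx(1) t by blast
    qed
  next
    case 2
    show ?thesis
    proof (cases "chosen_slot f x")
      case True
      then obtain c where c: "x = pr (f c) c" unfolding chosen_slot_def by blast
      have "n' = c \<and> j' = 1" if "stage L f n' j' w" for n' j'
        using u1[of n' j'] that True unfolding tx(1) 2 c by auto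
      moreover have "stage L f c 1 w" unfolding tx(1) 2 c stage_012 ..
      ultimately show ?thesis using less(2) by blast
    next
      case False
      have "n' = x \<and> j' = 6" if "stage L f n' j' w" for n' j'
        using u1[of n' j'] that False unfolding tx(1) 2 chosen_slot_def by blast
      moreover have "stage L f x 6 w" unfolding tx(1) 2 stage_6(2)[OF False] ..
      ultimately show ?thesis using less(4) by blast
    qed
  next
    case 3
    show ?thesis
    proof (cases "inner_slot L x")
      case True
      then obtain r m where r: "x = pr r m" "false_lit L r" unfolding inner_slot_def by blast
      define j where "j = (if t = 3 then 5 else if t = 4 then 4 else 3 :: 'a)"
      have "n' = pr r (m + 1) \<and> j' = j" if "stage L f n' j' w" for n' j'
        using u345[OF 3, of n' j'] that True r(1) unfolding tx(1) j_def by auto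
      moreover have "stage L f (pr r (m + 1)) j w"
        using 3 unfolding tx(1) r(1) j_def by (auto simp: stage_later[OF r(2)])
      moreover have "j < 7" unfolding j_def by simp
      ultimately show ?thesis by blast
    next
      case False
      have "n' = x \<and> j' = t" if "stage L f n' j' w" for n' j'
        using u345[OF 3, of n' j'] that False unfolding tx(1) inner_slot_def by blast
      moreover have "stage L f x t w"
        using 3 unfolding tx(1) by (auto simp: stage_outer[OF False])
      moreover have "t < 7" using 3 by auto
      ultimately show ?thesis by blast
    qed
  next
    case 4
    define j where "j = (if t = 7 then 3 else if t = 8 then 4 else 5 :: 'a)"
    have "n' = pr (pr x s) 0 \<and> j' = j" if "stage L f n' j' w" for n' j'
      using u789[OF 4, of n' j'] that unfolding tx(1) j_def s_iff by auto
    moreover have "stage L f (pr (pr x s) 0) j w"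
      using 4 unfolding tx(1) j_def by (auto simp: stage_first[OF s])
    moreover have "j < 7" unfolding j_def by simp
    ultimately show ?thesis by blast
  qed
qed

lemma arc_intros:
  "occurs C i x y \<Longrightarrow> arc C i (pr 0 x) (pr 1 y)"
  "occurs C i y x \<Longrightarrow> arc C i (pr 1 x) (pr 2 y)"
  "arc C i (pr 1 x) (pr 0 (x + 1))"
  "arc C i (pr 2 x) (pr 3 x)"
  "arc C i (pr 3 x) (pr 4 x)"
  "arc C i (pr 4 x) (pr 5 x)"
  "arc C i (pr 5 x) (pr 4 x)"
  "arc C i (pr 4 x) (pr 3 x)"
  "arc C i (pr 5 x) (pr 1 x)"
  "occurs C i y x \<Longrightarrow> arc C i (pr 5 x) (pr 6 y)"
  "occurs C i x y \<Longrightarrow> arc C i (pr 6 x) (pr 0 (y + 1))"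
  "next_copy y x \<Longrightarrow> arc C i (pr 2 x) (pr 5 y)"
  "next_copy x y \<Longrightarrow> arc C i (pr 3 x) (pr 1 y)"
  "first_copy x y \<Longrightarrow> arc C i (pr 2 x) (pr 7 y)"
  "arc C i (pr 7 x) (pr 8 x)"
  "arc C i (pr 8 x) (pr 9 x)"
  "first_copy y x \<Longrightarrow> arc C i (pr 9 x) (pr 1 y)"
  by (simp_all add: arc_def)

lemma stage_arc:
  fixes n :: "'a::rca0_model"
  assumes f: "\<And>c. pr i (pr c (f c)) \<in> C" "\<And>c. true_lit L (f c)"
  shows "stage L f n 0 w \<Longrightarrow> stage L f n 1 w' \<Longrightarrow> arc C i w w'"
    "stage L f n 1 w \<Longrightarrow> stage L f n 2 w' \<Longrightarrow> arc C i w w'"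
    "stage L f n 2 w \<Longrightarrow> stage L f n 3 w' \<Longrightarrow> arc C i w w'"
    "stage L f n 3 w \<Longrightarrow> stage L f n 4 w' \<Longrightarrow> arc C i w w'"
    "stage L f n 4 w \<Longrightarrow> stage L f n 5 w' \<Longrightarrow> arc C i w w'"
    "stage L f n 5 w \<Longrightarrow> stage L f n 6 w' \<Longrightarrow> arc C i w w'"
    "stage L f n 6 w \<Longrightarrow> stage L f (n + 1) 0 w' \<Longrightarrow> arc C i w w'"
proof -
  have occ: "occurs C i c (pr (f c) c)" for c
    using f(1)[of c] f(2)[of c] unfolding occurs_def is_lit_def true_lit_def by blast
  \<comment> \<open>A chosen slot holds a true literal, so its stage passes its own token and
    reaches \<open>pr 5 m\<close>, the only kind of vertex with an arc to a clause vertex.\<close>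
  have not_inner: "\<not> inner_slot L m" if chosen: "chosen_slot f m" for m
  proof -
    obtain c where m: "m = pr (f c) c" using chosen unfolding chosen_slot_def by blast
    have "\<not> false_lit L (f c)" using f(2)[of c] by (auto simp: true_lit_def false_lit_def)
    then show ?thesis unfolding inner_slot_def m by auto
  qed
  show "stage L f n 0 w \<Longrightarrow> stage L f n 1 w' \<Longrightarrow> arc C i w w'"
    "stage L f n 1 w \<Longrightarrow> stage L f n 2 w' \<Longrightarrow> arc C i w w'"
    using occ[of n] by (simp_all add: stage_012 arc_intros)
  have 345: "(\<forall>w w'. stage L f n 2 w \<longrightarrow> stage L f n 3 w' \<longrightarrow> arc C i w w') \<and>
    (\<forall>w w'. stage L f n 3 w \<longrightarrow> stage L f n 4 w' \<longrightarrow> arc C i w w') \<and>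
    (\<forall>w w'. stage L f n 4 w \<longrightarrow> stage L f n 5 w' \<longrightarrow> arc C i w w') \<and>
    (\<forall>w w'. stage L f n 5 w \<longrightarrow> stage L f n 6 w' \<longrightarrow> arc C i w w')"
  proof (cases L n rule: slot_cases)
    case outer
    have "arc C i (pr 5 n) w'" if w': "stage L f n 6 w'" for w'
    proof (cases "chosen_slot f n")
      case True
      then obtain c where c: "n = pr (f c) c" unfolding chosen_slot_def by blast
      have "w' = pr 6 c" using w' unfolding c stage_6(1) .
      then show ?thesis using occ[of c] unfolding c by (simp add: arc_intros)
    next
      case False
      then show ?thesis using w' by (simp add: stage_6(2) arc_intros)
    qed
    with outer show ?thesis by (simp add: stage_012 stage_outer arc_intros)
  next
    case (first x s)
    then have "stage L f n 6 w' \<longleftrightarrow> w' = pr 1 n" for w'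
      using not_inner unfolding inner_slot_def by (intro stage_6(2)) blast
    moreover have "first_copy n x" using first unfolding first_copy_def by blast
    ultimately show ?thesis using first(2) unfolding first(1) by (simp add: stage_012 stage_first arc_intros)
  next
    case (later r m)
    then have "stage L f n 6 w' \<longleftrightarrow> w' = pr 1 n" for w'
      using not_inner unfolding inner_slot_def by (intro stage_6(2)) blast
    moreover have "next_copy (pr r m) n" using later unfolding next_copy_def by blast
    ultimately show ?thesis using later(2) unfolding later(1) by (simp add: stage_012 stage_later arc_intros)
  qed
  then show "stage L f n 2 w \<Longrightarrow> stage L f n 3 w' \<Longrightarrow> arc C i w w'"
    "stage L f n 3 w \<Longrightarrow> stage L f n 4 w' \<Longrightarrow> arc C i w w'"
    "stage L f n 4 w \<Longrightarrow> stage L f n 5 w' \<Longrightarrow> arc C i w w'"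
    "stage L f n 5 w \<Longrightarrow> stage L f n 6 w' \<Longrightarrow> arc C i w w'" by blast+
  assume w: "stage L f n 6 w" and w': "stage L f (n + 1) 0 w'"
  have w'_eq: "w' = pr 0 (n + 1)" using w' unfolding stage_012 .
  show "arc C i w w'"
  proof (cases "chosen_slot f n")
    case True
    then obtain c where c: "n = pr (f c) c" unfolding chosen_slot_def by blast
    have "w = pr 6 c" using w unfolding c stage_6(1) .
    then show ?thesis using occ[of c] unfolding w'_eq c by (simp add: arc_intros)
  next
    case False
    then have "w = pr 1 n" using w by (simp add: stage_6(2))
    then show ?thesis unfolding w'_eq by (simp add: arc_intros)
  qed
qed

lemma stage_vertices: "j < 7 \<Longrightarrow> stage L f n j w \<Longrightarrow> w \<in> vertices"
proof -
  have v: "pr t x \<in> vertices \<longleftrightarrow> t = 0 \<or> t = 1 \<or> t = 2 \<or> t = 3 \<or> t = 4 \<or> t = 5 \<or> t = 6 \<or> t = 7 \<or> t = 8 \<or> t = 9"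
    for t x :: 'a by (auto simp: vertices_def)
  show "stage L f n j w \<Longrightarrow> w \<in> vertices"
    unfolding stage_def by (elim disjE exE conjE) (simp_all add: v)
qed

lemma satisfiable_imp_dhamilton:
  assumes C: "C \<in> Sets" and A: "\<And>u v. pr i (pr u v) \<in> A \<longleftrightarrow> arc C i u v"
    and L: "L \<in> Sets" "satisfies C i L"
  shows "\<exists>D. dhamilton vertices A i D"
proof -
  have "\<exists>f. fn f \<and> (\<forall>c. pr i (pr c (f c)) \<in> C \<and> true_lit L (f c))"
  proof (rule bd_choice)
    show "bd (\<lambda>e. pr i (pr (e 0) (e 1)) \<in> C \<and> true_lit L (e 1))"
      by (intro bd_pr_intros bd_true_lit C L(1))
  qed (use L(2) in \<open>simp add: satisfies_def\<close>)
  then obtain f where fnf: "fn f" and f: "\<And>c. pr i (pr c (f c)) \<in> C" "\<And>c. true_lit L (f c)" by blast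
  define Q where "Q x w \<longleftrightarrow> (\<exists>n. n \<le> x \<and> (\<exists>j. j < 7 \<and> (x = 7 * n + j \<and> stage L f n j w)))" for x w
  have le: "n \<le> 7 * n + j" for n j :: 'a
  proof -
    have "(1 + 6) * n = n + 6 * n" by (simp only: distrib_right mult_1)
    then have "7 * n + j = n + (6 * n + j)" by (simp add: add.assoc)
    then show ?thesis unfolding le_iff_ex_add_M by blast
  qed
  have Q: "Q (7 * n + j) w \<longleftrightarrow> stage L f n j w" if j: "j < 7" for n j w
  proof
    assume "Q (7 * n + j) w"
    then obtain n' j' where "j' < 7" "7 * n + j = 7 * n' + j'" "stage L f n' j' w"
      unfolding Q_def by blast
    then show "stage L f n j w" using division_unique[OF j, of j' n n'] by blast
  next
    assume "stage L f n j w"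
    then show "Q (7 * n + j) w" unfolding Q_def using j le by blast
  qed
  have mod7: "\<exists>n j. j < 7 \<and> x = 7 * n + j" for x :: 'a
    using division_exists[of 7 x] by auto
  have "\<exists>!w. Q x w" for x
  proof -
    obtain n j where "j < 7" "x = 7 * n + j" using mod7 by blast
    then show ?thesis using Q[of j n] stage_unique[of j L f n] by simp
  qed
  then have "\<exists>D. \<forall>x w. D x = w \<longleftrightarrow> Q x w" by metis
  then obtain D where D: "\<And>x w. D x = w \<longleftrightarrow> Q x w" by blast
  have "fn D"
  proof (rule fnI[OF D])
    show "bd (\<lambda>e. Q (e 1) (e 0))"
      unfolding Q_def stage_def inner_slot_def chosen_slot_def
      by (intro bd_pr_intros bd_fn_eq[OF fnf] bd_false_lit[OF L(1)])
  qed
  have stage_D: "stage L f n j w \<longleftrightarrow> D (7 * n + j) = w" if "j < 7" for n j w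
    unfolding D Q[OF that] ..
  have D_stage: "stage L f n j (D (7 * n + j))" if "j < 7" for n j
    unfolding stage_D[OF that] ..
  have "D x \<in> vertices" for x
  proof -
    obtain n j where "j < 7" "x = 7 * n + j" using mod7 by blast
    then show ?thesis using D_stage[of j n] stage_vertices by blast
  qed
  moreover have "arc C i (D x) (D (x + 1))" for x
  proof -
    obtain n j where j: "j < 7" and x: "x = 7 * n + j" using mod7 by blast
    have step: "arc C i (D (7 * n + j)) (D (7 * n + j + 1))"
      if "j < 7" "j + 1 < 7" "\<And>w w'. stage L f n j w \<Longrightarrow> stage L f n (j + 1) w' \<Longrightarrow> arc C i w w'" for j
      using that(3)[OF D_stage[OF that(1)] D_stage[OF that(2)]] by (simp add: add.assoc)
    have last: "arc C i (D (7 * n + 6)) (D (7 * n + 6 + 1))"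
    proof -
      have "7 * n + 6 + 1 = 7 * (n + 1) + 0" by (simp add: add.assoc distrib_left)
      then show ?thesis using stage_arc(7)[where f = f and L = L, OF f] D_stage[of 6 n] D_stage[of 0 "n + 1"] by simp
    qed
    note arcs = stage_arc[where f = f and L = L, OF f]
    from j have "j = 0 \<or> j = 1 \<or> j = 2 \<or> j = 3 \<or> j = 4 \<or> j = 5 \<or> j = 6" by (simp only: less_7_cases)
    then show ?thesis
      unfolding x using last step[of 0] step[of 1] step[of 2] step[of 3] step[of 4] step[of 5] arcs(1-6)
      by (elim disjE) simp_all
  qed
  moreover have "\<exists>!x. D x = w" if w: "w \<in> vertices" for w
  proof -
    obtain n j where nj: "j < 7" "stage L f n j w" "\<And>n' j'. stage L f n' j' w \<Longrightarrow> n' = n \<and> j' = j"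
      using stage_cover[OF w] by blast
    have "x = 7 * n + j" if x: "D x = w" for x
    proof -
      obtain n' j' where x': "j' < 7" "x = 7 * n' + j'" using mod7 by blast
      then have "stage L f n' j' w" using x stage_D by blast
      with nj(3) x'(2) show ?thesis by blast
    qed
    moreover have "D (7 * n + j) = w" using nj stage_D by blast
    ultimately show ?thesis by blast
  qed
  ultimately show ?thesis
    using \<open>fn D\<close> unfolding dhamilton_def A by blast
qed

theorem satisfiability_comprehension:
  fixes C :: "'a::rca0_model set"
  assumes ham: "hamilton_comprehension TYPE('a)" and C: "C \<in> Sets"
  shows "{i. \<exists>L\<in>Sets. satisfies C i L} \<in> Sets"
proof -
  define A where "A = {z. \<exists>i p. z = pr i p \<and> (\<exists>u v. p = pr u v \<and> arc C i u v)}"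
  have A: "pr i (pr u v) \<in> A \<longleftrightarrow> arc C i u v" for i u v by (simp add: A_def)
  have "A \<in> Sets"
    unfolding A_def arc_def
    by (intro Sets_pr bd_pr_intros bd_occurs[OF C] bd_next_copy bd_first_copy)
  \<comment> \<open>Arcs into a vertex of kind 0 lead to a successor stage, so \<open>pr 0 0\<close>
    is the source that the passage to undirected graphs requires.\<close>
  moreover have "(pr 0 0 :: 'a) \<in> vertices" by (auto simp: vertices_def)
  moreover have "pr i (pr u (pr 0 0)) \<notin> A" for i u
    unfolding A using arc_pred(1) by blast
  ultimately have "{i. \<exists>D. dhamilton vertices A i D} \<in> Sets"
    using dhamilton_comprehension[OF ham _ vertices_in_Sets] by blast
  moreover have "(\<exists>D. dhamilton vertices A i D) \<longleftrightarrow> (\<exists>L\<in>Sets. satisfies C i L)" for i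
    using dhamilton_imp_satisfiable[OF A] satisfiable_imp_dhamilton[OF C A] by blast
  ultimately show ?thesis by simp
qed


section \<open>Arithmetical comprehension\<close>

lemma projection_in_Sets:
  fixes A :: "'a::rca0_model set"
  assumes ham: "hamilton_comprehension TYPE('a)" and A: "A \<in> Sets"
  shows "{i. \<exists>x. pr i x \<in> A} \<in> Sets"
proof -
  \<comment> \<open>All clauses of instance \<open>i\<close> coincide: they consist of the positive
    literals of those \<open>x\<close> with \<open>pr i x \<in> A\<close>. If there is any such
    \<open>x\<close>, the full set satisfies them.\<close>
  define C where "C = {z. \<exists>i p. z = pr i p \<and> (\<exists>c r. p = pr c r \<and> (\<exists>x s. r = pr x s \<and> (s = 0 \<and> pr i x \<in> A)))}"
  have C: "pr i (pr c r) \<in> C \<longleftrightarrow> (\<exists>x s. r = pr x s \<and> (s = 0 \<and> pr i x \<in> A))" for i c r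
    by (simp add: C_def)
  have "C \<in> Sets" unfolding C_def by (intro Sets_pr bd_pr_intros A)
  then have "{i. \<exists>L\<in>Sets. satisfies C i L} \<in> Sets"
    by (rule satisfiability_comprehension[OF ham])
  moreover have "(\<exists>L\<in>Sets. satisfies C i L) \<longleftrightarrow> (\<exists>x. pr i x \<in> A)" for i
  proof
    assume "\<exists>L\<in>Sets. satisfies C i L"
    then obtain r where "pr i (pr 0 r) \<in> C" unfolding satisfies_def by blast
    then show "\<exists>x. pr i x \<in> A" unfolding C by blast
  next
    assume "\<exists>x. pr i x \<in> A"
    then obtain x where "pr i x \<in> A" by blast
    then have "satisfies C i UNIV"
      unfolding satisfies_def C true_lit_def by blast
    moreover have "(UNIV :: 'a set) \<in> Sets"
      using Sets_bd[of "\<lambda>_. True"] bd_True by simp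
    ultimately show "\<exists>L\<in>Sets. satisfies C i L" by blast
  qed
  ultimately show ?thesis by simp
qed

lemma Sets_complement:
  fixes A :: "'a::rca0_model set"
  shows "A \<in> Sets \<Longrightarrow> {a. a \<notin> A} \<in> Sets"
  by (intro Sets_bd bd_intros)

section \<open>Components of pairs, composition and coded environments\<close>

definition pfst :: "'a::rca0_model \<Rightarrow> 'a" where
  "pfst a = (if \<exists>x y. a = pr x y then THE x. \<exists>y. a = pr x y else 0)"

definition psnd :: "'a::rca0_model \<Rightarrow> 'a" where
  "psnd a = (if \<exists>x y. a = pr x y then THE y. \<exists>x. a = pr x y else 0)"

lemma pfst_pr [simp]: "pfst (pr x y) = x"
  by (auto simp: pfst_def)

lemma psnd_pr [simp]: "psnd (pr x y) = y"
  by (auto simp: psnd_def)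

text \<open>The pairing function is not onto, hence the second case with its default 0. In this form
  the graph is visibly bounded.\<close>

lemma pfst_iff: "pfst a = x \<longleftrightarrow> (\<exists>u v. a = pr u v \<and> u = x) \<or> \<not> (\<exists>u v. a = pr u v \<and> True) \<and> 0 = x"
proof (cases "\<exists>u v. a = pr u v")
  case True
  then obtain u v where "a = pr u v" by blast
  then show ?thesis by simp
qed (auto simp: pfst_def)

lemma psnd_iff: "psnd a = x \<longleftrightarrow> (\<exists>u v. a = pr u v \<and> v = x) \<or> \<not> (\<exists>u v. a = pr u v \<and> True) \<and> 0 = x"
proof (cases "\<exists>u v. a = pr u v")
  case True
  then obtain u v where "a = pr u v" by blast
  then show ?thesis by simp
qed (auto simp: psnd_def)

lemma fn_pfst: "fn pfst"
  by (rule fnI[OF pfst_iff]) (intro bd_pr_intros)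

lemma fn_psnd: "fn psnd"
  by (rule fnI[OF psnd_iff]) (intro bd_pr_intros)

lemma fn_const: "fn (\<lambda>_. c)"
  by (rule fnI[of _ "\<lambda>x y. c = y"]) (auto intro!: bd_pr_intros)

text \<open>The intermediate value \<open>G x\<close> is not bounded by a term. But it exists and is
  unique, so the graph and its complement are both \<Sigma> with this value as witness.\<close>

lemma fn_comp:
  assumes F: "fn F" and G: "fn G"
  shows "fn (\<lambda>x. F (G x))"
  unfolding fn_def
proof (rule Sets_sig)
  have 1: "(\<exists>x. z = pr x (F (G x))) \<longleftrightarrow> (\<exists>u. \<exists>x y. z = pr x y \<and> (G x = u \<and> F u = y))" for z by blast
  show "sig (\<lambda>e. \<exists>x. e 0 = pr x (F (G x)))"
    unfolding 1 by (intro sig_ex_bd bd_pr_intros bd_fn_eq[OF F] bd_fn_eq[OF G])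
  have 2: "(\<not> (\<exists>x. z = pr x (F (G x)))) \<longleftrightarrow>
      (\<exists>u. \<not> (\<exists>x y. z = pr x y \<and> True) \<or> (\<exists>x y. z = pr x y \<and> (G x = u \<and> \<not> F u = y)))" for z by auto
  show "sig (\<lambda>e. \<not> (\<exists>x. e 0 = pr x (F (G x))))"
    unfolding 2 by (intro sig_ex_bd bd_pr_intros bd_fn_eq[OF F] bd_fn_eq[OF G])
qed

lemma fn_pr:
  assumes F: "fn F" and G: "fn G"
  shows "fn (\<lambda>x. pr (F x) (G x))"
proof (rule fnI)
  show "pr (F x) (G x) = y \<longleftrightarrow> (\<exists>u v. y = pr u v \<and> (F x = u \<and> G x = v))" for x y by auto
  show "bd (\<lambda>e. \<exists>u v. e 0 = pr u v \<and> (F (e 1) = u \<and> G (e 1) = v))"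
    by (intro bd_pr_intros bd_fn_eq[OF F] bd_fn_eq[OF G])
qed

text \<open>The operation is regarded as a function of one argument on pairs, which reduces the
  claim to composition.\<close>

lemma fn_binary:
  assumes F: "fn F" and G: "fn G" and h: "bd (\<lambda>e. h (e 1) (e 0) = e 2)"
  shows "fn (\<lambda>x. h (F x) (G x))"
proof -
  have "fn (\<lambda>z. h (pfst z) (psnd z))"
  proof (rule fnI)
    show "h (pfst z) (psnd z) = y \<longleftrightarrow>
      (\<exists>u v. z = pr u v \<and> h u v = y) \<or> \<not> (\<exists>u v. z = pr u v \<and> True) \<and> h 0 0 = y" for z y
      by (auto simp: pfst_def psnd_def)
    have "bd (\<lambda>e. \<exists>u v. e 1 = pr u v \<and> h u v = e 0)"
      using bd_reindex[OF h, of "\<lambda>i. i"] by (intro bd_ex_pr tm_var) (simp add: numeral_2_eq_2)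
    then show "bd (\<lambda>e. (\<exists>u v. e 1 = pr u v \<and> h u v = e 0) \<or>
        \<not> (\<exists>u v. e 1 = pr u v \<and> True) \<and> h 0 0 = e 0)"
      by (rule bd_or) (intro bd_pr_intros)
  qed
  from fn_comp[OF this fn_pr[OF F G]] show ?thesis by simp
qed

lemma fn_vimage:
  assumes F: "fn F" and A: "A \<in> Sets"
  shows "{x. F x \<in> A} \<in> Sets"
proof (rule Sets_sig)
  have 1: "F x \<in> A \<longleftrightarrow> (\<exists>u. F x = u \<and> u \<in> A)" "F x \<notin> A \<longleftrightarrow> (\<exists>u. F x = u \<and> \<not> u \<in> A)" for x by auto
  show "sig (\<lambda>e. F (e 0) \<in> A)"
    unfolding 1(1) by (intro sig_ex_bd bd_and bd_fn_eq[OF F] bd_mem A tm_var)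
  show "sig (\<lambda>e. F (e 0) \<notin> A)"
    unfolding 1(2) by (intro sig_ex_bd bd_and bd_not bd_fn_eq[OF F] bd_mem A tm_var)
qed

lemma range_case_nat: "X \<in> A \<Longrightarrow> range v \<subseteq> A \<Longrightarrow> range (case_nat X v) \<subseteq> A"
proof -
  assume "X \<in> A" "range v \<subseteq> A"
  then have "case_nat X v i \<in> A" for i by (cases i) auto
  then show ?thesis by blast
qed

text \<open>Read as an infinitely nested pair, a number codes an environment; parts that are not pairs give \<open>0\<close>.\<close>

fun dec :: "'a::rca0_model \<Rightarrow> nat \<Rightarrow> 'a" where
  "dec a 0 = pfst a"
| "dec a (Suc i) = dec (psnd a) i"

text \<open>Pairing with \<open>m\<close> in front does to the code what a number quantifier does to
  the environment.\<close>

lemma dec_pr: "dec (pr m a) = case_nat m (dec a)"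
proof
  show "dec (pr m a) i = case_nat m (dec a) i" for i
    by (cases i) simp_all
qed

lemma fn_dec: "fn (\<lambda>a. dec a i)"
proof (induction i)
  case 0
  then show ?case by (simp add: fn_pfst)
next
  case (Suc i)
  from fn_comp[OF this fn_psnd] show ?case by simp
qed

lemma fn_eval: "fn (\<lambda>a :: 'a::rca0_model. eval struct (dec a) t)"
proof (induction t)
  case (TAdd s t)
  have "bd (\<lambda>e. e 1 + e 0 = (e 2 :: 'a))" by (intro bd_pr_intros)
  from fn_binary[OF TAdd this] have "fn (\<lambda>a :: 'a. eval struct (dec a) s + eval struct (dec a) t)" .
  then show ?case by simp
next
  case (TMul s t)
  have "bd (\<lambda>e. e 1 * e 0 = (e 2 :: 'a))" by (intro bd_pr_intros)
  from fn_binary[OF TMul this] have "fn (\<lambda>a :: 'a. eval struct (dec a) s * eval struct (dec a) t)" .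
  then show ?case by simp
qed (simp_all add: fn_dec fn_const)

text \<open>The induction on the formula takes place outside the model, so comprehension may be used
  at every step: each number quantifier costs one projection between two complements.\<close>

theorem arithmetical_comprehension:
  fixes v :: "nat \<Rightarrow> 'a::rca0_model set"
  assumes ham: "hamilton_comprehension TYPE('a)" and v: "range v \<subseteq> Sets"
  shows "arithmetical \<phi> \<Longrightarrow> {a. sat struct (dec a) v \<phi>} \<in> Sets"
proof (induction \<phi>)
  case (FEq s t)
  have "{z. \<exists>x y. z = pr x y \<and> x = (y :: 'a)} \<in> Sets" by (intro Sets_pr bd_pr_intros)
  from fn_vimage[OF fn_pr[OF fn_eval fn_eval] this] show ?case by simp
next
  case (FLess s t)
  have "{z. \<exists>x y. z = pr x y \<and> x < (y :: 'a)} \<in> Sets" by (intro Sets_pr bd_pr_intros)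
  from fn_vimage[OF fn_pr[OF fn_eval fn_eval] this] show ?case by simp
next
  case (FMem t X)
  have "v X \<in> Sets" using v by blast
  from fn_vimage[OF fn_eval this] show ?case by simp
next
  case Falsum
  then show ?case using Sets_bd[of "\<lambda>_. False"] bd_False by simp
next
  case (FImp \<phi> \<psi>)
  then have "{a. sat struct (dec a) v \<phi>} \<in> Sets" "{a. sat struct (dec a) v \<psi>} \<in> Sets" by simp_all
  moreover have "{a. a \<in> A \<longrightarrow> a \<in> B} \<in> Sets" if "A \<in> Sets" "B \<in> Sets" for A B :: "'a set"
    using that by (intro Sets_bd bd_intros)
  ultimately show ?case by fastforce
next
  case (AllN \<phi>)
  then have A: "{a. sat struct (dec a) v \<phi>} \<in> Sets" by simp
  have "{a. \<forall>m. pr m a \<in> A} \<in> Sets" if A: "A \<in> Sets" for A :: "'a set"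
  proof -
    \<comment> \<open>A binder prepends the new value, whereas \<open>projection_in_Sets\<close>
      quantifies the second component; so the pairs are swapped.\<close>
    have "{z. \<exists>x y. z = pr x y \<and> pr y x \<notin> A} \<in> Sets" by (intro Sets_pr bd_pr_intros A)
    then have "{a. \<exists>m. pr a m \<in> {z. \<exists>x y. z = pr x y \<and> pr y x \<notin> A}} \<in> Sets"
      by (rule projection_in_Sets[OF ham])
    then have "{a. \<exists>m. pr m a \<notin> A} \<in> Sets" by simp
    from Sets_complement[OF this] show ?thesis by simp
  qed
  from this[OF A] show ?case by (simp add: dec_pr)
qed simp


section \<open>\<open>\<Pi>\<close>-comprehension from satisfiability\<close>

text \<open>A single instance, whose equivalence with \<open>\<Phi>\<close> is demanded for all
  \<open>L\<close>, also outside \<open>Sets\<close>. Closure under conjunction then allows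
  conditions to be assembled by recursion on a formula.\<close>

definition clausal :: "('a::rca0_model set \<Rightarrow> bool) \<Rightarrow> bool" where
  "clausal \<Phi> \<longleftrightarrow> (\<exists>C\<in>Sets. \<forall>L. \<Phi> L \<longleftrightarrow> (\<forall>c. \<exists>r. pr c r \<in> C \<and> true_lit L r))"

lemma clausalI:
  assumes "bd (\<lambda>e. R (e 1) (e 0))" "\<And>L. \<Phi> L \<longleftrightarrow> (\<forall>c. \<exists>r. R c r \<and> true_lit L r)"
  shows "clausal \<Phi>"
  unfolding clausal_def using Sets_pr[of R] assms
  by (intro bexI[of _ "{z. \<exists>x y. z = pr x y \<and> R x y}"]) simp_all

lemma true_lit_simps [simp]:
  "true_lit L (pr x 0) \<longleftrightarrow> x \<in> L" "true_lit L (pr x 1) \<longleftrightarrow> x \<notin> L"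
  by (simp_all add: true_lit_def)

definition is_pr :: "'a::rca0_model \<Rightarrow> bool" where
  "is_pr c \<longleftrightarrow> (\<exists>x y. c = pr x y \<and> True)"

lemma bd_is_pr: "tm f \<Longrightarrow> bd (\<lambda>e. is_pr (f e))"
  unfolding is_pr_def by (intro bd_pr_intros)

text \<open>The trivial clause \<open>0 \<or> \<not> 0\<close> stands at the indices that are not pairs.\<close>

lemma all_pr_clauses:
  "(\<forall>c. \<exists>r. ((\<exists>x y. c = pr x y \<and> R x y r) \<or> \<not> is_pr c \<and> (r = pr 0 0 \<or> r = pr 0 1)) \<and> true_lit L r) \<longleftrightarrow>
    (\<forall>x y. \<exists>r. R x y r \<and> true_lit L r)" (is "(\<forall>c. ?P c) \<longleftrightarrow> ?Q")
proof
  assume P: "\<forall>c. ?P c"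
  show ?Q
  proof (intro allI)
    fix x y
    from P have "?P (pr x y)" by (rule spec)
    then show "\<exists>r. R x y r \<and> true_lit L r" by (auto simp: is_pr_def)
  qed
next
  assume Q: ?Q
  show "\<forall>c. ?P c"
  proof
    fix c
    show "?P c"
    proof (cases "is_pr c")
      case True
      then obtain x y where "c = pr x y" by (auto simp: is_pr_def)
      then show ?thesis using Q by blast
    next
      case False
      have "true_lit L (pr 0 0) \<or> true_lit L (pr 0 1)" by simp
      then show ?thesis using False by blast
    qed
  qed
qed

text \<open>Index \<open>pr x 0\<close> carries clause \<open>x\<close> of the first sequence, and
  each \<open>pr x y\<close> with \<open>y \<noteq> 0\<close> carries clause \<open>x\<close> of the
  second.\<close>

lemma clausal_and:
  assumes "clausal \<Phi>" "clausal \<Psi>"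
  shows "clausal (\<lambda>L. \<Phi> L \<and> \<Psi> L)"
proof -
  obtain C where C: "C \<in> Sets" "\<And>L. \<Phi> L \<longleftrightarrow> (\<forall>c. \<exists>r. pr c r \<in> C \<and> true_lit L r)"
    using assms unfolding clausal_def by blast
  obtain D where D: "D \<in> Sets" "\<And>L. \<Psi> L \<longleftrightarrow> (\<forall>c. \<exists>r. pr c r \<in> D \<and> true_lit L r)"
    using assms unfolding clausal_def by blast
  show ?thesis
  proof (rule clausalI)
    show "bd (\<lambda>e. (\<exists>x y. e 1 = pr x y \<and> (y = 0 \<and> pr x (e 0) \<in> C \<or> y \<noteq> 0 \<and> pr x (e 0) \<in> D)) \<or>
        \<not> is_pr (e 1) \<and> (e 0 = pr 0 0 \<or> e 0 = pr 0 1))"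
      by (intro bd_pr_intros bd_is_pr C D)
    show "\<Phi> L \<and> \<Psi> L \<longleftrightarrow> (\<forall>c. \<exists>r. ((\<exists>x y. c = pr x y \<and> (y = 0 \<and> pr x r \<in> C \<or> y \<noteq> 0 \<and> pr x r \<in> D)) \<or>
        \<not> is_pr c \<and> (r = pr 0 0 \<or> r = pr 0 1)) \<and> true_lit L r)" for L
      unfolding all_pr_clauses C(2) D(2) by (metis zero_neq_one)
  qed
qed

text \<open>Shorter clauses are obtained from this by repeating a literal.\<close>

lemma clausal_ternary:
  fixes s :: "'a::rca0_model"
  shows "clausal (\<lambda>L. \<forall>a. true_lit L (pr (pr k a) s) \<or> true_lit L (pr (pr k' a) s') \<or> true_lit L (pr (pr k'' a) s''))"
  by (rule clausalI[where R = "\<lambda>a r. r = pr (pr k a) s \<or> r = pr (pr k' a) s' \<or> r = pr (pr k'' a) s''"])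
    (intro bd_pr_intros, blast)

lemma clausal_slice_eq:
  assumes "A \<in> Sets"
  shows "clausal (\<lambda>L. \<forall>a. pr k a \<in> L \<longleftrightarrow> a \<in> A)"
proof (rule clausalI)
  show "bd (\<lambda>e. e 1 \<in> A \<and> e 0 = pr (pr k (e 1)) 0 \<or> e 1 \<notin> A \<and> e 0 = pr (pr k (e 1)) 1)"
    by (intro bd_pr_intros assms)
  show "(\<forall>a. pr k a \<in> L \<longleftrightarrow> a \<in> A) \<longleftrightarrow>
    (\<forall>a. \<exists>r. (a \<in> A \<and> r = pr (pr k a) 0 \<or> a \<notin> A \<and> r = pr (pr k a) 1) \<and> true_lit L r)" for L
  proof -
    have "(\<exists>r. (a \<in> A \<and> r = pr (pr k a) 0 \<or> a \<notin> A \<and> r = pr (pr k a) 1) \<and> true_lit L r) \<longleftrightarrow>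
      (pr k a \<in> L \<longleftrightarrow> a \<in> A)" for a by (cases "a \<in> A") auto
    then show ?thesis by simp
  qed
qed

lemma clausal_fn:
  assumes F: "fn F" and s: "s = 0 \<and> s' = 1 \<or> s = 1 \<and> s' = (0::'a::rca0_model)"
  shows "clausal (\<lambda>L. \<forall>a. true_lit L (pr (pr k a) s) \<or> true_lit L (pr (pr k' (F a)) s'))"
proof (rule clausalI)
  show "bd (\<lambda>e. e 0 = pr (pr k (e 1)) s \<or>
      (\<exists>x t. e 0 = pr x t \<and> (t = s' \<and> (\<exists>y z. x = pr y z \<and> (y = k' \<and> F (e 1) = z)))))"
    by (intro bd_pr_intros bd_fn_eq[OF F])
  show "(\<forall>a. true_lit L (pr (pr k a) s) \<or> true_lit L (pr (pr k' (F a)) s')) \<longleftrightarrow>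
    (\<forall>a. \<exists>r. (r = pr (pr k a) s \<or> (\<exists>x t. r = pr x t \<and> (t = s' \<and> (\<exists>y z. x = pr y z \<and> (y = k' \<and> F a = z))))) \<and>
      true_lit L r)" for L by blast
qed

text \<open>Here Tarski's conditions need infinite clauses: from right to left, the clause for
  \<open>a\<close> consists of \<open>pr k a\<close> and the negations of all
  \<open>pr k' (pr m a)\<close>. The other direction splits into a two-literal clause for each
  \<open>m\<close> and \<open>a\<close>.\<close>

lemma clausal_forall:
  "clausal (\<lambda>L. \<forall>a. pr k a \<in> L \<longleftrightarrow> (\<forall>m. pr k' (pr m a) \<in> (L :: 'a::rca0_model set)))"
proof -
  have 1: "clausal (\<lambda>L. \<forall>m a. \<exists>r. (r = pr (pr k a) 1 \<or> r = pr (pr k' (pr m a)) 0) \<and> true_lit L r)"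
    by (rule clausalI[OF _ all_pr_clauses[symmetric]]) (intro bd_pr_intros bd_is_pr)
  have 2: "clausal (\<lambda>L :: 'a set. \<forall>a. \<exists>r. (r = pr (pr k a) 0 \<or>
      (\<exists>x t. r = pr x t \<and> (t = 1 \<and> (\<exists>y z. x = pr y z \<and> (y = k' \<and> (\<exists>m a'. z = pr m a' \<and> a' = a)))))) \<and>
      true_lit L r)"
    by (rule clausalI[OF _ refl]) (intro bd_pr_intros)
  show ?thesis
  proof (rule back_subst[of clausal, OF clausal_and[OF 1 2]])
    show "(\<lambda>L :: 'a set. (\<forall>m a. \<exists>r. (r = pr (pr k a) 1 \<or> r = pr (pr k' (pr m a)) 0) \<and> true_lit L r) \<and>
      (\<forall>a. \<exists>r. (r = pr (pr k a) 0 \<or>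
        (\<exists>x t. r = pr x t \<and> (t = 1 \<and> (\<exists>y z. x = pr y z \<and> (y = k' \<and> (\<exists>m a'. z = pr m a' \<and> a' = a)))))) \<and>
        true_lit L r)) = (\<lambda>L. \<forall>a. pr k a \<in> L \<longleftrightarrow> (\<forall>m. pr k' (pr m a) \<in> L))" (is "?l = ?r")
    proof
      fix L :: "'a set"
      have "(\<exists>r. (r = pr (pr k a) 1 \<or> r = pr (pr k' (pr m a)) 0) \<and> true_lit L r) \<longleftrightarrow>
        pr k a \<notin> L \<or> pr k' (pr m a) \<in> L" for m a by (auto simp: conj_disj_distribR ex_disj_distrib)
      moreover have "(\<exists>r. (r = pr (pr k a) 0 \<or>
        (\<exists>x t. r = pr x t \<and> (t = 1 \<and> (\<exists>y z. x = pr y z \<and> (y = k' \<and> (\<exists>m a'. z = pr m a' \<and> a' = a)))))) \<and>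
        true_lit L r) \<longleftrightarrow> pr k a \<in> L \<or> (\<exists>m. pr k' (pr m a) \<notin> L)" (is "(\<exists>r. ?R r) \<longleftrightarrow> _") for a
      proof
        assume "pr k a \<in> L \<or> (\<exists>m. pr k' (pr m a) \<notin> L)"
        then show "\<exists>r. ?R r"
        proof
          assume "pr k a \<in> L"
          then show ?thesis by (intro exI[of _ "pr (pr k a) 0"] conjI disjI1 refl) simp
        next
          assume "\<exists>m. pr k' (pr m a) \<notin> L"
          then obtain m where "pr k' (pr m a) \<notin> L" by blast
          then show ?thesis by (intro exI[of _ "pr (pr k' (pr m a)) 1"]) simp
        qed
      qed (auto simp: conj_disj_distribR ex_disj_distrib)
      ultimately show "?l L = ?r L" by auto
    qed
  qed
qed

text \<open>The shift by \<open>Suc\<close> reserves 0 for the slice that interprets the set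
  variable. Codes are standard numerals and therefore distinct in every model.\<close>

definition code :: "fm \<Rightarrow> 'a::rca0_model" where
  "code \<phi> = of_nat (Suc (to_nat \<phi>))"

lemma code_inject [simp]: "code \<phi> = code \<psi> \<longleftrightarrow> \<phi> = \<psi>"
  by (simp add: code_def del: of_nat_Suc)

lemma code_nonzero [simp]: "code \<phi> \<noteq> 0" "0 \<noteq> code \<phi>"
  by (simp_all only: code_def of_nat_0_eq_iff of_nat_eq_0_iff)

text \<open>
  A truth definition: \<open>L\<close> contains \<open>pr (code \<psi>) a\<close> iff \<open>\<psi>\<close> holds at the environment \<open>a\<close>, and its slice at
  \<open>0\<close> interprets the set variable \<open>0\<close>. Tarski's conditions for this are clauses on \<open>L\<close>, which makes
  satisfiability as hard as \<open>\<Sigma>\<close>-truth.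
\<close>

primrec tarski :: "(nat \<Rightarrow> 'a::rca0_model set) \<Rightarrow> 'a set \<Rightarrow> fm \<Rightarrow> bool" where
  "tarski v L (s \<doteq> t) \<longleftrightarrow>
    (\<forall>a. pr (code (s \<doteq> t)) a \<in> L \<longleftrightarrow> a \<in> {a. eval struct (dec a) s = eval struct (dec a) t})"
| "tarski v L (s \<prec> t) \<longleftrightarrow>
    (\<forall>a. pr (code (s \<prec> t)) a \<in> L \<longleftrightarrow> a \<in> {a. eval struct (dec a) s < eval struct (dec a) t})"
| "tarski v L (t \<epsilon> X) \<longleftrightarrow> (\<forall>a. pr (code (t \<epsilon> X)) a \<in> L \<longleftrightarrow>
    (case X of 0 \<Rightarrow> pr 0 (eval struct (dec a) t) \<in> L | Suc Y \<Rightarrow> a \<in> {a. eval struct (dec a) t \<in> v Y}))"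
| "tarski v L \<^bold>\<bottom> \<longleftrightarrow> (\<forall>a. pr (code \<^bold>\<bottom>) a \<in> L \<longleftrightarrow> a \<in> {})"
| "tarski v L (\<phi> \<^bold>\<longrightarrow> \<psi>) \<longleftrightarrow> tarski v L \<phi> \<and> tarski v L \<psi> \<and>
    (\<forall>a. pr (code (\<phi> \<^bold>\<longrightarrow> \<psi>)) a \<in> L \<longleftrightarrow> (pr (code \<phi>) a \<in> L \<longrightarrow> pr (code \<psi>) a \<in> L))"
| "tarski v L (AllN \<phi>) \<longleftrightarrow> tarski v L \<phi> \<and>
    (\<forall>a. pr (code (AllN \<phi>)) a \<in> L \<longleftrightarrow> (\<forall>m. pr (code \<phi>) (pr m a) \<in> L))"
| "tarski v L (AllS \<phi>) \<longleftrightarrow> True"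

lemma tarski_truth:
  assumes "{x. pr 0 x \<in> L} = X"
  shows "arithmetical \<phi> \<Longrightarrow> tarski v L \<phi> \<Longrightarrow>
    pr (code \<phi>) a \<in> L \<longleftrightarrow> sat struct (dec a) (case_nat X v) \<phi>"
proof (induction \<phi> arbitrary: a)
  case (FMem t Y)
  then show ?case using assms by (cases Y) auto
qed (simp_all add: dec_pr)

primrec subformulas :: "fm \<Rightarrow> fm set" where
  "subformulas (s \<doteq> t) = {s \<doteq> t}"
| "subformulas (s \<prec> t) = {s \<prec> t}"
| "subformulas (t \<epsilon> X) = {t \<epsilon> X}"
| "subformulas \<^bold>\<bottom> = {\<^bold>\<bottom>}"
| "subformulas (\<phi> \<^bold>\<longrightarrow> \<psi>) = insert (\<phi> \<^bold>\<longrightarrow> \<psi>) (subformulas \<phi> \<union> subformulas \<psi>)"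
| "subformulas (AllN \<phi>) = insert (AllN \<phi>) (subformulas \<phi>)"
| "subformulas (AllS \<phi>) = insert (AllS \<phi>) (subformulas \<phi>)"

lemma finite_subformulas: "finite (subformulas \<phi>)"
  by (induction \<phi>) simp_all

lemma self_in_subformulas: "\<phi> \<in> subformulas \<phi>"
  by (cases \<phi>) simp_all

lemma arithmetical_subformulas: "arithmetical \<phi> \<Longrightarrow> \<psi> \<in> subformulas \<phi> \<Longrightarrow> arithmetical \<psi>"
  by (induction \<phi>) auto

lemma truth_tarski:
  assumes "\<And>x. pr 0 x \<in> L \<longleftrightarrow> x \<in> X"
    and "\<And>\<psi> a. \<psi> \<in> subformulas \<phi> \<Longrightarrow> pr (code \<psi>) a \<in> L \<longleftrightarrow> sat struct (dec a) (case_nat X v) \<psi>"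
  shows "tarski v L \<phi>"
  using assms(2)
proof (induction \<phi>)
  case (FMem t Y)
  then show ?case by (cases Y) (simp_all add: assms(1))
next
  case (FImp \<phi> \<psi>)
  then show ?case using self_in_subformulas by simp
next
  case (AllN \<phi>)
  then show ?case using self_in_subformulas by (simp add: dec_pr)
qed simp_all

text \<open>A true formula must yield a truth set inside the model. Only finitely many formulas are
  concerned, so the slices, which are arithmetical sets, are added one by one in an induction
  outside the model.\<close>

lemma truth_set_exists:
  fixes v :: "nat \<Rightarrow> 'a::rca0_model set"
  assumes ham: "hamilton_comprehension TYPE('a)" and v: "range v \<subseteq> Sets" and X: "X \<in> Sets"
    and F: "finite F" "\<And>\<psi>. \<psi> \<in> F \<Longrightarrow> arithmetical \<psi>"
  shows "\<exists>L\<in>Sets. (\<forall>x. pr 0 x \<in> L \<longleftrightarrow> x \<in> X) \<and>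
    (\<forall>\<psi>\<in>F. \<forall>a. pr (code \<psi>) a \<in> L \<longleftrightarrow> sat struct (dec a) (case_nat X v) \<psi>)"
  using F
proof (induction rule: finite_induct)
  case empty
  have "{z. \<exists>x y. z = pr x y \<and> y \<in> X} \<in> Sets" by (intro Sets_pr bd_pr_intros X)
  then show ?case by (rule bexI[rotated]) simp
next
  case (insert \<psi> F)
  then obtain L where L: "L \<in> Sets" "\<And>x. pr 0 x \<in> L \<longleftrightarrow> x \<in> X"
    "\<And>\<chi> a. \<chi> \<in> F \<Longrightarrow> pr (code \<chi>) a \<in> L \<longleftrightarrow> sat struct (dec a) (case_nat X v) \<chi>" by auto
  define A where "A = {a. sat struct (dec a) (case_nat X v) \<psi>}"
  have "range (case_nat X v) \<subseteq> Sets" using X v by (rule range_case_nat)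
  then have A: "A \<in> Sets" unfolding A_def using insert by (intro arithmetical_comprehension[OF ham]) auto
  define L' where "L' = {z. \<exists>x y. z = pr x y \<and> (x = code \<psi> \<and> y \<in> A \<or> x \<noteq> code \<psi> \<and> pr x y \<in> L)}"
  have mem: "pr x y \<in> L' \<longleftrightarrow> x = code \<psi> \<and> y \<in> A \<or> x \<noteq> code \<psi> \<and> pr x y \<in> L" for x y
    by (simp add: L'_def)
  have "L' \<in> Sets" unfolding L'_def by (intro Sets_pr bd_pr_intros A L(1))
  moreover have "pr 0 x \<in> L' \<longleftrightarrow> x \<in> X" for x by (simp add: mem L(2))
  moreover have "pr (code \<chi>) a \<in> L' \<longleftrightarrow> sat struct (dec a) (case_nat X v) \<chi>" if \<chi>: "\<chi> \<in> insert \<psi> F" for \<chi> a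
  proof (cases "\<chi> = \<psi>")
    case True
    then show ?thesis by (simp add: mem A_def)
  next
    case False
    with \<chi> have "\<chi> \<in> F" by simp
    with False show ?thesis by (simp add: mem L(3))
  qed
  ultimately show ?case by blast
qed

lemma clausal_cong:
  assumes "clausal \<Phi>" "\<And>L. \<Phi> L \<longleftrightarrow> \<Psi> L"
  shows "clausal \<Psi>"
  using assms unfolding clausal_def by simp

lemma clausal_tarski:
  fixes v :: "nat \<Rightarrow> 'a::rca0_model set"
  assumes v: "range v \<subseteq> Sets"
  shows "clausal (\<lambda>L. tarski v L \<phi>)"
proof (induction \<phi>)
  case (FEq s t)
  have "{z. \<exists>x y. z = pr x y \<and> x = (y :: 'a)} \<in> Sets" by (intro Sets_pr bd_pr_intros)
  from fn_vimage[OF fn_pr[OF fn_eval fn_eval] this] show ?case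
    unfolding tarski.simps by (intro clausal_slice_eq) simp
next
  case (FLess s t)
  have "{z. \<exists>x y. z = pr x y \<and> x < (y :: 'a)} \<in> Sets" by (intro Sets_pr bd_pr_intros)
  from fn_vimage[OF fn_pr[OF fn_eval fn_eval] this] show ?case
    unfolding tarski.simps by (intro clausal_slice_eq) simp
next
  case (FMem t X)
  show ?case
  proof (cases X)
    case 0
    let ?k = "code (t \<epsilon> X)"
    have "clausal (\<lambda>L :: 'a set. (\<forall>a. true_lit L (pr (pr ?k a) 1) \<or> true_lit L (pr (pr 0 (eval struct (dec a) t)) 0)) \<and>
      (\<forall>a. true_lit L (pr (pr ?k a) 0) \<or> true_lit L (pr (pr 0 (eval struct (dec a) t)) 1)))"
      by (intro clausal_and clausal_fn[OF fn_eval]) simp_all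
    then show ?thesis
      by (rule clausal_cong) (unfold 0 tarski.simps true_lit_simps nat.case, blast)
  next
    case (Suc Y)
    have "v Y \<in> Sets" using v by blast
    from clausal_slice_eq[OF fn_vimage[OF fn_eval this]] show ?thesis by (simp add: Suc)
  qed
next
  case Falsum
  have "{} \<in> (Sets :: 'a set set)" using Sets_bd[of "\<lambda>_. False"] bd_False by simp
  then show ?case unfolding tarski.simps by (rule clausal_slice_eq)
next
  case (FImp \<phi> \<psi>)
  let ?k = "code (\<phi> \<^bold>\<longrightarrow> \<psi>)" and ?l = "code \<phi>" and ?m = "code \<psi>"
  have "clausal (\<lambda>L :: 'a set.
      (\<forall>a. true_lit L (pr (pr ?k a) 1) \<or> true_lit L (pr (pr ?l a) 1) \<or> true_lit L (pr (pr ?m a) 0)) \<and>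
      (\<forall>a. true_lit L (pr (pr ?k a) 0) \<or> true_lit L (pr (pr ?l a) 0) \<or> true_lit L (pr (pr ?l a) 0)) \<and>
      (\<forall>a. true_lit L (pr (pr ?k a) 0) \<or> true_lit L (pr (pr ?m a) 1) \<or> true_lit L (pr (pr ?m a) 1)))"
    by (intro clausal_and clausal_ternary)
  then have "clausal (\<lambda>L :: 'a set. \<forall>a. pr ?k a \<in> L \<longleftrightarrow> (pr ?l a \<in> L \<longrightarrow> pr ?m a \<in> L))"
    by (rule clausal_cong) (unfold true_lit_simps, blast)
  with FImp show ?case unfolding tarski.simps by (intro clausal_and)
next
  case (AllN \<phi>)
  then show ?case unfolding tarski.simps by (intro clausal_and clausal_forall)
next
  case (AllS \<phi>)
  \<comment> \<open>A sequence of tautologies represents the condition \<open>True\<close>.\<close>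
  have "clausal (\<lambda>L :: 'a set. \<forall>a. true_lit L (pr (pr 0 a) 0) \<or> true_lit L (pr (pr 0 a) 1) \<or> true_lit L (pr (pr 0 a) 1))"
    by (rule clausal_ternary)
  then show ?case by (rule clausal_cong) simp
qed

text \<open>A whole environment need not be coded by a number, but a formula depends only on
  finitely many of its values.\<close>

lemma dec_exists: "\<exists>a. \<forall>i<n. dec a i = e i"
proof (induction n arbitrary: e)
  case (Suc n)
  obtain a where a: "\<forall>i<n. dec a i = e (Suc i)" using Suc[of "\<lambda>i. e (Suc i)"] by blast
  have "dec (pr (e 0) a) i = e i" if "i < Suc n" for i
    using a that by (cases i) simp_all
  then show ?case by blast
qed simp

text \<open>Replacing the irrelevant number variables by \<open>\<zero>\<close> carries
  \<open>supported\<close>, a property of substitution, over to truth.\<close>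

lemma sat_supported:
  assumes \<phi>: "supported m \<phi>" and e: "\<forall>i<m. e i = e' i"
  shows "sat M e v \<phi> \<longleftrightarrow> sat M e' v \<phi>"
proof -
  let ?\<sigma> = "\<lambda>i. if i < m then Var i else \<zero>"
  have "subst ?\<sigma> (\<lambda>X. X) \<phi> = subst Var (\<lambda>X. X) \<phi>"
    by (rule \<phi>[unfolded supported_def, rule_format]) simp
  then have *: "sat M f v \<phi> \<longleftrightarrow> sat M (\<lambda>i. eval M f (?\<sigma> i)) v \<phi>" for f
    using sat_subst[of M f v ?\<sigma> "\<lambda>X. X" \<phi>] by simp
  have "(\<lambda>i. eval M e (?\<sigma> i)) = (\<lambda>i. eval M e' (?\<sigma> i))" using e by (auto simp: fun_eq_iff)
  then show ?thesis using *[of e] *[of e'] by simp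
qed

theorem Sigma11_comprehension:
  fixes v :: "nat \<Rightarrow> 'a::rca0_model set"
  assumes ham: "hamilton_comprehension TYPE('a)" and v: "range v \<subseteq> Sets" and \<theta>: "arithmetical \<theta>"
  shows "{n. \<exists>X\<in>Sets. sat struct (case_nat n e) (case_nat X v) \<theta>} \<in> Sets"
proof -
  obtain m where m: "supported m \<theta>" using support_exists by blast
  obtain a where a: "\<forall>i<m. dec a i = e i" using dec_exists by blast
  have sat_a: "sat struct (dec (pr n a)) w \<theta> \<longleftrightarrow> sat struct (case_nat n e) w \<theta>" for n w
    by (rule sat_supported[OF m]) (use a in \<open>auto simp: dec_pr split: nat.split\<close>)
  obtain C0 where C0: "C0 \<in> Sets" "\<And>L. tarski v L \<theta> \<longleftrightarrow> (\<forall>c. \<exists>r. pr c r \<in> C0 \<and> true_lit L r)"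
    using clausal_tarski[OF v] unfolding clausal_def by blast
  \<comment> \<open>Clause 0 demands that \<open>\<theta>\<close> be true at the environment coded
    by \<open>pr n a\<close>; the clauses \<open>d + 1\<close> are Tarski's conditions and do not
    depend on \<open>n\<close>.\<close>
  define C where "C = {z. \<exists>n p. z = pr n p \<and> (\<exists>c r. p = pr c r \<and>
    (c = 0 \<and> r = pr (pr (code \<theta>) (pr n a)) 0 \<or> (\<exists>d. c = d + 1 \<and> pr d r \<in> C0)))}"
  have C: "pr n (pr c r) \<in> C \<longleftrightarrow> c = 0 \<and> r = pr (pr (code \<theta>) (pr n a)) 0 \<or> (\<exists>d. c = d + 1 \<and> pr d r \<in> C0)"
    for n c r by (simp add: C_def)
  have "C \<in> Sets" unfolding C_def by (intro Sets_pr bd_pr_intros C0(1))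
  then have "{n. \<exists>L\<in>Sets. satisfies C n L} \<in> Sets"
    by (rule satisfiability_comprehension[OF ham])
  moreover have satisfies_iff: "satisfies C n L \<longleftrightarrow> pr (code \<theta>) (pr n a) \<in> L \<and> tarski v L \<theta>" for n L
  proof -
    have "satisfies C n L \<longleftrightarrow> (\<exists>r. pr n (pr 0 r) \<in> C \<and> true_lit L r) \<and>
        (\<forall>d. \<exists>r. pr n (pr (d + 1) r) \<in> C \<and> true_lit L r)"
      unfolding satisfies_def using zero_or_succ by metis
    then show ?thesis unfolding C C0(2) by simp
  qed
  have "(\<exists>L\<in>Sets. satisfies C n L) \<longleftrightarrow> (\<exists>X\<in>Sets. sat struct (case_nat n e) (case_nat X v) \<theta>)" for n
  proof
    assume "\<exists>L\<in>Sets. satisfies C n L"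
    then obtain L where L: "L \<in> Sets" "pr (code \<theta>) (pr n a) \<in> L" "tarski v L \<theta>"
      unfolding satisfies_iff by blast
    \<comment> \<open>The slice at 0 of a satisfying assignment is the required witness.\<close>
    have "{x. pr 0 x \<in> L} \<in> Sets" by (intro Sets_bd bd_pr_intros L(1))
    moreover have "sat struct (case_nat n e) (case_nat {x. pr 0 x \<in> L} v) \<theta>"
      using tarski_truth[OF refl \<theta> L(3)] L(2) unfolding sat_a[symmetric] by blast
    ultimately show "\<exists>X\<in>Sets. sat struct (case_nat n e) (case_nat X v) \<theta>" by blast
  next
    assume "\<exists>X\<in>Sets. sat struct (case_nat n e) (case_nat X v) \<theta>"
    then obtain X where X: "X \<in> Sets" "sat struct (dec (pr n a)) (case_nat X v) \<theta>"
      unfolding sat_a by blast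
    obtain L where L: "L \<in> Sets" "\<And>x. pr 0 x \<in> L \<longleftrightarrow> x \<in> X"
      "\<And>\<psi> a. \<psi> \<in> subformulas \<theta> \<Longrightarrow> pr (code \<psi>) a \<in> L \<longleftrightarrow> sat struct (dec a) (case_nat X v) \<psi>"
      using truth_set_exists[OF ham v X(1) finite_subformulas[of \<theta>]] arithmetical_subformulas[OF \<theta>]
      by blast
    have "tarski v L \<theta>" using L(2,3) by (rule truth_tarski)
    moreover have "pr (code \<theta>) (pr n a) \<in> L"
      using L(3)[OF self_in_subformulas] X(2) by blast
    ultimately show "\<exists>L\<in>Sets. satisfies C n L" using L(1) unfolding satisfies_iff by blast
  qed
  with \<open>{n. \<exists>L\<in>Sets. satisfies C n L} \<in> Sets\<close> show ?thesis by simp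
qed


section \<open>The equivalence\<close>

lemma sat_comprehension_struct:
  "sat struct e v (comprehension \<phi>) \<longleftrightarrow> {x. sat struct (case_nat x e) v \<phi>} \<in> Sets"
  unfolding sat_comprehension struct_simps by simp

lemma hamilton_comprehension_imp_Pi11:
  assumes ham: "hamilton_comprehension TYPE('a::rca0_model)"
  shows "models (struct :: 'a l2_structure) Pi11_CA0"
  unfolding models_def
proof (intro conjI ballI allI impI)
  show "s_sets (struct :: 'a l2_structure) \<noteq> {}" using Sets_nonempty by simp
  fix \<phi> and e :: "nat \<Rightarrow> 'a" and v :: "nat \<Rightarrow> 'a set"
  assume "\<phi> \<in> Pi11_CA0" and v: "range v \<subseteq> s_sets struct"
  then consider "\<phi> \<in> RCA0" | \<theta> where "\<phi> = comprehension (AllS \<theta>)" "arithmetical \<theta>"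
    unfolding Pi11_CA0_def Pi11_def by blast
  then show "sat struct e v \<phi>"
  proof cases
    case 1
    then show ?thesis using struct_models_RCA0[where 'a='a] v unfolding models_def by blast
  next
    case 2
    have "arithmetical (\<^bold>\<not> \<theta>)" using 2(2) by simp
    then have "{n. \<exists>X\<in>Sets. sat struct (case_nat n e) (case_nat X v) (\<^bold>\<not> \<theta>)} \<in> Sets"
      using v by (intro Sigma11_comprehension[OF ham]) simp_all
    from Sets_complement[OF this] show ?thesis
      unfolding 2(1) sat_comprehension_struct by simp
  qed
qed

lemma Pi11_imp_hamilton_comprehension:
  assumes Pi11: "models (struct :: 'a::rca0_model l2_structure) Pi11_CA0"
  shows "hamilton_comprehension TYPE('a)"
  unfolding hamilton_comprehension_def
proof (intro ballI impI)
  fix V E :: "'a set"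
  assume VE: "V \<in> Sets" "E \<in> Sets"
  let ?\<psi> = "AllS (\<^bold>\<not> hamilton_path 0 (Suc 0) (Suc 1) 0)"
  let ?v = "case_nat V (\<lambda>_. E)"
  have "?\<psi> \<in> Pi11"
    by (simp add: Pi11_def hamilton_path_def path_def total_function_def edge_in_def vertex_in_def)
  then have "comprehension ?\<psi> \<in> Pi11_CA0" unfolding Pi11_CA0_def by blast
  moreover have "range ?v \<subseteq> Sets" using VE by (intro range_case_nat) auto
  ultimately have "sat struct (\<lambda>_. 0) ?v (comprehension ?\<psi>)"
    using Pi11 unfolding models_def struct_simps by blast
  from Sets_complement[OF this[unfolded sat_comprehension_struct]]
  have "{x. \<exists>X\<in>Sets. sat struct (case_nat x (\<lambda>_. 0)) (case_nat X ?v) (hamilton_path 0 (Suc 0) (Suc 1) 0)} \<in> Sets"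
    by simp
  then show "{i. \<exists>F. hamilton V E i F} \<in> Sets"
    unfolding hamilton_path_iff by simp
qed

theorem theorem30:
  "equivalent_over RCA0 Pi11_CA0 {hamilton_sets_exist}"
proof -
  have "models (struct :: number l2_structure) Pi11_CA0 \<longleftrightarrow> models (struct :: number l2_structure) {hamilton_sets_exist}"
    using hamilton_comprehension_imp_Pi11 Pi11_imp_hamilton_comprehension
    unfolding models_hamilton_sets_exist by blast
  then have "equivalence_holds chosen_structure"
    unfolding models_number equivalence_holds_def .
  \<comment> \<open>The chosen structure would be a counterexample if there were one, so the
    equivalence passes to all models with carrier \<open>nat\<close>; completeness needs no
    others.\<close>
  then have equiv: "models M Pi11_CA0 \<longleftrightarrow> models M {hamilton_sets_exist}" if "models M RCA0" for M :: "nat l2_structure"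
    using chosen_structure_refutes that unfolding equivalence_holds_def by blast
  have basic: "basic_axioms \<subseteq> RCA0" unfolding RCA0_def by blast
  have complete: "T \<turnstile> \<phi>" if "RCA0 \<subseteq> T" "\<And>M :: nat l2_structure. models M T \<Longrightarrow> models M {\<phi>}" for T \<phi>
  proof (rule ccontr)
    assume "\<not> T \<turnstile> \<phi>"
    moreover have "bij (\<lambda>n :: nat. n)" by (simp add: bij_def)
    moreover have "basic_axioms \<subseteq> T" using basic that(1) by blast
    ultimately obtain M :: "nat l2_structure" and e v
      where "models M T" "range v \<subseteq> s_sets M" "\<not> sat M e v \<phi>"
      using completeness by blast
    with that(2)[of M] show False unfolding models_def by blast
  qed
  have sub: "models M A" if "models M B" "A \<subseteq> B" for M :: "nat l2_structure" and A B
    using that unfolding models_def by blast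
  show ?thesis
    unfolding equivalent_over_def
  proof (intro conjI ballI)
    fix \<phi> assume "\<phi> \<in> {hamilton_sets_exist}"
    then show "RCA0 \<union> Pi11_CA0 \<turnstile> \<phi>"
      using equiv sub by (intro complete) blast+
  next
    fix \<phi> assume "\<phi> \<in> Pi11_CA0"
    show "RCA0 \<union> {hamilton_sets_exist} \<turnstile> \<phi>"
    proof (rule complete)
      fix M :: "nat l2_structure"
      assume M: "models M (RCA0 \<union> {hamilton_sets_exist})"
      have "models M Pi11_CA0" using equiv sub[OF M] by blast
      then show "models M {\<phi>}" by (rule sub) (use \<open>\<phi> \<in> Pi11_CA0\<close> in simp)
    qed blast
  qed
qed

end
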